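(* Let $\alpha\in(0,1)$, $\beta\in(0,2]$ and let $d\in\mathbb{Z}_+$ satisfy $d\ge\beta$. There exists a sequence $(u_n)_{n=1}^\infty$ of smooth, positive solutions to the equation $$\partial_t^\alpha\big(u_n-u_n|_{t=0}\big)+(-\Delta)^{\beta/2}u_n=0\quad\text{in }(0,\infty)\times\mathbb{R}^d$$ such that $$\frac{u_n(t_1,0)}{u_n(t_2,x_0)}\to\infty\quad\text{as } n\to\infty$$ for each pair of time levels $t_1,t_2>0$ and for each $x_0\in\mathbb{R}^d$ with $x_0\neq0$. This contradicts the local Harnack inequality $\sup_{Q^-}u\le C\inf_{Q^+}u$ for nonnegative solutions.
   Context: For $0<\alpha<1$, $\partial_t^\alpha$ is the Riemann-Liouville fractional derivative in time, $$\partial_t^\alpha f(t)=\frac{d}{dt}\,\frac{1}{\Gamma(1-\alpha)}\int_0^t(t-\tau)^{-\alpha}f(\tau)\,d\tau .$$ $(-\Delta)^{\beta/2}$ acts in the space variable as the Fourier multiplier with symbol $|\xi|^\beta$ (so it is $-\Delta$ for $\beta=2$). Under suitable conditions on $u_0$, the classical solution of the Cauchy problem $\partial_t^\alpha(u-u_0)+(-\Delta)^{\beta/2}u=0$, $u(0,x)=u_0(x)$, is given by $u(t,x)=\int_{\mathbb{R}^d}Z(t,x-y)u_0(y)\,dy$. Here $Z$ is the fundamental solution, i.e. for each $t>0$ the probability density $Z(t,\cdot)$ on $\mathbb{R}^d$ (continuous on $\mathbb{R}^d\setminus\{0\}$) with Fourier transform $\widehat Z(t,\xi)=(2\pi)^{-d/2}E_\alpha(-|\xi|^\beta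 t^\alpha)$, where $\widehat f(\xi)=(2\pi)^{-d/2}\int_{\mathbb{R}^d}e^{-ix\cdot\xi}f(x)\,dx$ and $E_\alpha(z)=\sum_{k=0}^\infty z^k/\Gamma(1+\alpha k)$ is the Mittag-Leffler function. The local Harnack inequality referred to is the statement that $\sup_{Q^-}u\le C\inf_{Q^+}u$ holds for nonnegative solutions on time-lagged, properly scaled space-time cylinders $Q^-$ and $Q^+$, with a constant $C>0$ that depends neither on the initial datum $u_0$, nor on the solution $u$, nor on the scaling. *)

theory Defs
  imports "HOL-Analysis.Analysis"
begin

definition rl_kernel_integral :: "real \<Rightarrow> (real \<Rightarrow> real) \<Rightarrow> real \<Rightarrow> real" where
  "rl_kernel_integral \<alpha> f t =
     1 / Gamma (1 - \<alpha>) * (LBINT \<tau>:{0..t}. (t - \<tau>) powr (- \<alpha>) * f \<tau>)"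

(* The integrability clause is needed because the Bochner integral of a non-integrable
   function is 0 by convention. *)
definition has_rl_derivative :: "real \<Rightarrow> (real \<Rightarrow> real) \<Rightarrow> real \<Rightarrow> real \<Rightarrow> bool" where
  "has_rl_derivative \<alpha> f D t \<longleftrightarrow>
     (\<forall>s>0. set_integrable lborel {0..s} (\<lambda>\<tau>. (s - \<tau>) powr (- \<alpha>) * f \<tau>)) \<and>
     (rl_kernel_integral \<alpha> f has_real_derivative D) (at t)"

definition fourier :: "('a::euclidean_space \<Rightarrow> complex) \<Rightarrow> 'a \<Rightarrow> complex" where
  "fourier f \<xi> = of_real ((2 * pi) powr (- real DIM('a) / 2)) *
     (LINT x|lborel. exp (- (\<i> * of_real (x \<bullet> \<xi>))) * f x)"

definition inverse_fourier :: "('a::euclidean_space \<Rightarrow> complex) \<Rightarrow> 'a \<Rightarrow> complex" where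
  "inverse_fourier g x = of_real ((2 * pi) powr (- real DIM('a) / 2)) *
     (LINT \<xi>|lborel. exp (\<i> * of_real (x \<bullet> \<xi>)) * g \<xi>)"

definition frac_laplacian :: "real \<Rightarrow> ('a::euclidean_space \<Rightarrow> complex) \<Rightarrow> 'a \<Rightarrow> complex" where
  "frac_laplacian \<beta> f = inverse_fourier (\<lambda>\<xi>. of_real (norm \<xi> powr \<beta>) * fourier f \<xi>)"

(* The functions for which both integrals in the Fourier multiplier are absolutely convergent,
   so that the multiplier is defined pointwise. *)
definition frac_laplacian_dom :: "real \<Rightarrow> ('a::euclidean_space \<Rightarrow> complex) \<Rightarrow> bool" where
  "frac_laplacian_dom \<beta> f \<longleftrightarrow> integrable lborel f \<and>
     integrable lborel (\<lambda>\<xi>. of_real (norm \<xi> powr \<beta>) * fourier f \<xi>)"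

(* Continuity down to t = 0 makes u 0 the trace of u at t = 0; without it the value u 0 would be
   unrelated to the values at positive times. *)
definition classical_solution ::
  "real \<Rightarrow> real \<Rightarrow> (real \<Rightarrow> 'a::euclidean_space \<Rightarrow> real) \<Rightarrow> bool" where
  "classical_solution \<alpha> \<beta> u \<longleftrightarrow>
     continuous_on ({0..} \<times> UNIV) (\<lambda>(t, x). u t x) \<and>
     (\<forall>t>0. frac_laplacian_dom \<beta> (\<lambda>x. of_real (u t x))) \<and>
     (\<forall>t>0. \<forall>x. \<exists>D. has_rl_derivative \<alpha> (\<lambda>\<tau>. u \<tau> x - u 0 x) D t \<and>
        of_real D + frac_laplacian \<beta> (\<lambda>y. of_real (u t y)) x = 0)"

primrec C_k_on ::
  "nat \<Rightarrow> 'b::real_normed_vector set \<Rightarrow> ('b \<Rightarrow> 'c::real_normed_vector) \<Rightarrow> bool" where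
  "C_k_on 0 S f \<longleftrightarrow> continuous_on S f"
| "C_k_on (Suc k) S f \<longleftrightarrow> (\<forall>x\<in>S. f differentiable (at x)) \<and>
     (\<forall>v. C_k_on k S (\<lambda>x. frechet_derivative f (at x) v))"

(* Meaningful for open S, because C_k_on uses two-sided derivatives. *)
definition smooth_on :: "'b::real_normed_vector set \<Rightarrow> ('b \<Rightarrow> 'c::real_normed_vector) \<Rightarrow> bool" where
  "smooth_on S f \<longleftrightarrow> (\<forall>k. C_k_on k S f)"

(* Times scale like length to the power \<beta> / \<alpha>, the parabolic scaling of the equation. *)
definition cylinder :: "real \<Rightarrow> real \<Rightarrow> real \<Rightarrow> real \<Rightarrow> real \<Rightarrow> real \<Rightarrow> 'a::euclidean_space \<Rightarrow> real
    \<Rightarrow> (real \<times> 'a) set" where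
  "cylinder \<alpha> \<beta> a b \<delta> t\<^sub>0 x\<^sub>0 r =
     {t\<^sub>0 + a * r powr (\<beta> / \<alpha>) <..< t\<^sub>0 + b * r powr (\<beta> / \<alpha>)} \<times> ball x\<^sub>0 (\<delta> * r)"

(* The shape of the two cylinders is fixed by a\<^sub>1, a\<^sub>2, \<delta>\<^sub>1 (earlier one) and a\<^sub>3, a\<^sub>4, \<delta>\<^sub>2 (later one);
   C may depend on the shape, but not on the position (t\<^sub>0, x\<^sub>0), the scale r or the solution.
   The type token only fixes the space. Extended reals, as the supremum may be infinite. *)
definition local_harnack ::
  "'a::euclidean_space itself \<Rightarrow> real \<Rightarrow> real \<Rightarrow> real \<Rightarrow> real \<Rightarrow> real \<Rightarrow> real \<Rightarrow> real \<Rightarrow> real \<Rightarrow> bool" where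
  "local_harnack TYPE('a) \<alpha> \<beta> a\<^sub>1 a\<^sub>2 \<delta>\<^sub>1 a\<^sub>3 a\<^sub>4 \<delta>\<^sub>2 \<longleftrightarrow>
     (\<exists>C>0. \<forall>t\<^sub>0\<ge>0. \<forall>x\<^sub>0::'a. \<forall>r>0. \<forall>u.
        classical_solution \<alpha> \<beta> u \<and> (\<forall>t\<ge>0. \<forall>x. u t x \<ge> 0) \<longrightarrow>
        (SUP (t, x) \<in> cylinder \<alpha> \<beta> a\<^sub>1 a\<^sub>2 \<delta>\<^sub>1 t\<^sub>0 x\<^sub>0 r. ereal (u t x))
          \<le> ereal C * (INF (t, x) \<in> cylinder \<alpha> \<beta> a\<^sub>3 a\<^sub>4 \<delta>\<^sub>2 t\<^sub>0 x\<^sub>0 r. ereal (u t x)))"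

end

theory Submission
  imports Defs "HOL-Probability.Characteristic_Functions" "HOL-Real_Asymp.Real_Asymp"
begin

text \<open>
  Let \<open>E(x) = (\<Sum>k. (- x) ^ k / Gamma (1 + \<alpha> k))\<close>, the Mittag-Leffler function on the negative half
  line.  The solutions are
    \<open>u t x = \<integral> cos (x \<bullet> \<xi>) * E (norm \<xi> powr \<beta> * t powr \<alpha>) * exp (- \<epsilon> * (norm \<xi>)\<^sup>2) d\<xi>\<close>
  with \<open>\<epsilon> = 1 / (n + 1)\<close>: up to a constant factor, the solutions whose initial value is a Gaussian that
  concentrates at the origin as \<open>n\<close> grows.  They approximate a multiple of the fundamental solution, which is finite away
  from the origin but, for \<open>d \<ge> \<beta>\<close>, infinite at the origin at every positive time.

  Away from the origin one needs \<open>u > 0\<close> and a bound that does not depend on \<open>\<epsilon>\<close>.  Both hold because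
  \<open>z \<mapsto> E (z powr (\<beta> / 2) * t powr \<alpha>)\<close> is a mixture of exponentials \<open>exp (- r * z)\<close> with \<open>r \<ge> 0\<close>: then
  \<open>u t\<close> is the same mixture of Gaussians, and for fixed \<open>x \<noteq> 0\<close> the heat kernels of all times have a common bound
  (\<open>heat_kernel_le\<close>).  Bernstein's theorem and mixing measures are avoided: \<open>laplace_mixture\<close> is the
  closure of the exponentials under sums, nonnegative multiples and pointwise limits, and the two estimates survive these
  operations (\<open>mixture_transform_bounds\<close>).  Fractional powers of \<open>z\<close> are admitted by a binomial
  expansion (\<open>laplace_mixture_exp_powr\<close>).  The function \<open>E\<close> itself is the limit of an implicit time
  discretisation of \<open>\<partial>\<^sub>t\<^sup>\<alpha> (f - 1) = - x f\<close>: each step of it only multiplies by \<open>1 / (1 + q)\<close> and takes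
  nonnegative combinations (\<open>resolvent_recursion\<close>, \<open>mittag_leffler_laplace_mixture\<close>).

  At the origin, \<open>E (x) \<ge> 1 / (1 + Gamma (1 - \<alpha>) * x)\<close> (\<open>mittag_leffler_lower_bound\<close>), so
  \<open>E (norm \<xi> powr \<beta> * t powr \<alpha>)\<close> decays no faster than \<open>norm \<xi> powr (- \<beta>)\<close>.  For
  \<open>d \<ge> \<beta>\<close> every dyadic shell contributes a fixed amount to its integral, and \<open>u t 0\<close> tends to infinity
  (\<open>symbol_ball_integral_ge\<close>, \<open>gaussian_solution_origin_blowup\<close>).

  The equation is checked on the Fourier side.  Fourier inversion is available because \<open>u\<close> is nonnegative
  (\<open>fourier_inversion_nonneg\<close>), so the fractional Laplacian multiplies the
  integrand by \<open>norm \<xi> powr \<beta>\<close>;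
  Beta integrals show that the fractional integral of \<open>E (l * \<tau> powr \<alpha>) - 1\<close> is \<open>- l\<close> times the ordinary
  integral of \<open>E (l * \<tau> powr \<alpha>)\<close> (\<open>abel_integral_relaxation\<close>).  Smoothness follows by differentiating
  under the integral sign: the derivatives of \<open>E\<close> are, up to sign, again mixtures of exponentials and hence bounded.
  Finally, a Harnack constant for cylinders centred at the origin would bound the ratio of the values at
  \<open>(t\<^sub>1, 0)\<close> and \<open>(t\<^sub>2, x\<^sub>0)\<close>.
\<close>

section \<open>Pointwise limits of positive combinations of exponentials\<close>

text \<open>
  Up to the behaviour outside \<open>[0, \<infinity>)\<close>, these are the Laplace transforms of finite measures on
  \<open>[0, \<infinity>]\<close>, where the point \<open>\<infinity>\<close> stands for the indicator function of \<open>{0}\<close>.  The inductive form makes every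
  estimate that holds for exponentials and is stable under the three operations hold for all of them, without
  a representation theorem.
\<close>

inductive laplace_mixture :: "(real \<Rightarrow> real) \<Rightarrow> bool" where
  exp: "0 \<le> r \<Longrightarrow> laplace_mixture (\<lambda>x. exp (- r * x))"
| add: "laplace_mixture F \<Longrightarrow> laplace_mixture G \<Longrightarrow> laplace_mixture (\<lambda>x. F x + G x)"
| scale: "0 \<le> c \<Longrightarrow> laplace_mixture F \<Longrightarrow> laplace_mixture (\<lambda>x. c * F x)"
| limit: "(\<And>n. laplace_mixture (F n)) \<Longrightarrow> (\<And>x. 0 \<le> x \<Longrightarrow> (\<lambda>n. F n x) \<longlonglongrightarrow> G x) \<Longrightarrow>
    laplace_mixture G"

lemma laplace_mixture_const: "0 \<le> c \<Longrightarrow> laplace_mixture (\<lambda>_. c)"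
  using laplace_mixture.scale[OF _ laplace_mixture.exp[of 0], of c] by simp

lemma laplace_mixture_sum:
  "(\<And>i. i \<in> I \<Longrightarrow> laplace_mixture (F i)) \<Longrightarrow> laplace_mixture (\<lambda>x. \<Sum>i\<in>I. F i x)"
  by (induction I rule: infinite_finite_induct)
     (auto intro: laplace_mixture_const laplace_mixture.add)

lemma laplace_mixture_sums:
  assumes "\<And>k. laplace_mixture (F k)" "\<And>x. 0 \<le> x \<Longrightarrow> (\<lambda>k. F k x) sums G x"
  shows "laplace_mixture G"
  by (rule laplace_mixture.limit[of "\<lambda>n x. \<Sum>k<n. F k x"])
     (use assms in \<open>auto intro: laplace_mixture_sum simp: sums_def\<close>)

text \<open>
  Substitution \<open>x \<mapsto> g x\<close> commutes with sums, multiples and limits, so only the exponentials need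
  to be checked.
\<close>

lemma laplace_mixture_compose:
  assumes F: "laplace_mixture F"
    and g: "\<And>r. 0 \<le> r \<Longrightarrow> laplace_mixture (\<lambda>x. exp (- r * g x))" "\<And>x. 0 \<le> x \<Longrightarrow> 0 \<le> g x"
  shows "laplace_mixture (\<lambda>x. F (g x))"
  using F
proof induction
  case (limit F G)
  show ?case by (rule laplace_mixture.limit[of "\<lambda>n x. F n (g x)"]) (use limit g in auto)
qed (auto intro: laplace_mixture.intros g)

lemma laplace_mixture_dilate:
  "laplace_mixture F \<Longrightarrow> 0 \<le> c \<Longrightarrow> laplace_mixture (\<lambda>x. F (c * x))"
proof (erule laplace_mixture_compose)
  fix r :: real assume "0 \<le> c" "0 \<le> r"
  then show "laplace_mixture (\<lambda>x. exp (- r * (c * x)))"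
    using laplace_mixture.exp[of "r * c"] by (simp add: mult.assoc)
qed auto

text \<open>
  Products of exponentials are exponentials; two inductions extend this to both factors.
\<close>

lemma laplace_mixture_mult:
  assumes F: "laplace_mixture F" and G: "laplace_mixture G"
  shows "laplace_mixture (\<lambda>x. F x * G x)"
proof -
  have exp_mult: "laplace_mixture (\<lambda>x. exp (- r * x) * G x)" if "0 \<le> r" for r
    using G
  proof induction
    case (exp s)
    have "laplace_mixture (\<lambda>x. exp (- (r + s) * x))"
      using exp that by (intro laplace_mixture.exp) auto
    then show ?case by (simp add: exp_add[symmetric] algebra_simps)
  next
    case (add F G)
    then show ?case by (simp add: distrib_left laplace_mixture.add)
  next
    case (scale c F)
    then show ?case using laplace_mixture.scale[OF scale.hyps(1) scale.IH]
      by (simp add: algebra_simps)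
  next
    case (limit F G)
    show ?case
      by (rule laplace_mixture.limit[of "\<lambda>n x. exp (- r * x) * F n x"])
         (use limit in \<open>auto intro: tendsto_intros\<close>)
  qed
  show ?thesis
    using F
  proof induction
    case (exp s)
    then show ?case using exp_mult by simp
  next
    case (add F G)
    then show ?case by (simp add: distrib_right laplace_mixture.add)
  next
    case (scale c F)
    then show ?case using laplace_mixture.scale[OF scale.hyps(1) scale.IH]
      by (simp add: algebra_simps)
  next
    case (limit F' G')
    show ?case
      by (rule laplace_mixture.limit[of "\<lambda>n x. F' n x * G x"])
         (use limit in \<open>auto intro: tendsto_intros\<close>)
  qed
qed

lemma laplace_mixture_power: "laplace_mixture F \<Longrightarrow> laplace_mixture (\<lambda>x. F x ^ k)"
  by (induction k) (auto intro: laplace_mixture_const laplace_mixture_mult)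

lemma laplace_mixture_exp:
  assumes "laplace_mixture F"
  shows "laplace_mixture (\<lambda>x. exp (F x))"
proof (rule laplace_mixture_sums)
  show "laplace_mixture (\<lambda>x. inverse (fact k) * F x ^ k)" for k
    by (intro laplace_mixture.scale laplace_mixture_power assms) auto
  show "(\<lambda>k. inverse (fact k) * F x ^ k) sums exp (F x)" for x
    using exp_converges[of "F x"] by (simp add: divideR_right)
qed

lemma laplace_mixture_bounds:
  assumes "laplace_mixture F" "0 \<le> x"
  shows "0 \<le> F x" "F x \<le> F 0"
proof -
  have "0 \<le> F x \<and> F x \<le> F 0"
    using assms
  proof (induction)
    case (limit F G)
    have "0 \<le> G x" by (rule LIMSEQ_le_const[of "\<lambda>n. F n x"]) (use limit in auto)
    moreover have "G x \<le> G 0" by (rule LIMSEQ_le[of "\<lambda>n. F n x" _ "\<lambda>n. F n 0"]) (use limit in auto)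
    ultimately show ?case by blast
  qed (auto intro: mult_left_mono)
  then show "0 \<le> F x" "F x \<le> F 0" by auto
qed

text \<open>
  On an exponential the decrement is multiplication by the nonnegative number \<open>1 - exp (- r * h)\<close>.
  Difference quotients then give the next lemma: the class is stable under \<open>- d/dx\<close>.
\<close>

lemma laplace_mixture_decrement:
  assumes "laplace_mixture F" "0 \<le> h"
  shows "laplace_mixture (\<lambda>x. F x - F (x + h))"
  using assms
proof induction
  case (exp r)
  have "laplace_mixture (\<lambda>x. (1 - exp (- r * h)) * exp (- r * x))"
    using exp by (intro laplace_mixture.scale laplace_mixture.exp) auto
  then show ?case by (simp add: algebra_simps exp_add[symmetric])
next
  case (add F G)
  have "laplace_mixture (\<lambda>x. (F x - F (x + h)) + (G x - G (x + h)))"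
    using add by (intro laplace_mixture.add) auto
  then show ?case by (simp add: algebra_simps)
next
  case (scale c F)
  have "laplace_mixture (\<lambda>x. c * (F x - F (x + h)))"
    using scale by (intro laplace_mixture.scale) auto
  then show ?case by (simp add: algebra_simps)
next
  case (limit F G)
  show ?case by (rule laplace_mixture.limit[of "\<lambda>n x. F n x - F n (x + h)"])
      (use limit in \<open>auto intro: tendsto_intros\<close>)
qed

lemma laplace_mixture_deriv:
  assumes F: "laplace_mixture F" and F': "\<And>x. 0 \<le> x \<Longrightarrow> (F has_real_derivative F' x) (at x)"
  shows "laplace_mixture (\<lambda>x. - F' x)"
proof (rule laplace_mixture.limit)
  show "laplace_mixture (\<lambda>x. real (Suc n) * (F x - F (x + 1 / real (Suc n))))" for n
    by (intro laplace_mixture.scale laplace_mixture_decrement F) auto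
  fix x :: real assume "0 \<le> x"
  have "((\<lambda>h. (F (x + h) - F x) / h) \<longlongrightarrow> F' x) (at 0)"
    using F'[OF \<open>0 \<le> x\<close>] by (simp add: DERIV_def)
  moreover have "filterlim (\<lambda>n. 1 / real (Suc n)) (at 0) sequentially"
    by (intro filterlim_atI always_eventually) (rule LIMSEQ_Suc[OF lim_1_over_n], simp)
  ultimately have "(\<lambda>n. (F (x + 1 / real (Suc n)) - F x) / (1 / real (Suc n))) \<longlonglongrightarrow> F' x"
    by (rule filterlim_compose)
  then have "(\<lambda>n. - ((F (x + 1 / real (Suc n)) - F x) / (1 / real (Suc n)))) \<longlonglongrightarrow> - F' x"
    by (rule tendsto_minus)
  then show "(\<lambda>n. real (Suc n) * (F x - F (x + 1 / real (Suc n)))) \<longlonglongrightarrow> - F' x"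
    by (simp add: algebra_simps)
qed

lemma laplace_mixture_measurable:
  assumes "laplace_mixture F" and [measurable]: "h \<in> borel_measurable M" and "\<And>\<xi>. 0 \<le> h \<xi>"
  shows "(\<lambda>\<xi>. F (h \<xi>)) \<in> borel_measurable M"
  using assms(1)
proof induction
  case (limit F G)
  show ?case
    by (rule borel_measurable_LIMSEQ_real[of _ "\<lambda>n \<xi>. F n (h \<xi>)"]) (use limit assms in auto)
next
  case (add F G)
  from add.IH[measurable] show ?case by measurable
next
  case (scale c F)
  from scale.IH[measurable] show ?case by measurable
qed measurable

lemma exp_difference_quotient_tendsto:
  fixes c :: real
  shows "(\<lambda>n. real (Suc n) * (1 - exp (- (1 / real (Suc n)) * c))) \<longlonglongrightarrow> c"
proof -
  have "((\<lambda>h::real. exp (- h * c)) has_real_derivative (- c)) (at 0)"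
    by (auto intro!: derivative_eq_intros)
  then have "((\<lambda>h. (exp (- h * c) - 1) / h) \<longlongrightarrow> - c) (at 0)"
    by (simp add: DERIV_def)
  then have "((\<lambda>h. - ((exp (- h * c) - 1) / h)) \<longlongrightarrow> - (- c)) (at 0)"
    by (intro tendsto_intros)
  moreover have "filterlim (\<lambda>n. 1 / real (Suc n)) (at 0) sequentially"
    by (intro filterlim_atI always_eventually) (rule LIMSEQ_Suc[OF lim_1_over_n], simp)
  ultimately have "(\<lambda>n. - ((exp (- (1 / real (Suc n)) * c) - 1) / (1 / real (Suc n)))) \<longlonglongrightarrow> - (- c)"
    by (rule filterlim_compose)
  moreover have "- ((E - 1) / (1 / a)) = a * (1 - E)" for E a :: real
    by (simp add: algebra_simps)
  ultimately show ?thesis by simp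
qed

text \<open>
  Riemann sums of \<open>1 / (1 + x) = \<integral> exp (- s * (1 + x)) ds\<close>, which are geometric series.
\<close>

lemma laplace_mixture_inverse: "laplace_mixture (\<lambda>x. 1 / (1 + x))"
proof (rule laplace_mixture.limit)
  let ?h = "\<lambda>n. 1 / real (Suc n)"
  show "laplace_mixture (\<lambda>x. ?h n / (1 - exp (- ?h n * (1 + x))))" for n
  proof (rule laplace_mixture_sums)
    show "laplace_mixture (\<lambda>x. (?h n * exp (- ?h n * real k)) * exp (- (?h n * real k) * x))" for k
      by (intro laplace_mixture.scale laplace_mixture.exp) auto
    fix x :: real assume "0 \<le> x"
    then have "norm (exp (- ?h n * (1 + x))) < 1" by simp
    from sums_mult[OF geometric_sums[OF this], of "?h n"]
    moreover have "?h n * exp (- ?h n * (1 + x)) ^ k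
        = (?h n * exp (- ?h n * real k)) * exp (- (?h n * real k) * x)" for k
    proof -
      have "exp (- ?h n * (1 + x)) ^ k = exp (- ?h n * real k + - (?h n * real k) * x)"
        unfolding exp_of_nat_mult[symmetric] by (rule arg_cong[of _ _ exp]) (simp add: algebra_simps add_divide_distrib)
      then show ?thesis by (simp only: exp_add mult.assoc)
    qed
    ultimately show "(\<lambda>k. (?h n * exp (- ?h n * real k)) * exp (- (?h n * real k) * x)) sums
       (?h n / (1 - exp (- ?h n * (1 + x))))"
      by simp
  qed
  fix x :: real assume "0 \<le> x"
  then have "(\<lambda>n. inverse (real (Suc n) * (1 - exp (- ?h n * (1 + x))))) \<longlonglongrightarrow> inverse (1 + x)"
    by (intro tendsto_inverse exp_difference_quotient_tendsto) auto
  then show "(\<lambda>n. ?h n / (1 - exp (- ?h n * (1 + x)))) \<longlonglongrightarrow> 1 / (1 + x)"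
    by (simp add: inverse_eq_divide)
qed

lemma pochhammer_neg_nonpos:
  fixes a :: real
  assumes "0 \<le> a" "a \<le> 1"
  shows "pochhammer (- a) (Suc k) \<le> 0"
  using assms by (simp add: pochhammer_rec, simp add: pochhammer_prod prod_nonneg)

lemma binomial_complement_sums:
  fixes z :: real
  assumes "\<bar>z\<bar> < 1"
  shows "(\<lambda>k. - (pochhammer (- g) (Suc k) / fact (Suc k)) * z ^ Suc k) sums (1 - (1 - z) powr g)"
proof -
  have "(g gchoose k) * (- z) ^ k = pochhammer (- g) k / fact k * z ^ k" for k
  proof -
    have "(- 1) ^ k * (- z) ^ k = z ^ k" by (simp flip: power_mult_distrib)
    moreover have "(- 1) ^ k * p / f * m = p / f * ((- 1) ^ k * m)" for p f m :: real
      by simp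
    ultimately show ?thesis unfolding gbinomial_pochhammer by metis
  qed
  then have "(\<lambda>k. pochhammer (- g) k / fact k * z ^ k) sums (1 - z) powr g"
    using gen_binomial_real[of "- z" g] assms by simp
  then have "(\<lambda>k. pochhammer (- g) (Suc k) / fact (Suc k) * z ^ Suc k) sums ((1 - z) powr g - 1)"
    by (subst sums_Suc_iff) simp
  from sums_minus[OF this] show ?thesis by (simp del: fact_Suc power_Suc)
qed

text \<open>
  Let \<open>z = (1 - 1/m\<^sup>2) exp (- x / m)\<close> for \<open>m = n + 1\<close>.  Then \<open>m * (1 - z)\<close> tends to \<open>x\<close>, and in
  \<open>exp (- r * m powr g * (1 - z) powr g)\<close> the binomial series turns \<open>1 - (1 - z) powr g\<close> into a combination of powers
  of \<open>z\<close>, that is of exponentials, with nonnegative coefficients.  The factor \<open>1 - 1/m\<^sup>2\<close> keeps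
  \<open>\<bar>z\<bar> < 1\<close> at \<open>x = 0\<close>.
\<close>

lemma laplace_mixture_exp_powr:
  assumes "0 < g" "g \<le> 1" "0 \<le> r"
  shows "laplace_mixture (\<lambda>x. exp (- r * x powr g))"
proof (rule laplace_mixture.limit)
  let ?q = "\<lambda>n. 1 - 1 / real (Suc n) ^ 2"
  let ?z = "\<lambda>n x. ?q n * exp (- (1 / real (Suc n)) * x)"
  let ?a = "\<lambda>k. - (pochhammer (- g) (Suc k) / fact (Suc k))"
  have q: "0 \<le> ?q n" "?q n < 1" for n by (auto simp: field_simps)
  have A: "laplace_mixture (\<lambda>x. 1 - (1 - ?z n x) powr g)" for n
  proof (rule laplace_mixture_sums)
    show "laplace_mixture (\<lambda>x. (?a k * ?q n ^ Suc k) * exp (- (real (Suc k) / real (Suc n)) * x))" for k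
      using pochhammer_neg_nonpos[of g k] assms q(1)[of n]
      by (intro laplace_mixture.scale laplace_mixture.exp mult_nonneg_nonneg)
         (auto simp: divide_nonpos_pos simp del: fact_Suc)
    fix x :: real assume "0 \<le> x"
    then have "?z n x < 1" using q[of n] mult_left_mono[of "exp (- (1 / real (Suc n)) * x)" 1 "?q n"]
      by (auto intro: le_less_trans)
    then have "\<bar>?z n x\<bar> < 1" using q[of n] by (simp add: abs_mult)
    from binomial_complement_sums[OF this, of g]
    have "(\<lambda>k. ?a k * ?z n x ^ Suc k) sums (1 - (1 - ?z n x) powr g)" .
    moreover have "?z n x ^ Suc k = ?q n ^ Suc k * exp (- (real (Suc k) / real (Suc n)) * x)" for k
      unfolding power_mult_distrib exp_of_nat_mult[symmetric] by (simp add: field_simps)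
    ultimately show "(\<lambda>k. (?a k * ?q n ^ Suc k) * exp (- (real (Suc k) / real (Suc n)) * x)) sums
       (1 - (1 - ?z n x) powr g)" by (simp only: mult.assoc)
  qed
  show "laplace_mixture (\<lambda>x. exp (- r * real (Suc n) powr g) * exp (r * real (Suc n) powr g * (1 - (1 - ?z n x) powr g)))" for n
    using assms by (intro laplace_mixture.scale laplace_mixture_exp A) auto
  fix x :: real assume x: "0 \<le> x"
  have eq: "exp (- r * real (Suc n) powr g) * exp (r * real (Suc n) powr g * (1 - (1 - ?z n x) powr g))
     = exp (- r * (real (Suc n) * (1 - ?z n x)) powr g)" for n
  proof -
    define a w where "a = real (Suc n)" and "w = 1 - ?z n x"
    have "0 \<le> a" "0 \<le> w" unfolding a_def w_def using q[of n] x mult_le_one[of "?q n" "exp (- (1 / real (Suc n)) * x)"]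
      by auto
    then have "(a * w) powr g = a powr g * w powr g"
      by (intro powr_mult)
    then have "exp (- r * a powr g) * exp (r * a powr g * (1 - w powr g)) = exp (- r * (a * w) powr g)"
      by (simp add: algebra_simps flip: exp_add)
    then show ?thesis by (simp only: a_def w_def)
  qed
  have lim: "(\<lambda>n. real (Suc n) * (1 - ?z n x)) \<longlonglongrightarrow> x"
  proof -
    have h: "(\<lambda>n. 1 / real (Suc n)) \<longlonglongrightarrow> 0"
      by (rule LIMSEQ_Suc[OF lim_1_over_n])
    then have "(\<lambda>n. real (Suc n) * (1 - exp (- (1 / real (Suc n)) * x))
        + 1 / real (Suc n) * exp (- (1 / real (Suc n)) * x)) \<longlonglongrightarrow> x + 0 * exp (- 0 * x)"
      by (intro tendsto_add exp_difference_quotient_tendsto tendsto_mult tendsto_exp tendsto_minus tendsto_const)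
    moreover have "a * (1 - E) + 1 / a * E = a * (1 - (1 - 1 / a ^ 2) * E)" if "a > 0" for E a :: real
      using that by (simp add: field_simps power2_eq_square)
    ultimately show ?thesis by simp
  qed
  have "?z n x \<le> 1" for n using q[of n] x by (intro mult_le_one) auto
  then have "(\<lambda>n. (real (Suc n) * (1 - ?z n x)) powr g) \<longlonglongrightarrow> x powr g"
    by (intro tendsto_powr'[OF lim tendsto_const]) (use assms in auto)
  then show "(\<lambda>n. exp (- r * real (Suc n) powr g) * exp (r * real (Suc n) powr g * (1 - (1 - ?z n x) powr g)))
      \<longlonglongrightarrow> exp (- r * x powr g)"
    unfolding eq by (intro tendsto_exp tendsto_mult tendsto_const)
qed

lemma laplace_mixture_powr:
  "laplace_mixture F \<Longrightarrow> 0 < g \<Longrightarrow> g \<le> 1 \<Longrightarrow> laplace_mixture (\<lambda>x. F (x powr g))"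
  by (erule laplace_mixture_compose) (rule laplace_mixture_exp_powr, auto)

section \<open>The Mittag-Leffler function as a limit of discrete relaxation equations\<close>

text \<open>
  The \<open>m\<close>-th derivative of \<open>x \<mapsto> (\<Sum>k. (- x) ^ k / Gamma (1 + a * k))\<close>, as the formally differentiated power series.
\<close>

definition mittag_leffler_deriv :: "real \<Rightarrow> nat \<Rightarrow> real \<Rightarrow> real" where
  "mittag_leffler_deriv a m x = (\<Sum>k. (diffs ^^ m) (\<lambda>k. (- 1) ^ k / Gamma (1 + a * real k)) k * x ^ k)"

text \<open>
  The coefficient of \<open>z ^ n\<close> in \<open>(1 - z) powr (- 1 - y)\<close>.
\<close>

definition rising_binomial :: "nat \<Rightarrow> real \<Rightarrow> real" where
  "rising_binomial n y = pochhammer (1 + y) n / fact n"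

lemma rising_binomial_nonneg: "0 \<le> 1 + y \<Longrightarrow> 0 \<le> rising_binomial n y"
  by (auto simp: rising_binomial_def pochhammer_prod intro!: divide_nonneg_pos prod_nonneg)

lemma rising_binomial_Suc: "rising_binomial (Suc n) y = rising_binomial n y * (1 + y / real (Suc n))"
proof -
  have "p * (1 + y + real n) / ((1 + real n) * f) = p / f * (1 + y / (1 + real n))" if "f > 0" for p f :: real
    using that by (simp add: field_simps)
  from this[OF fact_gt_zero] show ?thesis
    unfolding rising_binomial_def by (simp add: pochhammer_Suc)
qed

text \<open>
  Comparison of coefficients in \<open>(1 - z) powr a * (1 - z) powr (- 1 - y) = (1 - z) powr (- 1 - (y - a))\<close>.
\<close>

lemma rising_binomial_vandermonde:
  "(\<Sum>j\<le>n. pochhammer (- a) j / fact j * rising_binomial (n - j) y) = rising_binomial n (y - a)"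
proof -
  have "pochhammer (- a + (1 + y)) n = (\<Sum>j\<le>n. real (n choose j) * pochhammer (- a) j * pochhammer (1 + y) (n - j))"
    by (rule pochhammer_binomial_sum)
  also have "\<dots> = (\<Sum>j\<le>n. fact n * (pochhammer (- a) j / fact j * rising_binomial (n - j) y))"
    by (intro sum.cong) (auto simp: rising_binomial_def binomial_fact)
  finally have "pochhammer (1 + (y - a)) n = fact n * (\<Sum>j\<le>n. pochhammer (- a) j / fact j * rising_binomial (n - j) y)"
    by (simp add: sum_distrib_left algebra_simps)
  then show ?thesis unfolding rising_binomial_def by (simp add: field_simps)
qed

text \<open>
  Monotonicity in \<open>n\<close> supplies the dominating series, at a single index, for the passage to the limit in
  \<open>mittag_leffler_limit\<close>.
\<close>

lemma rising_binomial_scaled_decreasing: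
  assumes "0 \<le> y" "0 < m" "m \<le> n"
  shows "rising_binomial n y / real n powr y \<le> rising_binomial m y / real m powr y"
  using \<open>m \<le> n\<close>
proof (induction rule: dec_induct)
  case (step n)
  define k where "k = real (Suc n)"
  have k: "k > 1" "real n = k - 1" using step \<open>0 < m\<close> by (auto simp: k_def)
  have "1 + y / k \<le> exp (y * (1 / k))" using exp_ge_add_one_self[of "y / k"] by simp
  also have "ln (1 - 1 / k) \<le> - (1 / k)" using ln_le_minus_one[of "1 - 1 / k"] k by simp
  then have "exp (y * (1 / k)) \<le> exp (y * - ln (1 - 1 / k))"
    using \<open>0 \<le> y\<close> by (simp only: exp_le_cancel_iff, intro mult_left_mono) auto
  also have "- ln (1 - 1 / k) = ln (k / real n)"
    using k by (simp add: ln_div diff_divide_eq_iff flip: ln_inverse)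
  also have "exp (y * ln (k / real n)) = (k / real n) powr y"
    using k by (simp add: powr_def)
  also have "\<dots> = k powr y / real n powr y"
    using k by (simp add: powr_divide)
  finally have "1 + y / k \<le> k powr y / real n powr y" .
  moreover have "A / K \<le> 1 / R" if "A \<le> K / R" "K > 0" "R > 0" for A K R :: real
    using that by (simp add: field_simps)
  ultimately have "(1 + y / k) / k powr y \<le> 1 / real n powr y"
    using k by simp
  then have "rising_binomial n y * ((1 + y / k) / k powr y) \<le> rising_binomial n y * (1 / real n powr y)"
    using \<open>0 \<le> y\<close> by (intro mult_left_mono rising_binomial_nonneg) auto
  with step.IH show ?case by (simp add: rising_binomial_Suc k_def)
qed simp

lemma rising_binomial_scaled_tendsto:
  assumes "0 \<le> y"
  shows "(\<lambda>n. rising_binomial n y / real n powr y) \<longlonglongrightarrow> 1 / Gamma (1 + y)"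
proof -
  have "Gamma (1 + y) \<noteq> 0" using Gamma_real_pos[of "1 + y"] assms by linarith
  then have "(\<lambda>n. inverse (Gamma_series' (1 + y) n)) \<longlonglongrightarrow> inverse (Gamma (1 + y))"
    by (intro tendsto_inverse Gamma_series'_LIMSEQ)
  moreover have "\<forall>\<^sub>F n in sequentially. inverse (Gamma_series' (1 + y) n) = rising_binomial n y / real n powr y"
    using eventually_gt_at_top[of 0]
  proof eventually_elim
    case (elim n)
    have "exp ((1 + y) * ln (real n)) = real n * real n powr y"
      using elim by (simp add: powr_def distrib_right exp_add)
    moreover have "fact n = real n * fact (n - 1)" using elim by (simp add: fact_reduce)
    ultimately show ?case
      using elim by (simp add: Gamma_series'_def rising_binomial_def)
  qed
  ultimately show ?thesis by (simp add: tendsto_cong inverse_eq_divide)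
qed

lemma summable_rising_binomial:
  assumes "0 \<le> a" "a \<le> 1" "0 \<le> q" "q < 1"
  shows "summable (\<lambda>k. rising_binomial n (a * real k) * q ^ k)"
proof (rule summable_comparison_test)
  have "summable (\<lambda>k. (- (1 + real n) gchoose k) * (- q) ^ k)"
    using gen_binomial_real[of "- q" "- (1 + real n)"] assms by (simp add: sums_iff)
  moreover have "(- (1 + real n) gchoose k) * (- q) ^ k = rising_binomial n (real k) * q ^ k" for k
  proof -
    have "fact n * pochhammer (1 + real n) k = fact k * pochhammer (1 + real k) n"
      using pochhammer_product'[of "1::real" n k] pochhammer_product'[of "1::real" k n]
      by (simp add: pochhammer_fact add.commute)
    then have "pochhammer (1 + real n) k / fact k = rising_binomial n (real k)"
      by (simp add: rising_binomial_def field_simps)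
    moreover have "(- 1) ^ k * (- q) ^ k = q ^ k" by (simp flip: power_mult_distrib)
    moreover have "(- 1) ^ k * p / f * m = p / f * ((- 1) ^ k * m)" for p f m :: real
      by simp
    ultimately show ?thesis unfolding gbinomial_pochhammer minus_minus by metis
  qed
  ultimately show "summable (\<lambda>k. rising_binomial n (real k) * q ^ k)" by simp
  have "rising_binomial n (a * real k) \<le> rising_binomial n (real k)" for k
    unfolding rising_binomial_def pochhammer_prod using assms
    by (intro divide_right_mono prod_mono) (auto simp: mult_left_le_one_le)
  then show "\<exists>N. \<forall>k\<ge>N. norm (rising_binomial n (a * real k) * q ^ k) \<le> rising_binomial n (real k) * q ^ k"
    using assms by (auto simp: abs_mult rising_binomial_nonneg intro!: mult_right_mono)
qed

text \<open>
  The generating function \<open>\<Sum>n. s n * z ^ n = (1 - z) powr (a - 1) / ((1 - z) powr a + q)\<close> shows that \<open>s\<close> solves the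
  implicit Gruenwald-Letnikov scheme for \<open>\<partial>\<^sub>t\<^sup>a (f - 1) = - q f\<close>.  All weights on the right-hand
  side are nonnegative, because the coefficients of \<open>(1 - z) powr a\<close> are nonpositive except for the first one.
\<close>

lemma resolvent_recursion:
  assumes a: "0 \<le> a" "a \<le> 1" and q: "0 \<le> q" "q < 1"
  defines "s \<equiv> \<lambda>n. \<Sum>k. rising_binomial n (a * real k) * (- q) ^ k"
  shows "s n = 1 / (1 + q) * (rising_binomial n (- a)
      + (\<Sum>j\<in>{1..n}. - (pochhammer (- a) j / fact j) * s (n - j)))"
proof -
  let ?w = "\<lambda>j. pochhammer (- a) j / fact j"
  have summ: "summable (\<lambda>k. rising_binomial n (a * real k) * (- q) ^ k)" for n
    by (rule summable_norm_cancel)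
       (use summable_rising_binomial[of a q n] assms in \<open>auto simp: abs_mult power_abs rising_binomial_nonneg\<close>)
  have sums: "(\<lambda>k. rising_binomial n (a * real k) * (- q) ^ k) sums s n" for n
    using summ[of n] by (simp add: s_def summable_sums)
  have "(\<lambda>k. \<Sum>j\<le>n. ?w j * (rising_binomial (n - j) (a * real k) * (- q) ^ k)) sums (\<Sum>j\<le>n. ?w j * s (n - j))"
    by (intro sums_sum sums_mult sums)
  also have "(\<lambda>k. \<Sum>j\<le>n. ?w j * (rising_binomial (n - j) (a * real k) * (- q) ^ k))
      = (\<lambda>k. rising_binomial n (a * real k - a) * (- q) ^ k)"
    unfolding rising_binomial_vandermonde[symmetric] sum_distrib_right by (simp add: mult.assoc)
  finally have "(\<lambda>k. rising_binomial n (a * real k - a) * (- q) ^ k) sums (\<Sum>j\<le>n. ?w j * s (n - j))" .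
  then have "(\<lambda>k. rising_binomial n (a * real (Suc k) - a) * (- q) ^ Suc k) sums
      ((\<Sum>j\<le>n. ?w j * s (n - j)) - rising_binomial n (- a))"
    by (subst sums_Suc_iff) simp
  moreover have "rising_binomial n (a * real (Suc k) - a) * (- q) ^ Suc k
      = (- q) * (rising_binomial n (a * real k) * (- q) ^ k)" for k
  proof -
    have "a * real (Suc k) - a = a * real k" by (simp add: algebra_simps)
    then show ?thesis by simp
  qed
  ultimately have "(\<lambda>k. (- q) * (rising_binomial n (a * real k) * (- q) ^ k)) sums
      ((\<Sum>j\<le>n. ?w j * s (n - j)) - rising_binomial n (- a))" by (simp only:)
  then have "(\<Sum>j\<le>n. ?w j * s (n - j)) - rising_binomial n (- a) = (- q) * s n"
    using sums_mult[OF sums[of n], of "- q"] by (rule sums_unique2)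
  moreover have "(\<Sum>j\<le>n. ?w j * s (n - j)) = s n + (\<Sum>j\<in>{1..n}. ?w j * s (n - j))"
  proof -
    have "{..n} = insert 0 {1..n}" by auto
    then show ?thesis by simp
  qed
  ultimately have "(1 + q) * s n = rising_binomial n (- a) - (\<Sum>j\<in>{1..n}. ?w j * s (n - j))"
    by (simp add: algebra_simps)
  then show ?thesis using q by (simp add: field_simps sum_negf)
qed

text \<open>
  The series for the \<open>n\<close>-th step of the scheme only converges for \<open>q < 1\<close>; the recursion continues it to all \<open>q \<ge> 0\<close>
  and stays inside the class.
\<close>

lemma resolvent_laplace_mixture:
  assumes a: "0 \<le> a" "a \<le> 1"
  shows "\<exists>F. laplace_mixture F \<and>
     (\<forall>q. 0 \<le> q \<and> q < 1 \<longrightarrow> F q = (\<Sum>k. rising_binomial n (a * real k) * (- q) ^ k))"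
proof (induction n rule: less_induct)
  case (less n)
  have "\<exists>F. \<forall>j\<in>{1..n}. laplace_mixture (F j) \<and> (\<forall>q. 0 \<le> q \<and> q < 1 \<longrightarrow>
      F j q = (\<Sum>k. rising_binomial (n - j) (a * real k) * (- q) ^ k))"
    by (rule bchoice) (use less in auto)
  then obtain F where F: "\<And>j. j \<in> {1..n} \<Longrightarrow> laplace_mixture (F j)"
      "\<And>j q. j \<in> {1..n} \<Longrightarrow> 0 \<le> q \<Longrightarrow> q < 1 \<Longrightarrow>
         F j q = (\<Sum>k. rising_binomial (n - j) (a * real k) * (- q) ^ k)"
    by blast
  have w: "0 \<le> - (pochhammer (- a) j / fact j)" if "j \<in> {1..n}" for j
    using pochhammer_neg_nonpos[of a "j - 1"] a that by (simp add: divide_nonpos_pos)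
  define G where "G q = 1 / (1 + q) * (rising_binomial n (- a)
      + (\<Sum>j\<in>{1..n}. - (pochhammer (- a) j / fact j) * F j q))" for q
  have "laplace_mixture G"
    unfolding G_def using a
    by (intro laplace_mixture_mult laplace_mixture_inverse laplace_mixture.add laplace_mixture_const
        rising_binomial_nonneg laplace_mixture_sum laplace_mixture.scale F w) auto
  moreover have "G q = (\<Sum>k. rising_binomial n (a * real k) * (- q) ^ k)" if "0 \<le> q" "q < 1" for q
    unfolding G_def resolvent_recursion[OF a that, of n] by (simp add: F that)
  ultimately show ?case by blast
qed

text \<open>
  At time 1 with step \<open>1 / n\<close> the scheme for \<open>\<partial>\<^sub>t\<^sup>a (f - 1) = - x f\<close> has \<open>q = x / n powr a\<close>; its \<open>n\<close>-th value
  converges to the Mittag-Leffler series by dominated convergence (Tannery's theorem).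
\<close>

lemma mittag_leffler_limit:
  assumes a: "0 < a" "a \<le> 1" and x: "0 \<le> x"
  shows "summable (\<lambda>k. norm ((- x) ^ k / Gamma (1 + a * real k)))"
    and "(\<lambda>n. \<Sum>k. rising_binomial n (a * real k) * (- (x / real n powr a)) ^ k)
           \<longlonglongrightarrow> (\<Sum>k. (- x) ^ k / Gamma (1 + a * real k))"
proof -
  let ?B = "\<lambda>n k. rising_binomial n (a * real k) / real n powr (a * real k)"
  have powr_pow: "(x / real n powr a) ^ k = x ^ k / real n powr (a * real k)" if "n > 0" for n k
    using that by (simp add: power_divide powr_powr flip: powr_realpow)
  have "filterlim (\<lambda>n. real n powr a) at_top sequentially"
    using a by real_asymp
  then have "\<forall>\<^sub>F n in sequentially. x < real n powr a"
    by (simp add: filterlim_at_top_dense)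
  then have "\<forall>\<^sub>F n in sequentially. x < real n powr a \<and> 0 < n"
    using eventually_gt_at_top[of 0] by (rule eventually_conj)
  \<comment> \<open>From this index on the arguments of the series are smaller than 1.\<close>
  then obtain N where N: "x < real N powr a" "0 < N"
    by (auto dest: eventually_happens simp: eventually_sequentially)
  have M: "summable (\<lambda>k. ?B N k * x ^ k)"
    using summable_rising_binomial[of a "x / real N powr a" N] a x N by (simp add: powr_pow)
  have bound: "\<forall>\<^sub>F (k, n) in at_top \<times>\<^sub>F sequentially. norm (?B n k * (- x) ^ k) \<le> ?B N k * x ^ k"
    unfolding case_prod_beta
  proof (rule eventually_mono[OF eventually_prod_same[THEN iffD2]])
    show "\<exists>Q. eventually Q sequentially \<and> (\<forall>k n. Q k \<longrightarrow> Q n \<longrightarrow> N \<le> snd (k, n))"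
      by (intro exI[of _ "\<lambda>n. N \<le> n"]) (auto simp: eventually_ge_at_top)
    fix kn :: "nat \<times> nat" assume "N \<le> snd kn"
    then show "norm (?B (snd kn) (fst kn) * (- x) ^ fst kn) \<le> ?B N (fst kn) * x ^ fst kn"
      using a x N rising_binomial_scaled_decreasing[of "a * real (fst kn)" N "snd kn"]
      by (simp add: abs_mult power_abs rising_binomial_nonneg)
         (drule mult_right_mono[where c = "x ^ fst kn"], auto)
  qed
  have lim: "(\<lambda>n. ?B n k * (- x) ^ k) \<longlonglongrightarrow> 1 / Gamma (1 + a * real k) * (- x) ^ k" for k
    using a by (intro tendsto_mult tendsto_const rising_binomial_scaled_tendsto) auto
  from tannerys_theorem[OF lim bound M]
  have *: "summable (\<lambda>k. norm (1 / Gamma (1 + a * real k) * (- x) ^ k))"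
     "(\<lambda>n. \<Sum>k. ?B n k * (- x) ^ k) \<longlonglongrightarrow> (\<Sum>k. 1 / Gamma (1 + a * real k) * (- x) ^ k)"
    by auto
  then show "summable (\<lambda>k. norm ((- x) ^ k / Gamma (1 + a * real k)))" by simp
  have "\<forall>\<^sub>F n in sequentially. (\<Sum>k. ?B n k * (- x) ^ k)
      = (\<Sum>k. rising_binomial n (a * real k) * (- (x / real n powr a)) ^ k)"
    using eventually_gt_at_top[of 0]
  proof eventually_elim
    case (elim n)
    have "(- (x / real n powr a)) ^ k = (- x) ^ k / real n powr (a * real k)" for k
      unfolding power_minus[of "x / real n powr a"] power_minus[of x] by (simp add: powr_pow elim)
    then show ?case by (simp add: field_simps)
  qed
  with *(2) show "(\<lambda>n. \<Sum>k. rising_binomial n (a * real k) * (- (x / real n powr a)) ^ k)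
           \<longlonglongrightarrow> (\<Sum>k. (- x) ^ k / Gamma (1 + a * real k))"
    by (simp add: tendsto_cong)
qed

lemma summable_mittag_leffler:
  assumes a: "0 < a" "a \<le> 1"
  shows "summable (\<lambda>k. \<bar>(- 1) ^ k / Gamma (1 + a * real k)\<bar> * \<bar>x\<bar> ^ k)"
  using mittag_leffler_limit(1)[OF a, of "\<bar>x\<bar>"] by (simp add: abs_mult power_abs)

lemma summable_mittag_leffler_deriv:
  assumes a: "0 < a" "a \<le> 1"
  shows "summable (\<lambda>k. (diffs ^^ m) (\<lambda>k. (- 1) ^ k / Gamma (1 + a * real k)) k * x ^ k)"
proof (induction m arbitrary: x)
  case 0
  show ?case by (rule summable_norm_cancel)
      (use summable_mittag_leffler[OF a, of x] in \<open>simp add: abs_mult power_abs\<close>)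
next
  case (Suc m)
  show ?case using termdiff_converges_all[OF Suc] by simp
qed

lemma has_real_derivative_mittag_leffler:
  assumes a: "0 < a" "a \<le> 1"
  shows "(mittag_leffler_deriv a m has_real_derivative mittag_leffler_deriv a (Suc m) x) (at x)"
  using termdiffs_strong_converges_everywhere[OF summable_mittag_leffler_deriv[OF a, of m], of x]
  unfolding mittag_leffler_deriv_def by simp

text \<open>
  For \<open>m = 0\<close> this is the limit of the discrete scheme, whose \<open>n\<close>-th value at \<open>q = x / n powr a\<close> is a dilation of a
  member of the class; differentiation preserves the class up to sign.
\<close>

lemma mittag_leffler_laplace_mixture:
  assumes a: "0 < a" "a \<le> 1"
  shows "laplace_mixture (\<lambda>x. (- 1) ^ m * mittag_leffler_deriv a m x)"
proof (induction m)
  case 0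
  have "\<exists>F. \<forall>n. laplace_mixture (F n) \<and>
     (\<forall>q. 0 \<le> q \<and> q < 1 \<longrightarrow> F n q = (\<Sum>k. rising_binomial n (a * real k) * (- q) ^ k))"
    using a by (intro choice allI resolvent_laplace_mixture) auto
  then obtain F where F: "\<And>n. laplace_mixture (F n)"
     "\<And>n q. 0 \<le> q \<Longrightarrow> q < 1 \<Longrightarrow> F n q = (\<Sum>k. rising_binomial n (a * real k) * (- q) ^ k)"
    by blast
  have "laplace_mixture (mittag_leffler_deriv a 0)"
  proof (rule laplace_mixture.limit)
    show "laplace_mixture (\<lambda>x. F n (1 / real n powr a * x))" for n
      by (intro laplace_mixture_dilate F) auto
    fix x :: real assume x: "0 \<le> x"
    have "filterlim (\<lambda>n. real n powr a) at_top sequentially"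
      using a by real_asymp
    then have "\<forall>\<^sub>F n in sequentially. x < real n powr a"
      by (simp add: filterlim_at_top_dense)
    then have "\<forall>\<^sub>F n in sequentially.
       (\<Sum>k. rising_binomial n (a * real k) * (- (x / real n powr a)) ^ k) = F n (1 / real n powr a * x)"
    proof eventually_elim
      case (elim n)
      with x have "0 < real n powr a" by linarith
      with elim x have "0 \<le> x / real n powr a" "x / real n powr a < 1" by auto
      from F(2)[OF this, of n] show ?case by simp
    qed
    moreover have "mittag_leffler_deriv a 0 x = (\<Sum>k. (- x) ^ k / Gamma (1 + a * real k))"
      unfolding mittag_leffler_deriv_def power_minus[of x] by simp
    ultimately show "(\<lambda>n. F n (1 / real n powr a * x)) \<longlonglongrightarrow> mittag_leffler_deriv a 0 x"
      using mittag_leffler_limit(2)[OF a x] by (simp add: tendsto_cong)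
  qed
  then show ?case by simp
next
  case (Suc m)
  have "laplace_mixture (\<lambda>x. - ((- 1) ^ m * mittag_leffler_deriv a (Suc m) x))"
    by (rule laplace_mixture_deriv[OF Suc])
       (intro DERIV_cmult has_real_derivative_mittag_leffler a)
  then show ?case by simp
qed

text \<open>
  Members of the class are nonnegative and largest at 0, and \<open>(- 1) ^ m\<close> times the \<open>m\<close>-th derivative is a member.
\<close>

lemma mittag_leffler_deriv_bound:
  assumes a: "0 < a" "a \<le> 1" and "0 \<le> x"
  shows "\<bar>mittag_leffler_deriv a m x\<bar> \<le> \<bar>mittag_leffler_deriv a m 0\<bar>"
  using laplace_mixture_bounds[OF mittag_leffler_laplace_mixture[OF a, of m], of x]
    laplace_mixture_bounds(1)[OF mittag_leffler_laplace_mixture[OF a, of m], of 0] assms(3)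
  by (cases "even m") auto

lemma mittag_leffler_0: "mittag_leffler_deriv a 0 0 = 1"
proof -
  have "(\<Sum>k. c k * 0 ^ k) = c 0" for c :: "nat \<Rightarrow> real" by simp
  from this[of "\<lambda>k. (- 1) ^ k / Gamma (1 + a * real k)"]
  show ?thesis by (simp only: mittag_leffler_deriv_def) simp
qed

lemma continuous_mittag_leffler_deriv [continuous_intros]:
  assumes "0 < a" "a \<le> 1" "continuous_on S f"
  shows "continuous_on S (\<lambda>x. mittag_leffler_deriv a m (f x))"
proof (rule continuous_on_compose2[OF _ assms(3), of UNIV])
  show "continuous_on UNIV (mittag_leffler_deriv a m)"
    using has_real_derivative_mittag_leffler[OF assms(1,2)]
    by (auto intro!: continuous_at_imp_continuous_on DERIV_isCont)
qed auto

section \<open>Beta integrals of the Mittag-Leffler function\<close>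

lemma Beta_set_integral:
  assumes "0 < b" "0 < q"
  shows "set_integrable lborel {0<..<1::real} (\<lambda>s. s powr (b - 1) * (1 - s) powr (q - 1))"
    and "(LBINT s:{0<..<1}. s powr (b - 1) * (1 - s) powr (q - 1)) = Beta b q"
proof -
  show int: "set_integrable lborel {0<..<1::real} (\<lambda>s. s powr (b - 1) * (1 - s) powr (q - 1))"
    by (rule set_integrable_subset[OF integrable_Beta[OF assms]]) auto
  have "((\<lambda>s. s powr (b - 1) * (1 - s) powr (q - 1)) has_integral Beta b q) {0<..<1}"
    using has_integral_Beta_real[OF assms] by (simp add: has_integral_Icc_iff_Ioo)
  then show "(LBINT s:{0<..<1}. s powr (b - 1) * (1 - s) powr (q - 1)) = Beta b q"
    using set_borel_integral_eq_integral(2)[OF int] by (simp add: integral_unique)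
qed

text \<open>
  Termwise integration against the Beta weight; on \<open>(0, 1)\<close> the factors \<open>(s powr a) ^ k\<close> are at most 1, so the absolute
  summability of the coefficients dominates everything.
\<close>

lemma Beta_series_integral:
  fixes c :: "nat \<Rightarrow> real"
  assumes a: "0 < a" and b: "0 < b" and q: "0 < q" and c: "summable (\<lambda>k. \<bar>c k\<bar>)"
  defines "h \<equiv> \<lambda>s. s powr (b - 1) * (1 - s) powr (q - 1) * (\<Sum>k. c k * (s powr a) ^ k)"
  shows "set_integrable lborel {0<..<1::real} h"
    and "(\<lambda>k. c k * Beta (b + a * real k) q) sums (LBINT s:{0<..<1}. h s)"
proof -
  define f where "f k s = indicator {0<..<1} s *\<^sub>R
    (c k * (s powr (b + a * real k - 1) * (1 - s) powr (q - 1)))" for k and s :: real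
  have pos: "0 < b + a * real k" for k using a b by (simp add: add_pos_nonneg)
  have int: "integrable lborel (f k)" for k
    using integrable_mult_right[OF Beta_set_integral(1)[OF pos q, of k, unfolded set_integrable_def], of "c k"]
    unfolding f_def by (simp add: mult_ac)
  have f_eq: "f k s = indicator {0<..<1} s *\<^sub>R (s powr (b - 1) * (1 - s) powr (q - 1)) * (c k * (s powr a) ^ k)" for k s
  proof (cases "s \<in> {0<..<1}")
    case True
    then have "s powr (b + a * real k - 1) = s powr (b - 1) * (s powr a) ^ k"
      by (simp add: powr_powr flip: powr_add powr_realpow) (simp add: algebra_simps)
    then show ?thesis by (simp add: f_def)
  qed (simp add: f_def)
  have norm_le: "norm (f k s) \<le> \<bar>c k\<bar> * (indicator {0<..<1} s *\<^sub>R (s powr (b - 1) * (1 - s) powr (q - 1)))" for k s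
  proof (cases "s \<in> {0<..<1}")
    case True
    then have "(s powr a) ^ k \<le> 1" using a by (intro power_le_one) (auto simp: powr_le1)
    then have "(s powr (b - 1) * (1 - s) powr (q - 1)) * (\<bar>c k\<bar> * (s powr a) ^ k)
        \<le> (s powr (b - 1) * (1 - s) powr (q - 1)) * (\<bar>c k\<bar> * 1)"
      by (intro mult_left_mono) auto
    then show ?thesis using True by (simp add: f_eq abs_mult mult_ac)
  qed (simp add: f_eq)
  have integral_f: "integral\<^sup>L lborel (f k) = c k * Beta (b + a * real k) q" for k
    using Beta_set_integral(2)[OF pos q, of k] unfolding f_def set_lebesgue_integral_def
    by (simp add: mult.left_commute[of _ "c k"])
  have summ: "AE s in lborel. summable (\<lambda>k. norm (f k s))"
    by (intro AE_I2 summable_comparison_test[OF exI[of _ 0] summable_mult2[OF c]])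
       (use norm_le in auto)
  have "summable (\<lambda>k. \<integral>s. norm (f k s) \<partial>lborel)"
  proof (rule summable_comparison_test[OF exI[of _ 0] summable_mult2[OF c]], intro allI impI)
    fix k
    have "(\<integral>s. norm (f k s) \<partial>lborel) \<le> (\<integral>s. \<bar>c k\<bar> * (indicator {0<..<1} s *\<^sub>R (s powr (b - 1) * (1 - s) powr (q - 1))) \<partial>lborel)"
      by (intro integral_mono integrable_norm int integrable_mult_right norm_le
          Beta_set_integral(1)[OF b q, unfolded set_integrable_def])
    also have "\<dots> = \<bar>c k\<bar> * Beta b q"
      using Beta_set_integral(2)[OF b q] by (simp add: set_lebesgue_integral_def)
    finally show "norm (\<integral>s. norm (f k s) \<partial>lborel) \<le> \<bar>c k\<bar> * Beta b q"
      by simp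
  qed
  note * = int summ this
  have "(\<Sum>k. f k s) = indicator {0<..<1} s *\<^sub>R h s" for s
  proof (cases "s \<in> {0<..<1}")
    case True
    have "summable (\<lambda>k. c k * (s powr a) ^ k)"
    proof (rule summable_comparison_test[OF exI[of _ 0] c], intro allI impI)
      fix k
      have "(s powr a) ^ k \<le> 1" using a True by (intro power_le_one) (auto simp: powr_le1)
      then have "\<bar>c k\<bar> * (s powr a) ^ k \<le> \<bar>c k\<bar> * 1" by (intro mult_left_mono) auto
      then show "norm (c k * (s powr a) ^ k) \<le> \<bar>c k\<bar>" by (simp add: abs_mult)
    qed
    then show ?thesis using True unfolding f_eq h_def by (simp add: suminf_mult)
  qed (simp add: f_def)
  with integrable_suminf[OF *] sums_integral[OF *] integral_f
  show "set_integrable lborel {0<..<1::real} h"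
    "(\<lambda>k. c k * Beta (b + a * real k) q) sums (LBINT s:{0<..<1}. h s)"
    by (simp_all add: set_integrable_def set_lebesgue_integral_def)
qed

context
  fixes a :: real
  assumes a: "0 < a" "a < 1"
begin

lemma mittag_leffler_sums:
  "(\<lambda>k. (- y) ^ k / Gamma (1 + a * real k)) sums mittag_leffler_deriv a 0 y"
  "summable (\<lambda>k. \<bar>(- y) ^ k / Gamma (1 + a * real k)\<bar>)"
proof -
  show "summable (\<lambda>k. \<bar>(- y) ^ k / Gamma (1 + a * real k)\<bar>)"
    using summable_mittag_leffler[of a y] a by (simp add: abs_mult power_abs)
  then have "summable (\<lambda>k. (- y) ^ k / Gamma (1 + a * real k))"
    by (simp add: summable_rabs_cancel)
  then show "(\<lambda>k. (- y) ^ k / Gamma (1 + a * real k)) sums mittag_leffler_deriv a 0 y"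
    unfolding mittag_leffler_deriv_def power_minus[of y] by (simp add: summable_sums)
qed

lemma mittag_leffler_1_sums:
  "(\<lambda>k. real (Suc k) * (- 1) ^ Suc k / Gamma (1 + a * real (Suc k)) * y ^ k) sums mittag_leffler_deriv a 1 y"
  "summable (\<lambda>k. \<bar>real (Suc k) * (- 1) ^ Suc k / Gamma (1 + a * real (Suc k)) * y ^ k\<bar>)"
proof -
  let ?c = "\<lambda>k. real (Suc k) * (- 1) ^ Suc k / Gamma (1 + a * real (Suc k))"
  have c: "diffs (\<lambda>k. (- 1) ^ k / Gamma (1 + a * real k)) = ?c"
    by (simp add: diffs_def fun_eq_iff)
  have s: "summable (\<lambda>k. ?c k * y ^ k)" for y
    using summable_mittag_leffler_deriv[of a 1 y] a c by simp
  then show "(\<lambda>k. ?c k * y ^ k) sums mittag_leffler_deriv a 1 y"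
    using c by (simp add: mittag_leffler_deriv_def summable_sums)
  show "summable (\<lambda>k. \<bar>?c k * y ^ k\<bar>)"
    using powser_insidea[OF s[of "\<bar>y\<bar> + 1"], of y] by simp
qed

lemma mittag_leffler_power_series:
  "mittag_leffler_deriv a 0 (y * z) = (\<Sum>k. (- y) ^ k / Gamma (1 + a * real k) * z ^ k)"
proof -
  have "(- (y * z)) ^ k = (- y) ^ k * z ^ k" for k by (simp flip: power_mult_distrib)
  then show ?thesis using mittag_leffler_sums(1)[of "y * z"] by (simp add: sums_iff)
qed

lemma Beta_one_right: "0 < b \<Longrightarrow> Beta b 1 = 1 / (b :: real)"
proof -
  assume b: "0 < b"
  then have "Gamma (b + 1) = b * Gamma b" by (intro Gamma_plus1) (auto simp: nonpos_Ints_def)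
  moreover have "Gamma b \<noteq> 0" using Gamma_real_pos[OF b] by linarith
  ultimately show ?thesis using b by (simp add: Beta_def)
qed

text \<open>
  With \<open>J\<^sub>1\<close> and \<open>J\<^sub>2\<close> for the two integrals, \<open>Beta (1 + a k) (1 - a) = Gamma (1 + a k) Gamma (1 - a) / Gamma (2 + a (k - 1))\<close>
  makes the \<open>k + 1\<close>-st term of \<open>J\<^sub>1\<close> a multiple of the \<open>k\<close>-th term of \<open>J\<^sub>2\<close>.  This is the integrated form
  of the fractional relaxation equation \<open>\<partial>\<^sub>t\<^sup>a (f - 1) = - l f\<close> for \<open>f (t) = E (l * t powr a)\<close>, scaled to the
  interval \<open>(0, 1)\<close>.
\<close>

lemma mittag_leffler_abel_integral:
  "set_integrable lborel {0<..<1} (\<lambda>s. (1 - s) powr (- a) * mittag_leffler_deriv a 0 (y * s powr a))"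
  "set_integrable lborel {0<..<1} (\<lambda>s. mittag_leffler_deriv a 0 (y * s powr a))"
  "(LBINT s:{0<..<1}. (1 - s) powr (- a) * mittag_leffler_deriv a 0 (y * s powr a))
    = Beta 1 (1 - a) - Gamma (1 - a) * y * (LBINT s:{0<..<1}. mittag_leffler_deriv a 0 (y * s powr a))"
proof -
  let ?c = "\<lambda>k. (- y) ^ k / Gamma (1 + a * real k)"
  let ?J1 = "LBINT s:{0<..<1}. (1 - s) powr (- a) * mittag_leffler_deriv a 0 (y * s powr a)"
  let ?J2 = "LBINT s:{0<..<1}. mittag_leffler_deriv a 0 (y * s powr a)"
  have 1: "?J1 = (LBINT s:{0<..<1}. s powr (1 - 1) * (1 - s) powr (1 - a - 1) * mittag_leffler_deriv a 0 (y * s powr a))"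
    "set_integrable lborel {0<..<1} (\<lambda>s. (1 - s) powr (- a) * mittag_leffler_deriv a 0 (y * s powr a))
      = set_integrable lborel {0<..<1} (\<lambda>s. s powr (1 - 1) * (1 - s) powr (1 - a - 1) * mittag_leffler_deriv a 0 (y * s powr a))"
    by (rule set_lebesgue_integral_cong set_integrable_cong; simp)+
  have J1: "set_integrable lborel {0<..<1} (\<lambda>s. (1 - s) powr (- a) * mittag_leffler_deriv a 0 (y * s powr a))"
    "(\<lambda>k. ?c k * Beta (1 + a * real k) (1 - a)) sums ?J1"
    unfolding 1 unfolding mittag_leffler_power_series
    using a by (intro Beta_series_integral mittag_leffler_sums(2); simp)+
  have 2: "?J2 = (LBINT s:{0<..<1}. s powr (1 - 1) * (1 - s) powr (1 - 1) * mittag_leffler_deriv a 0 (y * s powr a))"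
    "set_integrable lborel {0<..<1} (\<lambda>s. mittag_leffler_deriv a 0 (y * s powr a))
      = set_integrable lborel {0<..<1} (\<lambda>s. s powr (1 - 1) * (1 - s) powr (1 - 1) * mittag_leffler_deriv a 0 (y * s powr a))"
    by (rule set_lebesgue_integral_cong set_integrable_cong; simp)+
  have J2: "set_integrable lborel {0<..<1} (\<lambda>s. mittag_leffler_deriv a 0 (y * s powr a))"
    "(\<lambda>k. ?c k * Beta (1 + a * real k) 1) sums ?J2"
    unfolding 2 unfolding mittag_leffler_power_series
    using a by (intro Beta_series_integral mittag_leffler_sums(2); simp)+
  show "set_integrable lborel {0<..<1} (\<lambda>s. (1 - s) powr (- a) * mittag_leffler_deriv a 0 (y * s powr a))"
    "set_integrable lborel {0<..<1} (\<lambda>s. mittag_leffler_deriv a 0 (y * s powr a))"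
    by fact+
  have "(\<lambda>k. ?c (Suc k) * Beta (1 + a * real (Suc k)) (1 - a)) sums (?J1 - Beta 1 (1 - a))"
    using J1(2) by (subst sums_Suc_iff) simp
  moreover have "?c (Suc k) * Beta (1 + a * real (Suc k)) (1 - a)
      = - (Gamma (1 - a) * y) * (?c k * Beta (1 + a * real k) 1)" for k
  proof -
    have g: "Gamma (1 + a * real (Suc k)) > 0" using a by (intro Gamma_real_pos add_pos_nonneg) auto
    have "1 + a * real k > 0" using a by (auto intro!: add_pos_nonneg)
    then have G2: "Gamma (1 + a * real k + 1) = (1 + a * real k) * Gamma (1 + a * real k)"
      by (intro Gamma_plus1) (auto simp: nonpos_Ints_def)
    have "Beta (1 + a * real (Suc k)) (1 - a) = Gamma (1 + a * real (Suc k)) * Gamma (1 - a) / Gamma (1 + a * real k + 1)"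
      by (simp add: Beta_def algebra_simps)
    then have "?c (Suc k) * Beta (1 + a * real (Suc k)) (1 - a)
       = (- y) ^ Suc k * Gamma (1 - a) / ((1 + a * real k) * Gamma (1 + a * real k))"
      using g unfolding G2 by simp
    also have "\<dots> = - (Gamma (1 - a) * y) * (?c k * (1 / (1 + a * real k)))"
      by (simp add: mult_ac)
    finally show ?thesis using \<open>1 + a * real k > 0\<close> by (simp add: Beta_one_right)
  qed
  ultimately have "(\<lambda>k. - (Gamma (1 - a) * y) * (?c k * Beta (1 + a * real k) 1)) sums (?J1 - Beta 1 (1 - a))"
    by (simp only:)
  from sums_unique2[OF this sums_mult[OF J2(2)]]
  show "?J1 = Beta 1 (1 - a) - Gamma (1 - a) * y * ?J2" by (simp add: algebra_simps)
qed

text \<open>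
  For \<open>f (s) = E (x * s powr a)\<close> the relaxation equation at time 1 reads
  \<open>x * Gamma (1 - a) * f (1) = \<integral> (1 - s) powr (- a) * (- f' (s)) ds\<close>.  As \<open>- f'\<close> is nonnegative and the kernel
  is at least 1, the right-hand side is at least \<open>f (0) - f (1) = 1 - f (1)\<close>.
  In the proof, \<open>a * x * I (1 - a)\<close> and \<open>a * x * I 1\<close> are the integrals of \<open>f'\<close> with and without the kernel.
\<close>

lemma mittag_leffler_lower_bound:
  assumes x: "0 \<le> x"
  shows "1 / (1 + Gamma (1 - a) * x) \<le> mittag_leffler_deriv a 0 x"
proof -
  let ?c = "\<lambda>k. real (Suc k) * (- 1) ^ Suc k / Gamma (1 + a * real (Suc k)) * x ^ k"
  have series: "(\<Sum>k. ?c k * z ^ k) = mittag_leffler_deriv a 1 (x * z)" for z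
    using mittag_leffler_1_sums(1)[of "x * z"] by (simp add: sums_iff power_mult_distrib mult.assoc)
  define I where "I q = (LBINT s:{0<..<1}. s powr (a - 1) * (1 - s) powr (q - 1) * mittag_leffler_deriv a 1 (x * s powr a))" for q
  have I: "set_integrable lborel {0<..<1} (\<lambda>s. s powr (a - 1) * (1 - s) powr (q - 1) * mittag_leffler_deriv a 1 (x * s powr a))"
    "(\<lambda>k. ?c k * Beta (a + a * real k) q) sums I q" if "0 < q" for q
    unfolding I_def series[symmetric]
    using Beta_series_integral[OF a(1) a(1) that mittag_leffler_1_sums(2)] .
  have g: "Gamma (1 + a * real j) > 0" "Gamma (1 - a) > 0" for j using a by (auto intro!: Gamma_real_pos add_pos_nonneg)
  have pos: "0 < a + a * real k" for k using a by (auto intro!: add_pos_nonneg)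
  have G: "Gamma (1 + a * real (Suc k)) = (a + a * real k) * Gamma (a + a * real k)" for k
    using Gamma_plus1[of "a + a * real k"] pos[of k] by (auto simp: nonpos_Ints_def algebra_simps)
  have "(\<lambda>k. (a * x) * (?c k * Beta (a + a * real k) (1 - a))) sums (a * x * I (1 - a))"
    using a by (intro sums_mult I(2)) auto
  moreover have "(a * x) * (?c k * Beta (a + a * real k) (1 - a))
      = - (x * Gamma (1 - a)) * ((- x) ^ k / Gamma (1 + a * real k))" for k
  proof -
    have "Beta (a + a * real k) (1 - a) = Gamma (a + a * real k) * Gamma (1 - a) / Gamma (1 + a * real k)"
      by (simp add: Beta_def algebra_simps)
    moreover have "Gamma (1 + a * real (Suc k)) = real (Suc k) * a * Gamma (a + a * real k)"
      unfolding G by (simp add: algebra_simps)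
    moreover have "(- x) ^ k = - ((- 1) ^ Suc k) * x ^ k" unfolding power_minus[of x] by simp
    moreover have "(a * x) * (n * m / (n * a * G1) * p * (G1 * G2 / G3)) = - (x * G2) * ((- m) * p / G3)"
      if "n > 0" "G1 > 0" for n m G1 G2 G3 p :: real
      using that a by simp
    ultimately show ?thesis
      using Gamma_real_pos[OF pos[of k]] by (simp only: of_nat_0_less_iff zero_less_Suc)
  qed
  ultimately have "(\<lambda>k. - (x * Gamma (1 - a)) * ((- x) ^ k / Gamma (1 + a * real k))) sums (a * x * I (1 - a))"
    by (simp only:)
  from sums_unique2[OF this sums_mult[OF mittag_leffler_sums(1)]]
  have I1: "a * x * I (1 - a) = - (x * Gamma (1 - a)) * mittag_leffler_deriv a 0 x" .
  have "(\<lambda>k. (a * x) * (?c k * Beta (a + a * real k) 1)) sums (a * x * I 1)"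
    by (intro sums_mult I(2)) auto
  moreover have "(a * x) * (?c k * Beta (a + a * real k) 1) = (- x) ^ Suc k / Gamma (1 + a * real (Suc k))" for k
  proof -
    have "(- x) ^ Suc k = x * (- 1) ^ Suc k * x ^ k" unfolding power_minus[of x "Suc k"] by simp
    moreover have "a * real (Suc k) * Beta (a + a * real k) 1 = 1"
      using pos[of k] by (simp add: Beta_one_right field_simps)
    moreover have "(a * x) * (n * m / G * p * B) = (a * n * B) * (x * m * p) / G" for n m G p B :: real
      by simp
    ultimately show ?thesis by (simp only: mult_1)
  qed
  moreover have "(\<lambda>k. (- x) ^ Suc k / Gamma (1 + a * real (Suc k))) sums (mittag_leffler_deriv a 0 x - 1)"
    using mittag_leffler_sums(1)[of x] by (subst sums_Suc_iff) simp
  ultimately have I2: "a * x * I 1 = mittag_leffler_deriv a 0 x - 1"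
    by (simp only: sums_unique2)
  have "I (1 - a) \<le> I 1"
    unfolding I_def
  proof (rule set_integral_mono[OF I(1) I(1)])
    fix s :: real assume s: "s \<in> {0<..<1}"
    have neg: "mittag_leffler_deriv a 1 (x * s powr a) \<le> 0"
      using laplace_mixture_bounds(1)[OF mittag_leffler_laplace_mixture[of a 1], of "x * s powr a"] a x s by simp
    have "(1 - s) powr (1 - 1) \<le> (1 - s) powr (1 - a - 1)"
      using s a by (intro powr_mono') auto
    then show "s powr (a - 1) * (1 - s) powr (1 - a - 1) * mittag_leffler_deriv a 1 (x * s powr a)
        \<le> s powr (a - 1) * (1 - s) powr (1 - 1) * mittag_leffler_deriv a 1 (x * s powr a)"
      by (intro mult_right_mono_neg mult_left_mono neg) auto
  qed (use a in auto)
  then have "a * x * I (1 - a) \<le> a * x * I 1"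
    using a x by (intro mult_left_mono) auto
  then have "1 \<le> mittag_leffler_deriv a 0 x * (1 + Gamma (1 - a) * x)"
    unfolding I1 I2 by (simp add: algebra_simps)
  moreover have "0 < 1 + Gamma (1 - a) * x"
    using x g(2) by (intro add_pos_nonneg) auto
  ultimately show ?thesis by (simp add: field_simps)
qed

end

section \<open>Gaussian integrals and Gaussian mixtures\<close>

lemma borel_measurable_cis [measurable]: "cis \<in> borel_measurable borel"
  by (intro borel_measurable_continuous_onI continuous_intros)

text \<open>
  The characteristic function of the standard normal distribution, rescaled.
\<close>

lemma gaussian_real_fourier:
  fixes a x :: real
  assumes a: "0 < a"
  shows "integrable lborel (\<lambda>s::real. complex_of_real (exp (- a * s\<^sup>2)) * cis (x * s))"
    and "(LINT s|lborel. complex_of_real (exp (- a * s\<^sup>2)) * cis (x * s))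
      = complex_of_real (sqrt (pi / a) * exp (- x\<^sup>2 / (4 * a)))"
proof -
  define c where "c = sqrt (2 * a)"
  have c: "c > 0" "c\<^sup>2 = 2 * a" using a by (simp_all add: c_def)
  define h where "h z = complex_of_real (std_normal_density z) * cis (x / c * z)" for z
  have int_h: "integrable lborel h"
    unfolding h_def
    by (rule Bochner_Integration.integrable_bound[OF integrable_normal_density[where \<mu> = 0 and \<sigma> = 1]])
       (auto simp: norm_mult)
  have "(LINT z|lborel. h z) = char std_normal_distribution (x / c)"
    unfolding char_def by (subst integral_density) (auto simp: h_def[abs_def] cis_conv_exp scaleR_conv_of_real)
  also have "\<dots> = complex_of_real (exp (- x\<^sup>2 / (4 * a)))"
    unfolding char_std_normal_distribution using c(2) by (simp add: power_divide)
  finally have L: "(LINT z|lborel. h z) = complex_of_real (exp (- x\<^sup>2 / (4 * a)))" .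
  have h: "h (0 + c * s) = complex_of_real (1 / sqrt (2 * pi)) * (complex_of_real (exp (- a * s\<^sup>2)) * cis (x * s))" for s
    using c by (simp add: h_def std_normal_density_def power_mult_distrib)
  have "integrable lborel (\<lambda>s. h (0 + c * s))"
    using int_h c by (intro lborel_integrable_real_affine) auto
  then have "integrable lborel (\<lambda>s. complex_of_real (sqrt (2 * pi)) * h (0 + c * s))"
    by (rule integrable_mult_right)
  moreover have "complex_of_real (sqrt (2 * pi)) * h (0 + c * s)
      = complex_of_real (exp (- a * s\<^sup>2)) * cis (x * s)" for s
  proof -
    have "complex_of_real r * (complex_of_real (1 / r) * E) = E" if "r \<noteq> 0" for r E
      using that by simp
    then show ?thesis unfolding h by simp
  qed
  ultimately show "integrable lborel (\<lambda>s::real. complex_of_real (exp (- a * s\<^sup>2)) * cis (x * s))"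
    by simp
  have "complex_of_real (exp (- x\<^sup>2 / (4 * a))) = c *\<^sub>R (LINT s|lborel. h (0 + c * s))"
    unfolding L[symmetric] using c by (subst lborel_integral_real_affine[of c _ 0]) auto
  also have "\<dots> = complex_of_real (c / sqrt (2 * pi)) * (LINT s|lborel. complex_of_real (exp (- a * s\<^sup>2)) * cis (x * s))"
    unfolding h by (simp add: scaleR_conv_of_real)
  finally have "complex_of_real (sqrt (2 * pi) / c) * complex_of_real (exp (- x\<^sup>2 / (4 * a)))
      = (LINT s|lborel. complex_of_real (exp (- a * s\<^sup>2)) * cis (x * s))"
    using c by simp
  moreover have "sqrt (2 * pi) / c = sqrt (pi / a)"
    unfolding c_def by (simp flip: real_sqrt_divide)
  ultimately show "(LINT s|lborel. complex_of_real (exp (- a * s\<^sup>2)) * cis (x * s))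
      = complex_of_real (sqrt (pi / a) * exp (- x\<^sup>2 / (4 * a)))" by simp
qed

lemma lborel_product_integral:
  fixes f :: "'a::euclidean_space \<Rightarrow> real \<Rightarrow> complex"
  assumes f: "\<And>b. b \<in> Basis \<Longrightarrow> integrable lborel (f b)"
  shows "integrable lborel (\<lambda>x. \<Prod>b\<in>Basis. f b (x \<bullet> b))"
    and "(LINT x|lborel. (\<Prod>b\<in>Basis. f b (x \<bullet> b))) = (\<Prod>b\<in>Basis. (LINT s|lborel. f b s))"
proof -
  interpret product_sigma_finite "\<lambda>_::'a. lborel :: real measure" ..
  have [measurable]: "f b \<in> borel_measurable borel" if "b \<in> Basis" for b
    using borel_measurable_integrable[OF f[OF that]] by simp
  have meas: "(\<lambda>x. \<Prod>b\<in>Basis. f b (x \<bullet> b)) \<in> borel_measurable borel"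
    by measurable
  have T: "(\<lambda>g. \<Sum>b\<in>Basis. g b *\<^sub>R b) \<in> (\<Pi>\<^sub>M b\<in>(Basis::'a set). lborel) \<rightarrow>\<^sub>M borel"
    by measurable
  have eq: "(\<Prod>b\<in>Basis. f b ((\<Sum>c\<in>Basis. g c *\<^sub>R c) \<bullet> b)) = (\<Prod>b\<in>Basis. f b (g b))" for g
    by (intro prod.cong refl) simp
  show "integrable lborel (\<lambda>x. \<Prod>b\<in>Basis. f b (x \<bullet> b))"
    using T meas by (subst lborel_eq[where 'a='a], subst integrable_distr_eq) (simp_all add: eq product_integrable_prod f)
  show "(LINT x|lborel. (\<Prod>b\<in>Basis. f b (x \<bullet> b))) = (\<Prod>b\<in>Basis. (LINT s|lborel. f b s))"
    using T meas by (subst lborel_eq[where 'a='a], subst integral_distr) (simp_all add: eq product_integral_prod f)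
qed

lemma norm_power2_Basis: "(norm (x::'a::euclidean_space))\<^sup>2 = (\<Sum>b\<in>Basis. (x \<bullet> b)\<^sup>2)"
  unfolding power2_norm_eq_inner by (subst euclidean_inner) (simp add: power2_eq_square)

lemma gaussian_fourier:
  fixes x :: "'a::euclidean_space"
  assumes a: "0 < a"
  shows "integrable lborel (\<lambda>\<xi>::'a. exp (- a * (norm \<xi>)\<^sup>2))"
    and "(LINT \<xi>|lborel. cos (x \<bullet> \<xi>) * exp (- a * (norm \<xi>)\<^sup>2))
      = sqrt (pi / a) ^ DIM('a) * exp (- (norm x)\<^sup>2 / (4 * a))"
proof -
  define f where "f b s = complex_of_real (exp (- a * s\<^sup>2)) * cis ((x \<bullet> b) * s)" for b :: 'a and s
  have cis_sum: "cis (sum g B) = (\<Prod>b\<in>B. cis (g b))" for g :: "'a \<Rightarrow> real" and B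
    by (induction B rule: infinite_finite_induct) (auto simp flip: cis_mult)
  have "(\<Prod>b\<in>Basis. f b (\<xi> \<bullet> b)) = complex_of_real (\<Prod>b\<in>Basis. exp (- a * (\<xi> \<bullet> b)\<^sup>2)) * cis (\<Sum>b\<in>Basis. (x \<bullet> b) * (\<xi> \<bullet> b))" for \<xi> :: 'a
    by (simp add: f_def prod.distrib cis_sum)
  also have "\<dots> \<xi> = complex_of_real (exp (- a * (norm \<xi>)\<^sup>2)) * cis (x \<bullet> \<xi>)" for \<xi> :: 'a
    by (simp add: norm_power2_Basis euclidean_inner[of x \<xi>] sum_distrib_left flip: exp_sum sum_negf)
  finally have prod: "(\<Prod>b\<in>Basis. f b (\<xi> \<bullet> b)) = complex_of_real (exp (- a * (norm \<xi>)\<^sup>2)) * cis (x \<bullet> \<xi>)" for \<xi> :: 'a .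
  have f: "integrable lborel (f b)" for b
    unfolding f_def by (rule gaussian_real_fourier[OF a])
  have int: "integrable lborel (\<lambda>\<xi>::'a. complex_of_real (exp (- a * (norm \<xi>)\<^sup>2)) * cis (x \<bullet> \<xi>))"
    using lborel_product_integral(1)[of f, OF f] unfolding prod .
  have L: "(LINT \<xi>|lborel. complex_of_real (exp (- a * (norm \<xi>)\<^sup>2)) * cis (x \<bullet> \<xi>))
      = complex_of_real (sqrt (pi / a) ^ DIM('a) * exp (- (norm x)\<^sup>2 / (4 * a)))"
  proof -
    have "(LINT \<xi>|lborel. complex_of_real (exp (- a * (norm \<xi>)\<^sup>2)) * cis (x \<bullet> \<xi>))
        = (\<Prod>b\<in>(Basis::'a set). (LINT s|lborel. f b s))"
      using lborel_product_integral(2)[of f, OF f] unfolding prod .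
    also have "\<dots> = complex_of_real (\<Prod>b\<in>(Basis::'a set). sqrt (pi / a) * exp (- (x \<bullet> b)\<^sup>2 / (4 * a)))"
      unfolding f_def gaussian_real_fourier(2)[OF a] by simp
    also have "(\<Prod>b\<in>(Basis::'a set). sqrt (pi / a) * exp (- (x \<bullet> b)\<^sup>2 / (4 * a)))
        = sqrt (pi / a) ^ DIM('a) * exp (- (norm x)\<^sup>2 / (4 * a))"
      by (simp add: prod.distrib norm_power2_Basis sum_divide_distrib flip: exp_sum sum_negf)
    finally show ?thesis .
  qed
  show "integrable lborel (\<lambda>\<xi>::'a. exp (- a * (norm \<xi>)\<^sup>2))"
    using integrable_norm[OF int] by (simp add: norm_mult)
  have "(LINT \<xi>|lborel. Re (complex_of_real (exp (- a * (norm \<xi>)\<^sup>2)) * cis (x \<bullet> \<xi>)))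
      = sqrt (pi / a) ^ DIM('a) * exp (- (norm x)\<^sup>2 / (4 * a))"
    unfolding integral_Re[OF int] L by simp
  then show "(LINT \<xi>|lborel. cos (x \<bullet> \<xi>) * exp (- a * (norm \<xi>)\<^sup>2))
      = sqrt (pi / a) ^ DIM('a) * exp (- (norm x)\<^sup>2 / (4 * a))"
    by (simp add: mult.commute)
qed

lemma power_le_fact_mult_exp:
  fixes y :: real
  assumes "0 \<le> y"
  shows "y ^ k \<le> fact k * exp y"
proof -
  have "(\<lambda>k. y ^ k / fact k) sums exp y" using exp_converges[of y] by (simp add: divide_inverse mult.commute)
  then have "(\<Sum>k\<in>{k}. y ^ k / fact k) \<le> exp y"
    using assms sum_le_suminf[of "\<lambda>k. y ^ k / fact k" "{k}"] by (auto simp: sums_iff)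
  then show ?thesis by (simp add: field_simps)
qed

text \<open>
  For fixed \<open>x \<noteq> 0\<close> the heat kernel is bounded in time: with \<open>y = (norm x)\<^sup>2 / (4 * s)\<close> it is a
  multiple of \<open>y powr (d / 2) * exp (- y)\<close>.
\<close>

lemma heat_kernel_le:
  fixes x :: "'a::euclidean_space"
  assumes s: "0 < s" and x: "x \<noteq> 0"
  shows "sqrt (pi / s) ^ DIM('a) * exp (- (norm x)\<^sup>2 / (4 * s))
    \<le> (sqrt (4 * pi) / norm x) ^ DIM('a) * (1 + fact DIM('a))"
proof -
  let ?d = "DIM('a)"
  define y where "y = (norm x)\<^sup>2 / (4 * s)"
  have y: "y > 0" using s x by (simp add: y_def)
  have "sqrt (pi / s) = sqrt (4 * pi) / norm x * sqrt y"
    using s x by (simp add: y_def real_sqrt_divide real_sqrt_mult)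
  then have sq: "sqrt (pi / s) ^ ?d = (sqrt (4 * pi) / norm x) ^ ?d * sqrt y ^ ?d"
    by (simp only: power_mult_distrib)
  have *: "sqrt (pi / s) ^ ?d * exp (- (norm x)\<^sup>2 / (4 * s)) = (sqrt (4 * pi) / norm x) ^ ?d * (sqrt y ^ ?d * exp (- y))"
    unfolding sq by (simp add: y_def)
  have "sqrt y ^ ?d \<le> 1 + y ^ ?d"
  proof (cases "y \<le> 1")
    case True
    then have "sqrt y ^ ?d \<le> 1" using y by (intro power_le_one) auto
    then show ?thesis using y by (smt (verit) zero_le_power)
  next
    case False
    then have "sqrt y \<le> y" by (intro real_le_lsqrt) (auto simp: power2_eq_square)
    then have "sqrt y ^ ?d \<le> y ^ ?d" using y by (intro power_mono) auto
    then show ?thesis by simp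
  qed
  moreover have "y ^ ?d \<le> fact ?d * exp y"
    using y by (intro power_le_fact_mult_exp) auto
  moreover have "1 \<le> exp y" using y by simp
  moreover have "(1 + fact ?d) * exp y = exp y + fact ?d * exp y" by (simp add: distrib_right)
  ultimately have "sqrt y ^ ?d \<le> (1 + fact ?d) * exp y"
    by linarith
  then have "sqrt y ^ ?d * exp (- y) \<le> 1 + fact ?d"
    by (simp add: exp_minus field_simps)
  then show ?thesis unfolding * by (intro mult_left_mono) auto
qed

text \<open>
  When \<open>F\<close> is the Laplace transform of a measure, this is, up to a constant factor, the mixture of the heat kernels at the
  times \<open>a + r\<close>, with \<open>r\<close> distributed according to that measure.
\<close>

definition mixture_transform :: "real \<Rightarrow> (real \<Rightarrow> real) \<Rightarrow> 'a::euclidean_space \<Rightarrow> real" where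
  "mixture_transform a F x = (LINT \<xi>|lborel. cos (x \<bullet> \<xi>) * (exp (- a * (norm \<xi>)\<^sup>2) * F ((norm \<xi>)\<^sup>2)))"

lemma mixture_transform_integrable:
  assumes "0 < a" "laplace_mixture F"
  shows "integrable lborel (\<lambda>\<xi>::'a::euclidean_space. cos (x \<bullet> \<xi>) * (exp (- a * (norm \<xi>)\<^sup>2) * F ((norm \<xi>)\<^sup>2)))"
proof -
  have [measurable]: "(\<lambda>\<xi>::'a. F ((norm \<xi>)\<^sup>2)) \<in> borel_measurable borel"
    by (rule laplace_mixture_measurable[OF assms(2)]) auto
  show ?thesis
  proof (rule Bochner_Integration.integrable_bound[OF integrable_mult_left[OF gaussian_fourier(1)[OF assms(1)], of "F 0"]])
    show "AE \<xi> in lborel. norm (cos (x \<bullet> \<xi>) * (exp (- a * (norm \<xi>)\<^sup>2) * F ((norm \<xi>)\<^sup>2)))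
        \<le> norm (exp (- a * (norm \<xi>)\<^sup>2) * F 0)"
    proof (rule AE_I2)
      fix \<xi> :: 'a
      have F: "0 \<le> F ((norm \<xi>)\<^sup>2)" "F ((norm \<xi>)\<^sup>2) \<le> F 0"
        using laplace_mixture_bounds[OF assms(2), of "(norm \<xi>)\<^sup>2"] by auto
      have "\<bar>cos (x \<bullet> \<xi>)\<bar> * (exp (- a * (norm \<xi>)\<^sup>2) * F ((norm \<xi>)\<^sup>2)) \<le> 1 * (exp (- a * (norm \<xi>)\<^sup>2) * F 0)"
        using F by (intro mult_mono mult_nonneg_nonneg order_refl abs_cos_le_one) auto
      then show "norm (cos (x \<bullet> \<xi>) * (exp (- a * (norm \<xi>)\<^sup>2) * F ((norm \<xi>)\<^sup>2)))
          \<le> norm (exp (- a * (norm \<xi>)\<^sup>2) * F 0)"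
        using F by (simp add: abs_mult)
    qed
  qed measurable
qed

lemma mixture_transform_limit:
  fixes x :: "'a::euclidean_space"
  assumes a: "0 < a" and F: "\<And>n. laplace_mixture (F n)" and lim: "\<And>z. 0 \<le> z \<Longrightarrow> (\<lambda>n. F n z) \<longlonglongrightarrow> G z"
  shows "(\<lambda>n. mixture_transform a (F n) x) \<longlonglongrightarrow> mixture_transform a G x"
proof -
  obtain C where C: "\<And>n. F n 0 \<le> C"
    using convergent_imp_Bseq[OF convergentI[OF lim[of 0]]] by (auto simp: Bseq_def abs_le_iff)
  have G: "laplace_mixture G" using F lim by (rule laplace_mixture.limit)
  have [measurable]: "(\<lambda>\<xi>::'a. F n ((norm \<xi>)\<^sup>2)) \<in> borel_measurable borel" for n
    by (rule laplace_mixture_measurable[OF F]) auto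
  have [measurable]: "(\<lambda>\<xi>::'a. G ((norm \<xi>)\<^sup>2)) \<in> borel_measurable borel"
    by (rule laplace_mixture_measurable[OF G]) auto
  show ?thesis
    unfolding mixture_transform_def
  proof (rule integral_dominated_convergence[where w = "\<lambda>\<xi>. exp (- a * (norm \<xi>)\<^sup>2) * C"])
    show "integrable lborel (\<lambda>\<xi>::'a. exp (- a * (norm \<xi>)\<^sup>2) * C)"
      by (intro integrable_mult_left gaussian_fourier(1) a)
    show "AE \<xi> in lborel. norm (cos (x \<bullet> \<xi>) * (exp (- a * (norm \<xi>)\<^sup>2) * F n ((norm \<xi>)\<^sup>2))) \<le> exp (- a * (norm \<xi>)\<^sup>2) * C" for n
    proof (rule AE_I2)
      fix \<xi> :: 'a
      have "\<bar>cos (x \<bullet> \<xi>)\<bar> * (exp (- a * (norm \<xi>)\<^sup>2) * \<bar>F n ((norm \<xi>)\<^sup>2)\<bar>) \<le> 1 * (exp (- a * (norm \<xi>)\<^sup>2) * C)"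
        using laplace_mixture_bounds[OF F, of "(norm \<xi>)\<^sup>2" n] C[of n]
        by (intro mult_mono mult_nonneg_nonneg order_refl abs_cos_le_one) auto
      then show "norm (cos (x \<bullet> \<xi>) * (exp (- a * (norm \<xi>)\<^sup>2) * F n ((norm \<xi>)\<^sup>2))) \<le> exp (- a * (norm \<xi>)\<^sup>2) * C"
        by (simp add: abs_mult)
    qed
    show "AE \<xi> in lborel. (\<lambda>n. cos (x \<bullet> \<xi>) * (exp (- a * (norm \<xi>)\<^sup>2) * F n ((norm \<xi>)\<^sup>2)))
        \<longlonglongrightarrow> cos (x \<bullet> \<xi>) * (exp (- a * (norm \<xi>)\<^sup>2) * G ((norm \<xi>)\<^sup>2))"
      by (intro AE_I2 tendsto_mult tendsto_const lim) auto
  qed measurable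
qed

text \<open>
  For \<open>F z = exp (- r * z)\<close> the transform is an explicit Gaussian; its width is at least that for \<open>r = 0\<close>, which gives the
  first estimate, and the second is the bound on heat kernels.  Both estimates are linear in \<open>F\<close> and pass to limits.
  The first one, with \<open>F > 0\<close>, is what makes the transform strictly positive everywhere.
\<close>

lemma mixture_transform_bounds:
  fixes x :: "'a::euclidean_space"
  assumes a: "0 < a" and F: "laplace_mixture F"
  shows "exp (- (norm x)\<^sup>2 / (4 * a)) * mixture_transform a F (0::'a) \<le> mixture_transform a F x"
    and "x \<noteq> 0 \<Longrightarrow> mixture_transform a F x \<le> (sqrt (4 * pi) / norm x) ^ DIM('a) * (1 + fact DIM('a)) * F 0"
proof -
  let ?e = "exp (- (norm x)\<^sup>2 / (4 * a))" and ?K = "(sqrt (4 * pi) / norm x) ^ DIM('a) * (1 + fact DIM('a))"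
  let ?U = "\<lambda>F. mixture_transform a F :: 'a \<Rightarrow> real"
  have "?e * ?U F 0 \<le> ?U F x \<and> (x \<noteq> 0 \<longrightarrow> ?U F x \<le> ?K * F 0)"
    using F
  proof induction
    case (exp r)
    let ?s = "a + r"
    have s: "0 < ?s" using a exp by simp
    have "mixture_transform a (\<lambda>z. exp (- r * z)) y = (LINT \<xi>|lborel. cos (y \<bullet> \<xi>) * exp (- ?s * (norm \<xi>)\<^sup>2))" for y :: 'a
    proof -
      have "exp (- a * z) * exp (- r * z) = exp (- ?s * z)" for z
        by (simp add: algebra_simps flip: exp_add)
      then show ?thesis unfolding mixture_transform_def by simp
    qed
    then have U: "mixture_transform a (\<lambda>z. exp (- r * z)) y = sqrt (pi / ?s) ^ DIM('a) * exp (- (norm y)\<^sup>2 / (4 * ?s))" for y :: 'a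
      unfolding gaussian_fourier(2)[OF s] .
    have "?e \<le> exp (- (norm x)\<^sup>2 / (4 * ?s))"
      using a exp by (simp add: divide_left_mono)
    then have "sqrt (pi / ?s) ^ DIM('a) * ?e \<le> sqrt (pi / ?s) ^ DIM('a) * exp (- (norm x)\<^sup>2 / (4 * ?s))"
      using s by (intro mult_left_mono) auto
    then show ?case unfolding U using heat_kernel_le[OF s, of x] by (auto simp: mult.commute)
  next
    case (add F G)
    have "?U (\<lambda>z. F z + G z) y = ?U F y + ?U G y" for y
      unfolding mixture_transform_def distrib_left
      by (intro Bochner_Integration.integral_add mixture_transform_integrable a add)
    with add show ?case by (auto simp: distrib_left intro!: add_mono)
  next
    case (scale c F)
    have "?U (\<lambda>z. c * F z) y = c * ?U F y" for y
      unfolding mixture_transform_def by (simp add: mult.left_commute[of _ c])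
    with scale show ?case by (auto simp: mult.left_commute[of _ c] intro!: mult_left_mono)
  next
    case (limit F G)
    have U: "(\<lambda>n. ?U (F n) y) \<longlonglongrightarrow> ?U G y" for y
      by (rule mixture_transform_limit[OF a limit(1,2)])
    have "?e * ?U G 0 \<le> ?U G x"
      by (rule LIMSEQ_le[OF tendsto_mult[OF tendsto_const U] U]) (use limit in auto)
    moreover have "?U G x \<le> ?K * G 0" if "x \<noteq> 0"
      by (rule LIMSEQ_le[OF U tendsto_mult[OF tendsto_const limit(2)]]) (use limit that in auto)
    ultimately show ?case by blast
  qed
  then show "?e * ?U F 0 \<le> ?U F x" "x \<noteq> 0 \<Longrightarrow> ?U F x \<le> ?K * F 0" by auto
qed

text \<open>
  Fubini's theorem for an integrand that is dominated by a product of integrable functions of one variable.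
\<close>

lemma integrable_pair_bound:
  fixes f :: "'a \<Rightarrow> 'b \<Rightarrow> real"
  assumes "sigma_finite_measure M" "sigma_finite_measure N"
    and p: "integrable M p" and r: "integrable N r"
    and f: "case_prod f \<in> borel_measurable (M \<Otimes>\<^sub>M N)"
    and bound: "\<And>x y. \<bar>f x y\<bar> \<le> p x * r y"
  shows "integrable (M \<Otimes>\<^sub>M N) (case_prod f)"
    and "(\<integral>x. (\<integral>y. f x y \<partial>N) \<partial>M) = (\<integral>y. (\<integral>x. f x y \<partial>M) \<partial>N)"
proof -
  interpret pair_sigma_finite M N
    using assms(1,2) by (simp add: pair_sigma_finite_def)
  note [measurable] = borel_measurable_integrable[OF p] borel_measurable_integrable[OF r]
  have "integrable (M \<Otimes>\<^sub>M N) (\<lambda>z. p (fst z) * r (snd z))"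
  proof (rule Fubini_integrable)
    have "integrable M (\<lambda>x. \<bar>p x\<bar> * (\<integral>y. \<bar>r y\<bar> \<partial>N))"
      using p by (intro integrable_mult_left) auto
    then show "integrable M (\<lambda>x. \<integral>y. norm (p (fst (x, y)) * r (snd (x, y))) \<partial>N)"
      by (simp add: abs_mult)
  qed (use r in auto)
  then show int: "integrable (M \<Otimes>\<^sub>M N) (case_prod f)"
    by (rule Bochner_Integration.integrable_bound[OF _ f]) (use bound in \<open>auto intro!: AE_I2 intro: order_trans[OF _ abs_ge_self]\<close>)
  show "(\<integral>x. (\<integral>y. f x y \<partial>N) \<partial>M) = (\<integral>y. (\<integral>x. f x y \<partial>M) \<partial>N)"
    using Fubini_integral[OF int] by simp
qed

lemma lborel_integral_affine:
  fixes f :: "'a::euclidean_space \<Rightarrow> real"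
  assumes [measurable]: "f \<in> borel_measurable borel" and c: "c \<noteq> 0"
  shows "(LINT x|lborel. f x) = \<bar>c\<bar> ^ DIM('a) * (LINT x|lborel. f (t + c *\<^sub>R x))"
proof -
  have "(LINT x|lborel. f x) = integral\<^sup>L (density (distr lborel borel (\<lambda>x. t + c *\<^sub>R x)) (\<lambda>_. ennreal (\<bar>c\<bar> ^ DIM('a)))) f"
    using lborel_affine[OF c, of t] by (simp add: ennreal_power)
  also have "\<dots> = (LINT x|distr lborel borel (\<lambda>x. t + c *\<^sub>R x). (\<bar>c\<bar> ^ DIM('a)) *\<^sub>R f x)"
    by (rule integral_density) auto
  also have "\<dots> = \<bar>c\<bar> ^ DIM('a) * (LINT x|lborel. f (t + c *\<^sub>R x))"
    by (simp add: integral_distr)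
  finally show ?thesis .
qed

text \<open>
  The Gaussians are an approximate identity of total mass \<open>(2 * pi) ^ DIM('a)\<close>; substitute
  \<open>\<xi> = \<eta> + 2 / sqrt (n + 1) * \<zeta>\<close>.
\<close>

lemma gaussian_smoothing_tendsto:
  fixes g :: "'a::euclidean_space \<Rightarrow> real"
  assumes g: "continuous_on UNIV g" "\<And>\<xi>. \<bar>g \<xi>\<bar> \<le> M"
  shows "(\<lambda>n. LINT \<xi>|lborel. g \<xi> * (sqrt (pi * real (Suc n)) ^ DIM('a) * exp (- (norm (\<xi> - \<eta>))\<^sup>2 * real (Suc n) / 4)))
    \<longlonglongrightarrow> (2 * pi) ^ DIM('a) * g \<eta>"
proof -
  have [measurable]: "g \<in> borel_measurable borel"
    using g(1) by (rule borel_measurable_continuous_onI)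
  \<comment> \<open>The substitution with this scaling turns the Gaussian of index \<open>n\<close> into \<open>exp (- (norm \<zeta>)\<^sup>2)\<close>.\<close>
  define c where "c n = 2 / sqrt (real (Suc n))" for n
  have c: "c n > 0" "c n * sqrt (pi * real (Suc n)) = 2 * sqrt pi" for n
    by (simp_all add: c_def real_sqrt_mult)
  have c2: "(c n)\<^sup>2 * real (Suc n) / 4 = 1" for n by (simp add: c_def power_divide)
  have eq: "(LINT \<xi>|lborel. g \<xi> * (sqrt (pi * real (Suc n)) ^ DIM('a) * exp (- (norm (\<xi> - \<eta>))\<^sup>2 * real (Suc n) / 4)))
      = (2 * sqrt pi) ^ DIM('a) * (LINT \<zeta>|lborel. g (\<eta> + c n *\<^sub>R \<zeta>) * exp (- 1 * (norm (\<zeta>::'a))\<^sup>2))" for n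
  proof -
    have e: "- (norm (\<eta> + c n *\<^sub>R \<zeta> - \<eta>))\<^sup>2 * real (Suc n) / 4 = - 1 * (norm \<zeta>)\<^sup>2" for \<zeta> :: 'a
    proof -
      have "(norm (\<eta> + c n *\<^sub>R \<zeta> - \<eta>))\<^sup>2 = (c n)\<^sup>2 * (norm \<zeta>)\<^sup>2" by (simp add: power_mult_distrib)
      then have "- (norm (\<eta> + c n *\<^sub>R \<zeta> - \<eta>))\<^sup>2 * real (Suc n) / 4 = - ((c n)\<^sup>2 * real (Suc n) / 4) * (norm \<zeta>)\<^sup>2" by simp
      then show ?thesis unfolding c2 by simp
    qed
    have p: "(2 * sqrt pi) ^ DIM('a) = c n ^ DIM('a) * sqrt (pi * real (Suc n)) ^ DIM('a)"
      unfolding c(2)[of n, symmetric] power_mult_distrib ..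
    have "(LINT \<xi>|lborel. g \<xi> * (sqrt (pi * real (Suc n)) ^ DIM('a) * exp (- (norm (\<xi> - \<eta>))\<^sup>2 * real (Suc n) / 4)))
      = \<bar>c n\<bar> ^ DIM('a) * (LINT \<zeta>|lborel. g (\<eta> + c n *\<^sub>R \<zeta>) * (sqrt (pi * real (Suc n)) ^ DIM('a) * exp (- (norm (\<eta> + c n *\<^sub>R \<zeta> - \<eta>))\<^sup>2 * real (Suc n) / 4)))"
      using c(1)[of n] by (intro lborel_integral_affine) auto
    also have "\<dots> = \<bar>c n\<bar> ^ DIM('a) * (sqrt (pi * real (Suc n)) ^ DIM('a) * (LINT \<zeta>|lborel. g (\<eta> + c n *\<^sub>R \<zeta>) * exp (- 1 * (norm (\<zeta>::'a))\<^sup>2)))"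
      unfolding e mult.left_commute[of _ "sqrt (pi * real (Suc n)) ^ DIM('a)"] by simp
    also have "\<bar>c n\<bar> = c n" using c(1)[of n] by simp
    finally show ?thesis by (simp only: p mult.assoc)
  qed
  have "(\<lambda>n. LINT \<zeta>|lborel. g (\<eta> + c n *\<^sub>R \<zeta>) * exp (- 1 * (norm (\<zeta>::'a))\<^sup>2)) \<longlonglongrightarrow> (LINT \<zeta>|lborel. g \<eta> * exp (- 1 * (norm (\<zeta>::'a))\<^sup>2))"
  proof (rule integral_dominated_convergence[where w = "\<lambda>\<zeta>. M * exp (- 1 * (norm \<zeta>)\<^sup>2)"])
    show "integrable lborel (\<lambda>\<zeta>::'a. M * exp (- 1 * (norm \<zeta>)\<^sup>2))"
      by (intro integrable_mult_right gaussian_fourier(1)) auto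
    show "AE \<zeta> in lborel. (\<lambda>n. g (\<eta> + c n *\<^sub>R \<zeta>) * exp (- 1 * (norm (\<zeta>::'a))\<^sup>2)) \<longlonglongrightarrow> g \<eta> * exp (- 1 * (norm \<zeta>)\<^sup>2)"
    proof (rule AE_I2)
      fix \<zeta> :: 'a
      have "c \<longlonglongrightarrow> 0" unfolding c_def
        by (intro tendsto_divide_0[OF tendsto_const] filterlim_at_top_imp_at_infinity
             filterlim_compose[OF sqrt_at_top] filterlim_compose[OF filterlim_real_sequentially] filterlim_Suc)
      then have "(\<lambda>n. \<eta> + c n *\<^sub>R \<zeta>) \<longlonglongrightarrow> \<eta> + 0 *\<^sub>R \<zeta>" by (intro tendsto_intros)
      moreover have "isCont g \<eta>" using g(1) by (simp add: continuous_on_eq_continuous_at)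
      ultimately have "(\<lambda>n. g (\<eta> + c n *\<^sub>R \<zeta>)) \<longlonglongrightarrow> g \<eta>"
        using isCont_tendsto_compose[of \<eta> g "\<lambda>n. \<eta> + c n *\<^sub>R \<zeta>" sequentially] by simp
      then show "(\<lambda>n. g (\<eta> + c n *\<^sub>R \<zeta>) * exp (- 1 * (norm \<zeta>)\<^sup>2)) \<longlonglongrightarrow> g \<eta> * exp (- 1 * (norm \<zeta>)\<^sup>2)"
        by (intro tendsto_intros)
    qed
  qed (use g(2) in \<open>auto simp: abs_mult\<close>)
  from tendsto_mult[OF tendsto_const this, of "(2 * sqrt pi) ^ DIM('a)"]
  have "(\<lambda>n. (2 * sqrt pi) ^ DIM('a) * (LINT \<zeta>|lborel. g (\<eta> + c n *\<^sub>R \<zeta>) * exp (- 1 * (norm (\<zeta>::'a))\<^sup>2)))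
     \<longlonglongrightarrow> (2 * sqrt pi) ^ DIM('a) * (g \<eta> * (LINT \<zeta>|lborel. cos (0 \<bullet> \<zeta>) * exp (- 1 * (norm (\<zeta>::'a))\<^sup>2)))"
    by simp
  also have "(2 * sqrt pi) ^ DIM('a) * (g \<eta> * (LINT \<zeta>|lborel. cos (0 \<bullet> \<zeta>) * exp (- 1 * (norm (\<zeta>::'a))\<^sup>2)))
      = (2 * pi) ^ DIM('a) * g \<eta>"
  proof -
    have "(LINT \<zeta>|lborel. cos (0 \<bullet> \<zeta>) * exp (- 1 * (norm (\<zeta>::'a))\<^sup>2)) = sqrt pi ^ DIM('a)"
      unfolding gaussian_fourier(2)[OF zero_less_one] by simp
    moreover have "(2 * sqrt pi) ^ DIM('a) * sqrt pi ^ DIM('a) = (2 * pi) ^ DIM('a)"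
      unfolding power_mult_distrib[symmetric] by (simp only: mult.assoc real_sqrt_mult_self) simp
    ultimately show ?thesis by (metis mult.assoc mult.commute)
  qed
  finally show ?thesis unfolding eq .
qed

section \<open>Fourier inversion for nonnegative functions\<close>

text \<open>
  Multiply \<open>u\<close> by the Gaussian cut-off \<open>exp (- (norm x)\<^sup>2 / (n + 1))\<close> and integrate against a cosine.  By Fubini this is a Gaussian
  smoothing of \<open>g\<close>, which converges.  For frequency 0 and \<open>u \<ge> 0\<close>, monotone convergence yields the integrability of
  \<open>u\<close>; then dominated convergence removes the cut-off for every frequency.
\<close>

lemma fourier_inversion_nonneg:
  fixes g :: "'a::euclidean_space \<Rightarrow> real" and \<eta> :: 'a
  assumes g: "continuous_on UNIV g" "integrable lborel g" "\<And>\<xi>. \<bar>g \<xi>\<bar> \<le> M" "\<And>\<xi>. g (- \<xi>) = g \<xi>"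
  defines "u \<equiv> \<lambda>x. LINT \<xi>|lborel. cos (x \<bullet> \<xi>) * g \<xi>"
  assumes pos: "\<And>x. 0 \<le> u x"
  shows "integrable lborel u"
    and "(LINT x|lborel. cos (x \<bullet> \<eta>) * u x) = (2 * pi) ^ DIM('a) * g \<eta>"
proof -
  have [measurable]: "g \<in> borel_measurable borel"
    using g(1) by (rule borel_measurable_continuous_onI)
  have [measurable]: "u \<in> borel_measurable borel"
    unfolding u_def by measurable
  define E where "E n x = exp (- (1 / real (Suc n)) * (norm x)\<^sup>2)" for n and x :: 'a
  have E_int: "integrable lborel (E n)" for n
    unfolding E_def[abs_def] by (rule gaussian_fourier(1)) simp
  have [measurable]: "E n \<in> borel_measurable borel" for n
    using borel_measurable_integrable[OF E_int] by simp
  let ?k = "\<lambda>n (\<xi>::'a). sqrt (pi * real (Suc n)) ^ DIM('a) * exp (- (norm \<xi>)\<^sup>2 * real (Suc n) / 4)"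
  have gauss: "(LINT x|lborel. cos (x \<bullet> y) * E n x) = ?k n y" for n y
    using gaussian_fourier(2)[of "1 / real (Suc n)" y] unfolding E_def by (simp add: inner_commute)
  have cos_E_int: "integrable lborel (\<lambda>x. cos (x \<bullet> y) * E n x)" for n y
    by (rule Bochner_Integration.integrable_bound[OF E_int[of n]])
       (auto simp: abs_mult E_def mult_left_le_one_le)
  have u_bound: "\<bar>u x\<bar> \<le> (LINT \<xi>|lborel. \<bar>g \<xi>\<bar>)" for x
  proof -
    have "integrable lborel (\<lambda>\<xi>. cos (x \<bullet> \<xi>) * g \<xi>)"
      by (rule Bochner_Integration.integrable_bound[OF g(2)]) (auto simp: abs_mult mult_left_le_one_le)
    then have "\<bar>u x\<bar> \<le> (LINT \<xi>|lborel. \<bar>cos (x \<bullet> \<xi>) * g \<xi>\<bar>)"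
      using integral_norm_bound[of lborel "\<lambda>\<xi>. cos (x \<bullet> \<xi>) * g \<xi>"] by (simp only: u_def real_norm_def)
    also have "\<dots> \<le> (LINT \<xi>|lborel. \<bar>g \<xi>\<bar>)"
      using g(2) \<open>integrable lborel (\<lambda>\<xi>. cos (x \<bullet> \<xi>) * g \<xi>)\<close>
      by (intro integral_mono integrable_abs) (auto simp: abs_mult mult_left_le_one_le)
    finally show ?thesis .
  qed
  have Eu_int: "integrable lborel (\<lambda>x. E n x * u x)" for n
    by (rule Bochner_Integration.integrable_bound[OF integrable_mult_left[OF E_int[of n], of "LINT \<xi>|lborel. \<bar>g \<xi>\<bar>"]])
       (auto simp: abs_mult E_def intro!: mult_left_mono order_trans[OF u_bound])
  have g_k_int: "integrable lborel (\<lambda>\<xi>. g \<xi> * ?k n (\<xi> - y))" for n y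
    by (rule Bochner_Integration.integrable_bound[OF integrable_mult_left[OF g(2), of "sqrt (pi * real (Suc n)) ^ DIM('a)"]])
       (auto simp: abs_mult intro!: mult_left_mono mult_left_le)
  have reg: "(LINT x|lborel. cos (x \<bullet> \<eta>) * (E n x * u x))
      = 1 / 2 * (LINT \<xi>|lborel. g \<xi> * ?k n (\<xi> - \<eta>)) + 1 / 2 * (LINT \<xi>|lborel. g \<xi> * ?k n (\<xi> - (- \<eta>)))" for n \<eta>
  proof -
    define f where "f x \<xi> = (cos (x \<bullet> \<eta>) * E n x) * (cos (x \<bullet> \<xi>) * g \<xi>)" for x \<xi>
    have f: "(LINT x|lborel. (LINT \<xi>|lborel. f x \<xi>)) = (LINT \<xi>|lborel. (LINT x|lborel. f x \<xi>))"
    proof (rule integrable_pair_bound(2)[OF _ _ E_int[of n] integrable_abs[OF g(2)]])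
      show "case_prod f \<in> borel_measurable (lborel \<Otimes>\<^sub>M lborel)"
        unfolding f_def by measurable
      fix x \<xi>
      have "\<bar>f x \<xi>\<bar> = \<bar>cos (x \<bullet> \<eta>) * cos (x \<bullet> \<xi>)\<bar> * (E n x * \<bar>g \<xi>\<bar>)"
        by (simp add: f_def abs_mult E_def)
      also have "\<dots> \<le> 1 * (E n x * \<bar>g \<xi>\<bar>)"
        unfolding abs_mult by (intro mult_right_mono mult_le_one) (auto simp: E_def)
      finally show "\<bar>f x \<xi>\<bar> \<le> E n x * \<bar>g \<xi>\<bar>" by simp
    qed (auto intro: lborel.sigma_finite_measure_axioms)
    \<comment> \<open>The product of the two cosines is a sum of cosines, so the Gaussian kernel appears centred at
      \<open>\<eta>\<close> and at \<open>- \<eta>\<close>; evenness of \<open>g\<close> identifies the two limits.\<close>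
    have "f x \<xi> = g \<xi> * (1 / 2 * (cos (x \<bullet> (\<xi> - \<eta>)) * E n x) + 1 / 2 * (cos (x \<bullet> (\<xi> - (- \<eta>))) * E n x))" for x \<xi>
    proof -
      have "cos (x \<bullet> \<eta>) * cos (x \<bullet> \<xi>) = (cos (x \<bullet> (\<xi> - \<eta>)) + cos (x \<bullet> (\<xi> - (- \<eta>)))) / 2"
        by (simp add: inner_simps cos_add cos_diff)
      moreover have "f x \<xi> = (cos (x \<bullet> \<eta>) * cos (x \<bullet> \<xi>)) * (E n x * g \<xi>)" by (simp add: f_def)
      moreover have "(A + B) / 2 * (e * w) = w * (1 / 2 * (A * e) + 1 / 2 * (B * e))" for A B e w :: real
        by (simp add: field_simps)
      ultimately show ?thesis by (simp only:)
    qed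
    then have "(LINT x|lborel. f x \<xi>) = g \<xi> * (1 / 2 * ?k n (\<xi> - \<eta>) + 1 / 2 * ?k n (\<xi> - (- \<eta>)))" for \<xi>
      by (simp only: integral_mult_right_zero
          Bochner_Integration.integral_add[OF integrable_mult_right[OF cos_E_int] integrable_mult_right[OF cos_E_int]] gauss)
    moreover have "(LINT \<xi>|lborel. f x \<xi>) = cos (x \<bullet> \<eta>) * (E n x * u x)" for x
      unfolding f_def u_def by simp
    ultimately have "(LINT x|lborel. cos (x \<bullet> \<eta>) * (E n x * u x))
        = (LINT \<xi>|lborel. g \<xi> * (1 / 2 * ?k n (\<xi> - \<eta>) + 1 / 2 * ?k n (\<xi> - (- \<eta>))))"
      using f by simp
    also have "\<dots> = (LINT \<xi>|lborel. 1 / 2 * (g \<xi> * ?k n (\<xi> - \<eta>)) + 1 / 2 * (g \<xi> * ?k n (\<xi> - (- \<eta>))))"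
      by (intro Bochner_Integration.integral_cong) (auto simp: algebra_simps)
    also have "\<dots> = 1 / 2 * (LINT \<xi>|lborel. g \<xi> * ?k n (\<xi> - \<eta>)) + 1 / 2 * (LINT \<xi>|lborel. g \<xi> * ?k n (\<xi> - (- \<eta>)))"
      by (simp only: integral_mult_right_zero
          Bochner_Integration.integral_add[OF integrable_mult_right[OF g_k_int] integrable_mult_right[OF g_k_int]])
    finally show ?thesis .
  qed
  have lim: "(\<lambda>n. LINT x|lborel. cos (x \<bullet> \<eta>) * (E n x * u x)) \<longlonglongrightarrow> (2 * pi) ^ DIM('a) * g \<eta>" for \<eta>
  proof -
    have "(\<lambda>n. LINT x|lborel. cos (x \<bullet> \<eta>) * (E n x * u x))
        \<longlonglongrightarrow> 1 / 2 * ((2 * pi) ^ DIM('a) * g \<eta>) + 1 / 2 * ((2 * pi) ^ DIM('a) * g (- \<eta>))"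
      unfolding reg by (intro tendsto_add tendsto_mult tendsto_const gaussian_smoothing_tendsto[OF g(1,3)])
    then show ?thesis unfolding g(4) by (simp add: mult_ac)
  qed
  have E_lim: "(\<lambda>n. E n x) \<longlonglongrightarrow> 1" for x
  proof -
    have "(\<lambda>n. exp (- (1 / real (Suc n)) * (norm x)\<^sup>2)) \<longlonglongrightarrow> exp (- 0 * (norm x)\<^sup>2)"
      by (intro tendsto_intros LIMSEQ_Suc[OF lim_1_over_n])
    then show ?thesis unfolding E_def by simp
  qed
  have Eu_lim: "(\<lambda>n. E n x * u x) \<longlonglongrightarrow> u x" for x
    using tendsto_mult[OF E_lim tendsto_const, of x "u x"] by simp
  show u_int: "integrable lborel u"
  proof (rule integrable_monotone_convergence[of lborel "\<lambda>n x. E n x * u x"])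
    show "AE x in lborel. mono (\<lambda>n. E n x * u x)"
    proof (intro AE_I2 monoI mult_right_mono pos)
      fix x :: 'a and m n :: nat assume "m \<le> n"
      then have "1 / real (Suc n) * (norm x)\<^sup>2 \<le> 1 / real (Suc m) * (norm x)\<^sup>2"
        by (intro mult_right_mono divide_left_mono) auto
      then show "E m x \<le> E n x" by (simp add: E_def)
    qed
    show "(\<lambda>n. LINT x|lborel. E n x * u x) \<longlonglongrightarrow> (2 * pi) ^ DIM('a) * g 0"
      using lim[of 0] by simp
  qed (use Eu_int Eu_lim in auto)
  have "(\<lambda>n. LINT x|lborel. cos (x \<bullet> \<eta>) * (E n x * u x)) \<longlonglongrightarrow> (LINT x|lborel. cos (x \<bullet> \<eta>) * u x)"
  proof (rule integral_dominated_convergence[where w = u])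
    show "AE x in lborel. norm (cos (x \<bullet> \<eta>) * (E n x * u x)) \<le> u x" for n
    proof (rule AE_I2)
      fix x
      have "\<bar>cos (x \<bullet> \<eta>)\<bar> * E n x * u x \<le> 1 * u x"
        using pos by (intro mult_right_mono mult_le_one) (auto simp: E_def)
      then show "norm (cos (x \<bullet> \<eta>) * (E n x * u x)) \<le> u x"
        using pos by (simp add: abs_mult E_def)
    qed
    show "AE x in lborel. (\<lambda>n. cos (x \<bullet> \<eta>) * (E n x * u x)) \<longlonglongrightarrow> cos (x \<bullet> \<eta>) * u x"
      by (intro AE_I2 tendsto_mult tendsto_const Eu_lim)
  qed (use u_int in auto)
  then show "(LINT x|lborel. cos (x \<bullet> \<eta>) * u x) = (2 * pi) ^ DIM('a) * g \<eta>"
    using lim[of \<eta>] by (rule LIMSEQ_unique)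
qed

section \<open>Smoothness of parameter integrals\<close>

text \<open>
  The mean value inequality bounds the difference quotients by \<open>2 * B\<close>, so dominated convergence applies along
  every sequence that tends to the point.
\<close>

lemma has_derivative_integral:
  fixes f :: "'p::{real_normed_vector, perfect_space} \<Rightarrow> 'b \<Rightarrow> real" and D :: "'p \<Rightarrow> 'b \<Rightarrow> 'p \<Rightarrow> real"
  assumes e: "0 < e"
    and f_int: "\<And>p. p \<in> ball p0 e \<Longrightarrow> integrable M (f p)"
    and der: "\<And>p \<xi>. p \<in> ball p0 e \<Longrightarrow> ((\<lambda>p. f p \<xi>) has_derivative D p \<xi>) (at p)"
    and bound: "\<And>p \<xi> v. p \<in> ball p0 e \<Longrightarrow> \<bar>D p \<xi> v\<bar> \<le> B \<xi> * norm v"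
    and B: "integrable M B"
    and meas: "\<And>v. (\<lambda>\<xi>. D p0 \<xi> v) \<in> borel_measurable M"
  shows "((\<lambda>p. \<integral>\<xi>. f p \<xi> \<partial>M) has_derivative (\<lambda>v. \<integral>\<xi>. D p0 \<xi> v \<partial>M)) (at p0)"
  unfolding has_derivative_at_within tendsto_at_iff_sequentially
proof (intro conjI allI impI)
  have p0: "p0 \<in> ball p0 e" using e by simp
  have D_int: "integrable M (\<lambda>\<xi>. D p0 \<xi> v)" for v
    by (rule Bochner_Integration.integrable_bound[OF integrable_mult_left[OF B, of "norm v"] meas])
       (auto intro!: AE_I2 order_trans[OF bound[OF p0]])
  have lin: "bounded_linear (D p0 \<xi>)" for \<xi>
    using has_derivative_bounded_linear[OF der[OF p0]] .
  show "bounded_linear (\<lambda>v. \<integral>\<xi>. D p0 \<xi> v \<partial>M)"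
  proof (rule bounded_linear_intro)
    show "(\<integral>\<xi>. D p0 \<xi> (v + w) \<partial>M) = (\<integral>\<xi>. D p0 \<xi> v \<partial>M) + (\<integral>\<xi>. D p0 \<xi> w \<partial>M)" for v w
      using D_int by (simp add: linear_add[OF bounded_linear.linear[OF lin]])
    show "(\<integral>\<xi>. D p0 \<xi> (r *\<^sub>R v) \<partial>M) = r *\<^sub>R (\<integral>\<xi>. D p0 \<xi> v \<partial>M)" for r v
      by (simp add: linear_scale[OF bounded_linear.linear[OF lin]])
    show "norm (\<integral>\<xi>. D p0 \<xi> v \<partial>M) \<le> norm v * (\<integral>\<xi>. B \<xi> \<partial>M)" for v
    proof -
      have "norm (\<integral>\<xi>. D p0 \<xi> v \<partial>M) \<le> (\<integral>\<xi>. norm (D p0 \<xi> v) \<partial>M)"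
        by (rule integral_norm_bound)
      also have "\<dots> \<le> (\<integral>\<xi>. B \<xi> * norm v \<partial>M)"
        using bound[OF p0] by (intro integral_mono integrable_norm D_int integrable_mult_left B) auto
      finally show ?thesis by (simp add: mult.commute)
    qed
  qed
  fix X :: "nat \<Rightarrow> 'p"
  assume X: "\<forall>i. X i \<in> UNIV - {p0}" and lim: "X \<longlonglongrightarrow> p0"
  have "\<forall>\<^sub>F i in sequentially. X i \<in> ball p0 e"
    using lim e by (intro topological_tendstoD) auto
  then obtain N where N: "\<And>i. N \<le> i \<Longrightarrow> X i \<in> ball p0 e"
    by (auto simp: eventually_sequentially)
  define Y where "Y i = X (i + N)" for i
  have Y: "Y i \<in> ball p0 e" "Y i \<noteq> p0" for i using N X by (auto simp: Y_def)
  have Y_lim: "Y \<longlonglongrightarrow> p0" unfolding Y_def using lim by (rule LIMSEQ_ignore_initial_segment)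
  define q where "q i \<xi> = (f (Y i) \<xi> - f p0 \<xi> - D p0 \<xi> (Y i - p0)) /\<^sub>R norm (Y i - p0)" for i \<xi>
  have "(\<lambda>i. \<integral>\<xi>. q i \<xi> \<partial>M) \<longlonglongrightarrow> (\<integral>\<xi>. 0 \<partial>M)"
  proof (rule integral_dominated_convergence[where w = "\<lambda>\<xi>. 2 * B \<xi>"])
    show "integrable M (\<lambda>\<xi>. 2 * B \<xi>)" using B by simp
    show "q i \<in> borel_measurable M" for i
      unfolding q_def[abs_def]
      using borel_measurable_integrable[OF f_int[OF Y(1)]] borel_measurable_integrable[OF f_int[OF p0]] meas
      by measurable
    show "AE \<xi> in M. (\<lambda>i. q i \<xi>) \<longlonglongrightarrow> 0"
    proof (rule AE_I2)
      fix \<xi>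
      have "((\<lambda>y. (f y \<xi> - f p0 \<xi> - D p0 \<xi> (y - p0)) /\<^sub>R norm (y - p0)) \<longlongrightarrow> 0) (at p0)"
        using der[OF p0] unfolding has_derivative_at_within by blast
      then show "(\<lambda>i. q i \<xi>) \<longlonglongrightarrow> 0"
        unfolding tendsto_at_iff_sequentially q_def using Y Y_lim by (auto simp: o_def)
    qed
    show "AE \<xi> in M. norm (q i \<xi>) \<le> 2 * B \<xi>" for i
    proof (rule AE_I2)
      fix \<xi>
      have onorm: "onorm (D p \<xi>) \<le> B \<xi>" if "p \<in> ball p0 e" for p
        using bound[OF that] by (intro onorm_le) simp
      have "norm (f (Y i) \<xi> - f p0 \<xi>) \<le> B \<xi> * norm (Y i - p0)"
        by (rule differentiable_bound[where S = "ball p0 e" and f' = "\<lambda>p. D p \<xi>"])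
           (use der onorm Y p0 in \<open>auto intro: has_derivative_at_withinI simp del: mem_ball\<close>)
      moreover have "\<bar>D p0 \<xi> (Y i - p0)\<bar> \<le> B \<xi> * norm (Y i - p0)"
        by (rule bound[OF p0])
      ultimately have "\<bar>f (Y i) \<xi> - f p0 \<xi> - D p0 \<xi> (Y i - p0)\<bar> \<le> 2 * B \<xi> * norm (Y i - p0)"
        unfolding real_norm_def by linarith
      moreover have "norm (Y i - p0) > 0" using Y(2)[of i] by simp
      ultimately show "norm (q i \<xi>) \<le> 2 * B \<xi>"
        by (simp add: q_def abs_mult field_simps)
    qed
  qed simp
  moreover have "(\<integral>\<xi>. q i \<xi> \<partial>M) = ((\<integral>\<xi>. f (Y i) \<xi> \<partial>M) - (\<integral>\<xi>. f p0 \<xi> \<partial>M) - (\<integral>\<xi>. D p0 \<xi> (Y i - p0) \<partial>M)) /\<^sub>R norm (Y i - p0)" for i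
    unfolding q_def using f_int[OF Y(1)] f_int[OF p0] D_int by simp
  ultimately have "(\<lambda>i. ((\<integral>\<xi>. f (X (i + N)) \<xi> \<partial>M) - (\<integral>\<xi>. f p0 \<xi> \<partial>M) - (\<integral>\<xi>. D p0 \<xi> (X (i + N) - p0) \<partial>M)) /\<^sub>R norm (X (i + N) - p0)) \<longlonglongrightarrow> 0"
    by (simp add: Y_def)
  then show "((\<lambda>y. ((\<integral>\<xi>. f y \<xi> \<partial>M) - (\<integral>\<xi>. f p0 \<xi> \<partial>M) - (\<integral>\<xi>. D p0 \<xi> (y - p0) \<partial>M)) /\<^sub>R norm (y - p0)) \<circ> X) \<longlonglongrightarrow> 0"
    unfolding o_def by (rule LIMSEQ_offset)
qed

text \<open>
  On an open set derivatives only see the values on that set.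
\<close>

lemma C_k_on_cong:
  assumes "open S" "C_k_on k S f" "\<And>x. x \<in> S \<Longrightarrow> f x = g x"
  shows "C_k_on k S g"
  using assms(2,3)
proof (induction k arbitrary: f g)
  case 0
  then show ?case using continuous_on_cong[OF refl, of S f g] by simp
next
  case (Suc k)
  have der: "(g has_derivative frechet_derivative f (at x)) (at x)" if "x \<in> S" for x
    by (rule has_derivative_transform_within_open[OF _ \<open>open S\<close> that, of f])
       (use Suc.prems that in \<open>auto simp flip: frechet_derivative_works\<close>)
  have "frechet_derivative f (at x) = frechet_derivative g (at x)" if "x \<in> S" for x
    using frechet_derivative_at[OF der[OF that]] .
  moreover have "C_k_on k S (\<lambda>x. frechet_derivative f (at x) v)" for v
    using Suc.prems by simp
  ultimately have "C_k_on k S (\<lambda>x. frechet_derivative g (at x) v)" for v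
    by - (rule Suc.IH[of "\<lambda>x. frechet_derivative f (at x) v"], simp_all)
  moreover have "g differentiable (at x)" if "x \<in> S" for x
    using der[OF that] by (auto simp: differentiable_def)
  ultimately show ?case by simp
qed

text \<open>
  A family of differentiable functions that contains its own directional derivatives consists of smooth functions.
\<close>

lemma smooth_on_derivative_closed:
  assumes "open S" and "P f"
    and closed: "\<And>f. P f \<Longrightarrow> \<exists>f'. (\<forall>x\<in>S. (f has_derivative f' x) (at x)) \<and> (\<forall>v. P (\<lambda>x. f' x v))"
  shows "smooth_on S f"
proof -
  have "C_k_on k S f" for k
    using \<open>P f\<close>
  proof (induction k arbitrary: f)
    case 0
    from closed[OF 0] obtain f' where "\<And>x. x \<in> S \<Longrightarrow> (f has_derivative f' x) (at x)" by blast
    then have "isCont f x" if "x \<in> S" for x using that has_derivative_continuous by blast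
    then show ?case by (simp add: continuous_at_imp_continuous_on)
  next
    case (Suc k)
    from closed[OF Suc.prems] obtain f' where f': "\<And>x. x \<in> S \<Longrightarrow> (f has_derivative f' x) (at x)"
      "\<And>v. P (\<lambda>x. f' x v)" by blast
    have "f' x = frechet_derivative f (at x)" if "x \<in> S" for x
      by (rule frechet_derivative_at[OF f'(1)[OF that]])
    then have "C_k_on k S (\<lambda>x. frechet_derivative f (at x) v)" for v
      by - (rule C_k_on_cong[OF \<open>open S\<close> Suc.IH[OF f'(2)]], simp)
    then show ?case using f'(1) by (auto simp: differentiable_def)
  qed
  then show ?thesis by (simp add: smooth_on_def)
qed

definition rapidly_decaying :: "('a::euclidean_space \<Rightarrow> real) \<Rightarrow> bool" where
  "rapidly_decaying w \<longleftrightarrow> w \<in> borel_measurable borel \<and> (\<forall>N. integrable lborel (\<lambda>\<xi>. norm \<xi> ^ N * w \<xi>))"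

lemma rapidly_decaying_measurable [measurable_dest]: "rapidly_decaying w \<Longrightarrow> w \<in> borel_measurable borel"
  by (simp add: rapidly_decaying_def)

lemma rapidly_decaying_integrable: "rapidly_decaying w \<Longrightarrow> integrable lborel w"
  unfolding rapidly_decaying_def by (drule conjunct2, drule spec[of _ 0]) simp

lemma rapidly_decaying_mult:
  assumes w: "rapidly_decaying w" and [measurable]: "h \<in> borel_measurable borel"
    and h: "\<And>\<xi>. \<bar>h \<xi>\<bar> \<le> C * (1 + norm \<xi> ^ j)"
  shows "rapidly_decaying (\<lambda>\<xi>. h \<xi> * w \<xi>)"
  unfolding rapidly_decaying_def
proof (intro conjI allI)
  note [measurable] = rapidly_decaying_measurable[OF w]
  show "(\<lambda>\<xi>. h \<xi> * w \<xi>) \<in> borel_measurable borel" by measurable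
  fix N
  have "integrable lborel (\<lambda>\<xi>. C * (norm \<xi> ^ N * w \<xi>) + C * (norm \<xi> ^ (N + j) * w \<xi>))"
    using w unfolding rapidly_decaying_def by (intro Bochner_Integration.integrable_add integrable_mult_right) auto
  then show "integrable lborel (\<lambda>\<xi>. norm \<xi> ^ N * (h \<xi> * w \<xi>))"
  proof (rule Bochner_Integration.integrable_bound)
    show "AE \<xi> in lborel. norm (norm \<xi> ^ N * (h \<xi> * w \<xi>)) \<le> norm (C * (norm \<xi> ^ N * w \<xi>) + C * (norm \<xi> ^ (N + j) * w \<xi>))"
    proof (rule AE_I2)
      fix \<xi> :: 'a
      have "C * (norm \<xi> ^ N * w \<xi>) + C * (norm \<xi> ^ (N + j) * w \<xi>) = (C * (1 + norm \<xi> ^ j)) * (norm \<xi> ^ N * w \<xi>)"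
        by (simp add: algebra_simps power_add)
      moreover have "\<bar>h \<xi>\<bar> * \<bar>norm \<xi> ^ N * w \<xi>\<bar> \<le> \<bar>C * (1 + norm \<xi> ^ j)\<bar> * \<bar>norm \<xi> ^ N * w \<xi>\<bar>"
        using h[of \<xi>] by (intro mult_right_mono) auto
      ultimately show "norm (norm \<xi> ^ N * (h \<xi> * w \<xi>)) \<le> norm (C * (norm \<xi> ^ N * w \<xi>) + C * (norm \<xi> ^ (N + j) * w \<xi>))"
        by (simp add: abs_mult mult_ac)
    qed
  qed measurable
qed

lemma norm_powr_le: "0 \<le> b \<Longrightarrow> b \<le> 2 \<Longrightarrow> norm x powr b \<le> 1 + norm x ^ 2"
proof (cases "norm x \<le> 1")
  case True
  assume "0 \<le> b"
  then have "norm x powr b \<le> 1" using True by (intro powr_le1) auto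
  then show ?thesis by (simp add: add_increasing2)
next
  case False
  assume "b \<le> 2"
  with False have "norm x powr b \<le> norm x powr 2" by (intro powr_mono) auto
  also have "\<dots> = norm x ^ 2" using False by (subst powr_numeral) auto
  finally show ?thesis by simp
qed

lemma rapidly_decaying_gaussian:
  assumes a: "0 < a"
  shows "rapidly_decaying (\<lambda>\<xi>::'a::euclidean_space. exp (- a * (norm \<xi>)\<^sup>2))"
  unfolding rapidly_decaying_def
proof (intro conjI allI)
  fix N
  define C where "C = 1 + fact N * (2 / a) ^ N"
  have "norm \<xi> ^ N * exp (- a * (norm \<xi>)\<^sup>2) \<le> C * exp (- (a / 2) * (norm \<xi>)\<^sup>2)" for \<xi> :: 'a
  proof -
    define r where "r = norm \<xi>"
    have r: "0 \<le> r" by (simp add: r_def)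
    define E where "E = exp (a / 2 * r\<^sup>2)"
    have "r ^ N \<le> 1 + (r\<^sup>2) ^ N"
    proof (cases "r \<le> 1")
      case True
      then have "r ^ N \<le> 1" using r by (intro power_le_one) auto
      then show ?thesis using r by (simp add: add_increasing2)
    next
      case False
      then have "r \<le> r\<^sup>2" by (simp add: power2_eq_square)
      then have "r ^ N \<le> (r\<^sup>2) ^ N" using r by (intro power_mono) auto
      then show ?thesis by simp
    qed
    moreover have "(r\<^sup>2) ^ N \<le> (2 / a) ^ N * (fact N * E)"
    proof -
      have "(a / 2 * r\<^sup>2) ^ N \<le> fact N * E"
        unfolding E_def using a by (intro power_le_fact_mult_exp) auto
      then have "(2 / a) ^ N * (a / 2 * r\<^sup>2) ^ N \<le> (2 / a) ^ N * (fact N * E)"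
        using a by (intro mult_left_mono) auto
      moreover have "(2 / a) ^ N * (a / 2 * r\<^sup>2) ^ N = (r\<^sup>2) ^ N"
        unfolding power_mult_distrib[symmetric] using a by simp
      ultimately show ?thesis by simp
    qed
    moreover have "1 \<le> E" using a by (simp add: E_def)
    moreover have "C * E = E + (2 / a) ^ N * (fact N * E)" by (simp add: C_def algebra_simps)
    ultimately have "r ^ N \<le> C * E" by linarith
    then have "r ^ N * exp (- a * r\<^sup>2) \<le> C * E * exp (- a * r\<^sup>2)" by (rule mult_right_mono) simp
    moreover have "E * exp (- a * r\<^sup>2) = exp (- (a / 2) * r\<^sup>2)"
      by (simp add: E_def field_simps flip: exp_add)
    ultimately show ?thesis by (simp only: r_def mult.assoc)
  qed
  then show "integrable lborel (\<lambda>\<xi>::'a. norm \<xi> ^ N * exp (- a * (norm \<xi>)\<^sup>2))"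
    using a by (intro Bochner_Integration.integrable_bound[OF integrable_mult_right[OF gaussian_fourier(1)[of "a / 2"], of C]])
       (auto intro!: AE_I2 order_trans[OF _ abs_ge_self])
qed measurable

context
  fixes a b :: real
  assumes a: "0 < a" "a \<le> 1" and b: "0 < b" "b \<le> 2"
begin

text \<open>
  The phase \<open>\<theta>\<close> makes the family stable under \<open>x\<close>-derivatives without a separate sine integral, since
  differentiation of a cosine is a shift by \<open>pi / 2\<close>.
\<close>

definition wave_integral :: "nat \<Rightarrow> real \<Rightarrow> ('a::euclidean_space \<Rightarrow> real) \<Rightarrow> real \<times> 'a \<Rightarrow> real" where
  "wave_integral m \<theta> w = (\<lambda>(t, x). LINT \<xi>|lborel.
     mittag_leffler_deriv a m (norm \<xi> powr b * t powr a) * (cos (x \<bullet> \<xi> + \<theta>) * w \<xi>))"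

lemma mittag_leffler_deriv_measurable [measurable]: "mittag_leffler_deriv a m \<in> borel_measurable borel"
  by (intro borel_measurable_continuous_onI continuous_mittag_leffler_deriv a continuous_on_id)

lemma wave_integrand_integrable:
  assumes w: "rapidly_decaying w"
  shows "integrable lborel (\<lambda>\<xi>. mittag_leffler_deriv a m (norm \<xi> powr b * t powr a) * (cos (x \<bullet> \<xi> + \<theta>) * w \<xi>))"
proof (rule Bochner_Integration.integrable_bound[OF integrable_mult_right[OF rapidly_decaying_integrable[OF w], of "mittag_leffler_deriv a m 0"]])
  note [measurable] = rapidly_decaying_measurable[OF w]
  show "(\<lambda>\<xi>. mittag_leffler_deriv a m (norm \<xi> powr b * t powr a) * (cos (x \<bullet> \<xi> + \<theta>) * w \<xi>)) \<in> borel_measurable lborel"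
    by measurable
  show "AE \<xi> in lborel. norm (mittag_leffler_deriv a m (norm \<xi> powr b * t powr a) * (cos (x \<bullet> \<xi> + \<theta>) * w \<xi>))
      \<le> norm (mittag_leffler_deriv a m 0 * w \<xi>)"
  proof (rule AE_I2)
    fix \<xi> :: 'a
    have "\<bar>mittag_leffler_deriv a m (norm \<xi> powr b * t powr a)\<bar> * (\<bar>cos (x \<bullet> \<xi> + \<theta>)\<bar> * \<bar>w \<xi>\<bar>)
        \<le> \<bar>mittag_leffler_deriv a m 0\<bar> * (1 * \<bar>w \<xi>\<bar>)"
      using mittag_leffler_deriv_bound[OF a, of "norm \<xi> powr b * t powr a" m]
      by (intro mult_mono mult_nonneg_nonneg abs_cos_le_one order_refl) auto
    then show "norm (mittag_leffler_deriv a m (norm \<xi> powr b * t powr a) * (cos (x \<bullet> \<xi> + \<theta>) * w \<xi>))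
      \<le> norm (mittag_leffler_deriv a m 0 * w \<xi>)" by (simp add: abs_mult)
  qed
qed

lemma has_derivative_wave_integral:
  fixes w :: "'a::euclidean_space \<Rightarrow> real"
  assumes w: "rapidly_decaying w" and t: "0 < t"
  shows "(wave_integral m \<theta> w has_derivative (\<lambda>(\<tau>, v).
     t powr (a - 1) * wave_integral (Suc m) \<theta> (\<lambda>\<xi>. (a * \<tau> * norm \<xi> powr b) * w \<xi>) (t, x)
     + wave_integral m (\<theta> + pi / 2) (\<lambda>\<xi>. (v \<bullet> \<xi>) * w \<xi>) (t, x))) (at (t, x))"
proof -
  note [measurable] = rapidly_decaying_measurable[OF w]
  let ?E = "mittag_leffler_deriv a"
  let ?f = "\<lambda>p \<xi>. ?E m (norm \<xi> powr b * fst p powr a) * (cos (snd p \<bullet> \<xi> + \<theta>) * w \<xi>)"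
  let ?D = "\<lambda>p \<xi> v. fst v * (?E (Suc m) (norm \<xi> powr b * fst p powr a) * (norm \<xi> powr b * (a * fst p powr (a - 1)))) * (cos (snd p \<bullet> \<xi> + \<theta>) * w \<xi>)
      + ?E m (norm \<xi> powr b * fst p powr a) * (- sin (snd p \<bullet> \<xi> + \<theta>) * (snd v \<bullet> \<xi>) * w \<xi>)"
  let ?B = "\<lambda>\<xi>. \<bar>?E (Suc m) 0\<bar> * (a * (t / 2) powr (a - 1)) * \<bar>norm \<xi> powr b * w \<xi>\<bar> + \<bar>?E m 0\<bar> * \<bar>norm \<xi> * w \<xi>\<bar>"
  have wb: "rapidly_decaying (\<lambda>\<xi>. norm \<xi> powr b * w \<xi>)"
    by (rule rapidly_decaying_mult[OF w, of _ 1 2]) (use b in \<open>auto intro: norm_powr_le\<close>)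
  have wn: "rapidly_decaying (\<lambda>\<xi>. norm \<xi> * w \<xi>)"
    by (rule rapidly_decaying_mult[OF w, of _ 1 1]) auto
  have wv: "rapidly_decaying (\<lambda>\<xi>. (v \<bullet> \<xi>) * w \<xi>)" for v
    by (rule rapidly_decaying_mult[OF w, of _ "norm v" 1])
       (auto simp: distrib_left intro: order_trans[OF Cauchy_Schwarz_ineq2])
  have half: "t / 2 < fst p" if "p \<in> ball (t, x) (t / 2)" for p :: "real \<times> 'a"
  proof -
    have "\<bar>t - fst p\<bar> \<le> dist (t, x) p" using dist_fst_le[of "(t, x)" p] by (simp add: dist_real_def)
    then show ?thesis using that by auto
  qed
  have "((\<lambda>p. LINT \<xi>|lborel. ?f p \<xi>) has_derivative (\<lambda>v. LINT \<xi>|lborel. ?D (t, x) \<xi> v)) (at (t, x))"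
  proof (rule has_derivative_integral[where e = "t / 2" and B = ?B])
    show "integrable lborel (?f p)" for p by (rule wave_integrand_integrable[OF w])
    show "integrable lborel ?B"
      by (intro Bochner_Integration.integrable_add integrable_mult_right integrable_abs rapidly_decaying_integrable wb wn)
    show "(\<lambda>\<xi>. ?D (t, x) \<xi> v) \<in> borel_measurable lborel" for v by measurable
    fix p :: "real \<times> 'a" and \<xi> :: 'a assume p: "p \<in> ball (t, x) (t / 2)"
    have fp: "0 < fst p" using half[OF p] t by simp
    have "((\<lambda>s. ?E m (norm \<xi> powr b * s powr a)) has_real_derivative
        ?E (Suc m) (norm \<xi> powr b * fst p powr a) * (norm \<xi> powr b * (a * fst p powr (a - 1)))) (at (fst p))"
      by (intro DERIV_chain2[OF has_real_derivative_mittag_leffler[OF a]] DERIV_cmult has_real_derivative_powr fp)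
    then have "((\<lambda>p. ?E m (norm \<xi> powr b * fst p powr a)) has_derivative
        (\<lambda>v. fst v * (?E (Suc m) (norm \<xi> powr b * fst p powr a) * (norm \<xi> powr b * (a * fst p powr (a - 1)))))) (at p)"
      by (rule DERIV_compose_FDERIV) (auto intro!: derivative_eq_intros)
    moreover have "((\<lambda>p. cos (snd p \<bullet> \<xi> + \<theta>) * w \<xi>) has_derivative
        (\<lambda>v. - sin (snd p \<bullet> \<xi> + \<theta>) * (snd v \<bullet> \<xi>) * w \<xi>)) (at p)"
      by (auto intro!: derivative_eq_intros)
    ultimately show "((\<lambda>p. ?f p \<xi>) has_derivative ?D p \<xi>) (at p)"
      by (rule has_derivative_eq_rhs[OF has_derivative_mult]) (simp add: fun_eq_iff)
    fix v :: "real \<times> 'a"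
    have 1: "\<bar>fst v\<bar> * (\<bar>?E (Suc m) (norm \<xi> powr b * fst p powr a)\<bar> * (norm \<xi> powr b * (a * fst p powr (a - 1)))) * (\<bar>cos (snd p \<bullet> \<xi> + \<theta>)\<bar> * \<bar>w \<xi>\<bar>)
      \<le> norm v * (\<bar>?E (Suc m) 0\<bar> * (norm \<xi> powr b * (a * (t / 2) powr (a - 1)))) * (1 * \<bar>w \<xi>\<bar>)"
      using mittag_leffler_deriv_bound[OF a, of "norm \<xi> powr b * fst p powr a" "Suc m"] norm_fst_le[of "fst v" "snd v"]
        powr_mono2'[of "a - 1" "t / 2" "fst p"] half[OF p] a t
      by (intro mult_mono mult_nonneg_nonneg abs_cos_le_one order_refl) (auto simp: algebra_simps)
    have 2: "\<bar>?E m (norm \<xi> powr b * fst p powr a)\<bar> * (\<bar>sin (snd p \<bullet> \<xi> + \<theta>)\<bar> * \<bar>snd v \<bullet> \<xi>\<bar> * \<bar>w \<xi>\<bar>)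
      \<le> \<bar>?E m 0\<bar> * (1 * (norm v * norm \<xi>) * \<bar>w \<xi>\<bar>)"
      using mittag_leffler_deriv_bound[OF a, of "norm \<xi> powr b * fst p powr a" "m"]
        order_trans[OF Cauchy_Schwarz_ineq2 mult_right_mono[OF norm_snd_le[of "snd v" "fst v"]], of \<xi>]
      by (intro mult_mono mult_nonneg_nonneg abs_sin_le_one order_refl) auto
    let ?D1 = "fst v * (?E (Suc m) (norm \<xi> powr b * fst p powr a) * (norm \<xi> powr b * (a * fst p powr (a - 1)))) * (cos (snd p \<bullet> \<xi> + \<theta>) * w \<xi>)"
    let ?D2 = "?E m (norm \<xi> powr b * fst p powr a) * (- sin (snd p \<bullet> \<xi> + \<theta>) * (snd v \<bullet> \<xi>) * w \<xi>)"
    have "\<bar>?D1 + ?D2\<bar> \<le> \<bar>?D1\<bar> + \<bar>?D2\<bar>" by (rule abs_triangle_ineq)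
    also have "\<bar>?D1\<bar> = \<bar>fst v\<bar> * (\<bar>?E (Suc m) (norm \<xi> powr b * fst p powr a)\<bar> * (norm \<xi> powr b * (a * fst p powr (a - 1)))) * (\<bar>cos (snd p \<bullet> \<xi> + \<theta>)\<bar> * \<bar>w \<xi>\<bar>)"
      using a by (simp add: abs_mult)
    also have "\<bar>?D2\<bar> = \<bar>?E m (norm \<xi> powr b * fst p powr a)\<bar> * (\<bar>sin (snd p \<bullet> \<xi> + \<theta>)\<bar> * \<bar>snd v \<bullet> \<xi>\<bar> * \<bar>w \<xi>\<bar>)"
      by (simp add: abs_mult)
    also note add_mono[OF 1 2]
    also have "norm v * (\<bar>?E (Suc m) 0\<bar> * (norm \<xi> powr b * (a * (t / 2) powr (a - 1)))) * (1 * \<bar>w \<xi>\<bar>)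
        + \<bar>?E m 0\<bar> * (1 * (norm v * norm \<xi>) * \<bar>w \<xi>\<bar>) = ?B \<xi> * norm v"
      by (simp add: abs_mult algebra_simps)
    finally show "\<bar>?D p \<xi> v\<bar> \<le> ?B \<xi> * norm v" by simp
  qed (use t in auto)
  also have "(\<lambda>v. LINT \<xi>|lborel. ?D (t, x) \<xi> v) = (\<lambda>(\<tau>, v).
     t powr (a - 1) * wave_integral (Suc m) \<theta> (\<lambda>\<xi>. (a * \<tau> * norm \<xi> powr b) * w \<xi>) (t, x)
     + wave_integral m (\<theta> + pi / 2) (\<lambda>\<xi>. (v \<bullet> \<xi>) * w \<xi>) (t, x))"
  proof (rule ext, clarify)
    fix \<tau> v
    let ?I1 = "\<lambda>\<xi>. ?E (Suc m) (norm \<xi> powr b * t powr a) * (cos (x \<bullet> \<xi> + \<theta>) * ((a * \<tau> * norm \<xi> powr b) * w \<xi>))"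
    let ?I2 = "\<lambda>\<xi>. ?E m (norm \<xi> powr b * t powr a) * (cos (x \<bullet> \<xi> + (\<theta> + pi / 2)) * ((v \<bullet> \<xi>) * w \<xi>))"
    have "rapidly_decaying (\<lambda>\<xi>. (a * \<tau> * norm \<xi> powr b) * w \<xi>)"
      using rapidly_decaying_mult[OF wb, of "\<lambda>_. a * \<tau>" "\<bar>a * \<tau>\<bar>" 0] by (simp add: mult.assoc)
    note int = wave_integrand_integrable[OF this, of "Suc m" t x \<theta>] wave_integrand_integrable[OF wv, of m t x "\<theta> + pi / 2" v]
    have "cos (y + (\<theta> + pi / 2)) = - sin (y + \<theta>)" for y
      using cos_add[of "y + \<theta>" "pi / 2"] by (simp add: add.assoc)
    then have "?D (t, x) \<xi> (\<tau>, v) = t powr (a - 1) * ?I1 \<xi> + ?I2 \<xi>" for \<xi>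
      by (simp add: mult_ac)
    then have "(LINT \<xi>|lborel. ?D (t, x) \<xi> (\<tau>, v)) = (LINT \<xi>|lborel. t powr (a - 1) * ?I1 \<xi> + ?I2 \<xi>)"
      by (simp only:)
    also have "\<dots> = t powr (a - 1) * (LINT \<xi>|lborel. ?I1 \<xi>) + (LINT \<xi>|lborel. ?I2 \<xi>)"
      using int by (simp only: Bochner_Integration.integral_add[OF integrable_mult_right] integral_mult_right_zero)
    finally show "(LINT \<xi>|lborel. ?D (t, x) \<xi> (\<tau>, v)) = t powr (a - 1) * wave_integral (Suc m) \<theta> (\<lambda>\<xi>. (a * \<tau> * norm \<xi> powr b) * w \<xi>) (t, x)
     + wave_integral m (\<theta> + pi / 2) (\<lambda>\<xi>. (v \<bullet> \<xi>) * w \<xi>) (t, x)"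
      by (simp add: wave_integral_def)
  qed
  also have "(\<lambda>p. LINT \<xi>|lborel. ?f p \<xi>) = wave_integral m \<theta> w"
    by (simp add: wave_integral_def fun_eq_iff)
  finally show ?thesis .
qed

text \<open>
  The powers of \<open>t\<close> come from the inner derivative of \<open>t powr a\<close>.
\<close>

inductive wave :: "(real \<times> 'a::euclidean_space \<Rightarrow> real) \<Rightarrow> bool" where
  base: "rapidly_decaying w \<Longrightarrow> wave (\<lambda>p. fst p powr q * wave_integral m \<theta> w p)"
| add: "wave f \<Longrightarrow> wave g \<Longrightarrow> wave (\<lambda>p. f p + g p)"

lemma wave_derivative:
  fixes f :: "real \<times> 'a::euclidean_space \<Rightarrow> real"
  assumes "wave f"
  shows "\<exists>f'. (\<forall>p\<in>{0<..} \<times> UNIV. (f has_derivative f' p) (at p)) \<and> (\<forall>v. wave (\<lambda>p. f' p v))"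
  using assms
proof induction
  case (base w q m \<theta>)
  let ?I1 = "\<lambda>\<tau>. wave_integral (Suc m) \<theta> (\<lambda>\<xi>. (a * \<tau> * norm \<xi> powr b) * w \<xi>)"
  let ?I2 = "\<lambda>v. wave_integral m (\<theta> + pi / 2) (\<lambda>\<xi>. (v \<bullet> \<xi>) * w \<xi>)"
  let ?I3 = "\<lambda>\<tau>. wave_integral m \<theta> (\<lambda>\<xi>. (q * \<tau>) * w \<xi>)"
  define f' where "f' p v = fst p powr (q - 1) * ?I3 (fst v) p + (fst p powr (q + a - 1) * ?I1 (fst v) p + fst p powr q * ?I2 (snd v) p)"
    for p v :: "real \<times> 'a"
  have "((\<lambda>p. fst p powr q * wave_integral m \<theta> w p) has_derivative f' (t, x)) (at (t, x))" if t: "0 < t" for t x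
  proof -
    have "((\<lambda>p::real \<times> 'a. fst p powr q) has_derivative (\<lambda>v. fst v * (q * t powr (q - 1)))) (at (t, x))"
      using t by (intro DERIV_compose_FDERIV[where g = fst]) (auto intro!: has_real_derivative_powr derivative_eq_intros)
    from has_derivative_mult[OF this has_derivative_wave_integral[OF base t]]
    show ?thesis
    proof (rule has_derivative_eq_rhs, intro ext)
      fix v :: "real \<times> 'a"
      have I3: "?I3 s (t, x) = q * s * wave_integral m \<theta> w (t, x)" for s
        by (simp add: wave_integral_def mult.left_commute[of _ "q * s"])
      have "t powr (q + a - 1) = t powr q * t powr (a - 1)"
        by (simp add: algebra_simps flip: powr_add)
      note eq = this
      show "fst (t, x) powr q * (case v of (\<tau>, v) \<Rightarrow> t powr (a - 1) * ?I1 \<tau> (t, x) + ?I2 v (t, x))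
          + fst v * (q * t powr (q - 1)) * wave_integral m \<theta> w (t, x) = f' (t, x) v"
        unfolding f'_def fst_conv I3 case_prod_beta eq by (simp add: algebra_simps)
    qed
  qed
  moreover have "wave (\<lambda>p. f' p v)" for v
    unfolding f'_def
  proof (intro wave.add wave.base)
    show "rapidly_decaying (\<lambda>\<xi>. (q * fst v) * w \<xi>)"
      by (rule rapidly_decaying_mult[OF base, of _ "\<bar>q * fst v\<bar>" 0]) auto
    show "rapidly_decaying (\<lambda>\<xi>. (snd v \<bullet> \<xi>) * w \<xi>)"
      by (rule rapidly_decaying_mult[OF base, of _ "norm (snd v)" 1])
         (auto simp: distrib_left intro: order_trans[OF Cauchy_Schwarz_ineq2])
    show "rapidly_decaying (\<lambda>\<xi>. (a * fst v * norm \<xi> powr b) * w \<xi>)"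
      by (rule rapidly_decaying_mult[OF base, of _ "\<bar>a * fst v\<bar>" 2])
         (use b in \<open>auto simp: abs_mult intro!: mult_left_mono norm_powr_le\<close>)
  qed
  ultimately show ?case by (intro exI[of _ f']) auto
next
  case (add f g)
  then obtain f' g' where f': "\<forall>p\<in>{0<..} \<times> UNIV. (f has_derivative f' p) (at p)" "\<forall>v. wave (\<lambda>p. f' p v)"
    and g': "\<forall>p\<in>{0<..} \<times> UNIV. (g has_derivative g' p) (at p)" "\<forall>v. wave (\<lambda>p. g' p v)"
    by blast
  show ?case
    by (rule exI[of _ "\<lambda>p v. f' p v + g' p v"]) (use f' g' in \<open>auto intro!: wave.add has_derivative_add\<close>)
qed

lemma wave_integral_smooth:
  assumes "rapidly_decaying (w :: 'a::euclidean_space \<Rightarrow> real)"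
  shows "smooth_on ({0<..} \<times> UNIV) (wave_integral m \<theta> w)"
proof -
  have S: "open ({0<..} \<times> (UNIV :: 'a set) :: (real \<times> 'a) set)" by (intro open_Times) auto
  have "smooth_on ({0<..} \<times> UNIV) (\<lambda>p. fst p powr 0 * wave_integral m \<theta> w p)"
    by (rule smooth_on_derivative_closed[OF S wave.base[OF assms] wave_derivative])
  then have "C_k_on k ({0<..} \<times> UNIV) (\<lambda>p. fst p powr 0 * wave_integral m \<theta> w p)" for k
    by (simp only: smooth_on_def)
  then have "C_k_on k ({0<..} \<times> UNIV) (wave_integral m \<theta> w)" for k
    by (rule C_k_on_cong[OF S]) auto
  then show ?thesis unfolding smooth_on_def by blast
qed

end

section \<open>The solutions with Gaussian initial value\<close>

lemma set_integral_rescale: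
  fixes h :: "real \<Rightarrow> real"
  assumes t: "0 < t"
  shows "set_integrable lborel {0<..<t} h \<longleftrightarrow> set_integrable lborel {0<..<1} (\<lambda>s. h (t * s))"
    and "(LBINT \<tau>:{0<..<t}. h \<tau>) = t * (LBINT s:{0<..<1}. h (t * s))"
proof -
  have ind: "indicator {0<..<t} (0 + t * s) = (indicator {0<..<1} s :: real)" for s
    using t by (auto simp: indicator_def mult_less_cancel_left_pos[of t s 1, simplified] zero_less_mult_iff)
  show "set_integrable lborel {0<..<t} h \<longleftrightarrow> set_integrable lborel {0<..<1} (\<lambda>s. h (t * s))"
    using lborel_integrable_real_affine_iff[of t "\<lambda>\<tau>. indicator {0<..<t} \<tau> *\<^sub>R h \<tau>" 0] t ind
    by (simp add: set_integrable_def)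
  show "(LBINT \<tau>:{0<..<t}. h \<tau>) = t * (LBINT s:{0<..<1}. h (t * s))"
    using lborel_integral_real_affine[of t "\<lambda>\<tau>. indicator {0<..<t} \<tau> *\<^sub>R h \<tau>" 0] t ind
    by (simp add: set_lebesgue_integral_def)
qed

lemma set_integral_Icc_eq_Ioo:
  fixes h :: "real \<Rightarrow> real"
  assumes [measurable]: "h \<in> borel_measurable borel"
  shows "set_integrable lborel {s..t} h \<longleftrightarrow> set_integrable lborel {s<..<t} h"
    and "(LBINT \<tau>:{s..t}. h \<tau>) = (LBINT \<tau>:{s<..<t}. h \<tau>)"
proof -
  have *: "AE \<tau> in lborel. indicator {s..t} \<tau> *\<^sub>R h \<tau> = indicator {s<..<t} \<tau> *\<^sub>R h \<tau>"
    using AE_lborel_singleton[of s] AE_lborel_singleton[of t]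
    by eventually_elim (auto simp: indicator_def)
  show "set_integrable lborel {s..t} h \<longleftrightarrow> set_integrable lborel {s<..<t} h"
    unfolding set_integrable_def by (rule integrable_cong_AE[OF _ _ *]) measurable
  show "(LBINT \<tau>:{s..t}. h \<tau>) = (LBINT \<tau>:{s<..<t}. h \<tau>)"
    unfolding set_lebesgue_integral_def by (rule integral_cong_AE[OF _ _ *]) measurable
qed

text \<open>
  The sine part of an even function integrates to 0.
\<close>

lemma fourier_integral_even:
  fixes h :: "'a::euclidean_space \<Rightarrow> real"
  assumes h: "integrable lborel h" and even: "\<And>x. h (- x) = h x"
  shows "(LINT x|lborel. exp (\<i> * of_real (x \<bullet> y)) * of_real (h x)) = of_real (LINT x|lborel. cos (x \<bullet> y) * h x)"
proof -
  note [measurable] = borel_measurable_integrable[OF h]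
  have e: "exp (\<i> * complex_of_real r) = cis r" for r by (simp add: cis_conv_exp)
  have int: "integrable lborel (\<lambda>x. cis (x \<bullet> y) * complex_of_real (h x))"
    by (rule Bochner_Integration.integrable_bound[OF h]) (auto simp: norm_mult)
  have "(LINT x|lborel. sin (x \<bullet> y) * h x) = \<bar>- 1\<bar> ^ DIM('a) * (LINT x|lborel. sin ((0 + (- 1) *\<^sub>R x) \<bullet> y) * h (0 + (- 1) *\<^sub>R x))"
    by (rule lborel_integral_affine) auto
  then have "(LINT x|lborel. sin (x \<bullet> y) * h x) = - (LINT x|lborel. sin (x \<bullet> y) * h x)"
    by (simp add: even)
  then have "(LINT x|lborel. sin (x \<bullet> y) * h x) = 0" by simp
  then have "(LINT x|lborel. cis (x \<bullet> y) * complex_of_real (h x)) = of_real (LINT x|lborel. cos (x \<bullet> y) * h x)"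
    by (intro complex_eqI) (simp_all flip: integral_Re[OF int] integral_Im[OF int])
  then show ?thesis unfolding e .
qed

lemma fourier_even:
  fixes h :: "'a::euclidean_space \<Rightarrow> real"
  assumes "integrable lborel h" "\<And>x. h (- x) = h x"
  shows "fourier (\<lambda>x. of_real (h x)) y = of_real ((2 * pi) powr (- real DIM('a) / 2) * (LINT x|lborel. cos (x \<bullet> y) * h x))"
    and "inverse_fourier (\<lambda>x. of_real (h x)) y = of_real ((2 * pi) powr (- real DIM('a) / 2) * (LINT x|lborel. cos (x \<bullet> y) * h x))"
  using fourier_integral_even[OF assms, of "- y"] fourier_integral_even[OF assms, of y]
  by (simp_all add: fourier_def inverse_fourier_def inner_commute)

context
  fixes a b :: real
  assumes a: "0 < a" "a < 1" and b: "0 < b" "b \<le> 2"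
begin

abbreviation E :: "real \<Rightarrow> real" where "E \<equiv> mittag_leffler_deriv a 0"

lemma mittag_leffler_measurable [measurable]: "E \<in> borel_measurable borel"
  using mittag_leffler_deriv_measurable[of a 0] a by simp

lemma mittag_leffler_bounds:
  assumes "0 \<le> x"
  shows "0 < E x" "E x \<le> 1" "\<bar>E x\<bar> \<le> 1" "1 / (1 + Gamma (1 - a) * x) \<le> E x"
proof -
  show low: "1 / (1 + Gamma (1 - a) * x) \<le> E x"
    using mittag_leffler_lower_bound[OF a assms] .
  have "0 < 1 + Gamma (1 - a) * x" using assms a by (intro add_pos_nonneg mult_nonneg_nonneg less_imp_le[OF Gamma_real_pos]) auto
  then have "0 < 1 / (1 + Gamma (1 - a) * x)" by simp
  then show "0 < E x" using low by linarith
  then show "E x \<le> 1" "\<bar>E x\<bar> \<le> 1"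
    using mittag_leffler_deriv_bound[of a x 0] a assms by (auto simp: mittag_leffler_0)
qed

lemma relaxation_continuous: "0 \<le> l \<Longrightarrow> continuous_on {0..} (\<lambda>\<tau>. E (l * \<tau> powr a))"
  using a by (intro continuous_intros continuous_on_powr') auto

text \<open>
  The identity \<open>mittag_leffler_abel_integral\<close>, transported from \<open>(0, 1)\<close> to \<open>(0, t)\<close>.
\<close>

lemma abel_integral_relaxation:
  assumes t: "0 < t" and l: "0 \<le> l"
  shows "(LBINT \<tau>:{0<..<t}. (t - \<tau>) powr (- a) * (E (l * \<tau> powr a) - 1))
    = - Gamma (1 - a) * (l * (LBINT \<tau>:{0<..<t}. E (l * \<tau> powr a)))"
    and "set_integrable lborel {0<..<t} (\<lambda>\<tau>. (t - \<tau>) powr (- a))"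
proof -
  define y where "y = l * t powr a"
  have scale: "E (l * (t * s) powr a) = E (y * s powr a)" "(t - t * s) powr (- a) = t powr (- a) * (1 - s) powr (- a)"
    if "s \<in> {0<..<1}" for s
  proof -
    show "E (l * (t * s) powr a) = E (y * s powr a)" using that t by (simp add: y_def powr_mult mult.assoc)
    have "t - t * s = t * (1 - s)" by (simp add: algebra_simps)
    then show "(t - t * s) powr (- a) = t powr (- a) * (1 - s) powr (- a)" using that t by (simp add: powr_mult)
  qed
  note V = mittag_leffler_abel_integral[OF a, of y]
  have B: "set_integrable lborel {0<..<1} (\<lambda>s. (1 - s) powr (- a))"
    "(LBINT s:{0<..<1}. (1 - s) powr (- a)) = Beta 1 (1 - a)"
  proof -
    have 1: "set_integrable lborel {0<..<1} (\<lambda>s. (1 - s) powr (- a)) = set_integrable lborel {0<..<1} (\<lambda>s::real. s powr (1 - 1) * (1 - s) powr (1 - a - 1))"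
      by (rule set_integrable_cong) auto
    have 2: "(LBINT s:{0<..<1}. (1 - s) powr (- a)) = (LBINT s:{0<..<1}. s powr (1 - 1) * (1 - s) powr (1 - a - 1))"
      by (rule set_lebesgue_integral_cong) auto
    show "set_integrable lborel {0<..<1} (\<lambda>s. (1 - s) powr (- a))"
      "(LBINT s:{0<..<1}. (1 - s) powr (- a)) = Beta 1 (1 - a)"
      unfolding 1 2 using Beta_set_integral[of 1 "1 - a"] a by auto
  qed
  have "set_integrable lborel {0<..<1} (\<lambda>s. (t - t * s) powr (- a)) = set_integrable lborel {0<..<1} (\<lambda>s. t powr (- a) * (1 - s) powr (- a))"
    by (rule set_integrable_cong) (simp_all add: scale)
  then show "set_integrable lborel {0<..<t} (\<lambda>\<tau>. (t - \<tau>) powr (- a))"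
    unfolding set_integral_rescale(1)[OF t] using B(1) by simp
  have "(LBINT \<tau>:{0<..<t}. (t - \<tau>) powr (- a) * (E (l * \<tau> powr a) - 1))
      = t * (LBINT s:{0<..<1}. (t - t * s) powr (- a) * (E (l * (t * s) powr a) - 1))"
    by (rule set_integral_rescale(2)[OF t])
  also have "(LBINT s:{0<..<1}. (t - t * s) powr (- a) * (E (l * (t * s) powr a) - 1))
      = (LBINT s:{0<..<1}. t powr (- a) * ((1 - s) powr (- a) * E (y * s powr a) - (1 - s) powr (- a)))"
    by (rule set_lebesgue_integral_cong) (simp_all add: scale right_diff_distrib mult.assoc)
  also have "\<dots> = t powr (- a) * ((LBINT s:{0<..<1}. (1 - s) powr (- a) * E (y * s powr a)) - (LBINT s:{0<..<1}. (1 - s) powr (- a)))"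
    using V(1) B(1) by simp
  also have "\<dots> = t powr (- a) * - (Gamma (1 - a) * (l * t powr a) * (LBINT s:{0<..<1}. E (y * s powr a)))"
    unfolding V(3) B(2) unfolding y_def by simp
  also have "t * \<dots> = - Gamma (1 - a) * (l * (t * (LBINT s:{0<..<1}. E (y * s powr a))))"
    using t by (simp add: powr_minus field_simps)
  also have "(LBINT s:{0<..<1}. E (y * s powr a)) = (LBINT s:{0<..<1}. E (l * (t * s) powr a))"
    by (rule set_lebesgue_integral_cong) (simp_all add: scale)
  also have "t * \<dots> = (LBINT \<tau>:{0<..<t}. E (l * \<tau> powr a))"
    by (rule set_integral_rescale(2)[OF t, symmetric])
  finally show "(LBINT \<tau>:{0<..<t}. (t - \<tau>) powr (- a) * (E (l * \<tau> powr a) - 1))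
    = - Gamma (1 - a) * (l * (LBINT \<tau>:{0<..<t}. E (l * \<tau> powr a)))" .
qed

lemma relaxation_antiderivative:
  assumes t: "0 < t" and l: "0 \<le> l"
  shows "((\<lambda>t. LBINT \<tau>:{0<..<t}. E (l * \<tau> powr a)) has_real_derivative E (l * t powr a)) (at t)"
    and "\<bar>LBINT \<tau>:{0<..<t}. E (l * \<tau> powr a)\<bar> \<le> t"
proof -
  have int: "set_integrable lborel {0..s} (\<lambda>\<tau>. E (l * \<tau> powr a))" for s
    unfolding set_integrable_def
    by (rule borel_integrable_compact) (auto intro: continuous_on_subset[OF relaxation_continuous[OF l]])
  have eq: "(LBINT \<tau>:{0<..<s}. E (l * \<tau> powr a)) = integral {0..s} (\<lambda>\<tau>. E (l * \<tau> powr a))" for s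
    using set_borel_integral_eq_integral(2)[OF int] by (subst set_integral_Icc_eq_Ioo(2)[symmetric]) auto
  have "((\<lambda>s. integral {0..s} (\<lambda>\<tau>. E (l * \<tau> powr a))) has_real_derivative E (l * t powr a)) (at t within {0..t + 1})"
    using t by (intro integral_has_real_derivative continuous_on_subset[OF relaxation_continuous[OF l]]) auto
  moreover have "at t within {0..t + 1} = at t" using t by (intro at_within_interior) auto
  ultimately show "((\<lambda>t. LBINT \<tau>:{0<..<t}. E (l * \<tau> powr a)) has_real_derivative E (l * t powr a)) (at t)"
    unfolding eq by simp
  have "norm (integral (cbox 0 t) (\<lambda>\<tau>. E (l * \<tau> powr a))) \<le> 1 * measure lborel (cbox 0 t)"
    by (rule integrable_bound[OF _ set_borel_integral_eq_integral(1)[OF int, of t, unfolded box_real(2)[symmetric]]])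
       (use mittag_leffler_bounds l in auto)
  then show "\<bar>LBINT \<tau>:{0<..<t}. E (l * \<tau> powr a)\<bar> \<le> t" unfolding eq using t by simp
qed

text \<open>
  The solution whose initial value is a multiple of \<open>exp (- (norm x)\<^sup>2 / (4 * \<epsilon>))\<close>.
\<close>

definition gaussian_solution :: "real \<Rightarrow> real \<Rightarrow> 'a::euclidean_space \<Rightarrow> real" where
  "gaussian_solution \<epsilon> t x = wave_integral a b 0 0 (\<lambda>\<xi>. exp (- \<epsilon> * (norm \<xi>)\<^sup>2)) (t, x)"

lemma gaussian_solution_eq:
  "gaussian_solution \<epsilon> t x = (LINT \<xi>|lborel. E (norm \<xi> powr b * t powr a) * (cos (x \<bullet> \<xi>) * exp (- \<epsilon> * (norm \<xi>)\<^sup>2)))"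
  using a b by (simp add: gaussian_solution_def wave_integral_def)

lemma gaussian_solution_integrable:
  assumes "0 < \<epsilon>"
  shows "integrable lborel (\<lambda>\<xi>::'a::euclidean_space. E (norm \<xi> powr b * t powr a) * (cos (x \<bullet> \<xi>) * exp (- \<epsilon> * (norm \<xi>)\<^sup>2)))"
  using wave_integrand_integrable[of a b "\<lambda>\<xi>. exp (- \<epsilon> * (norm \<xi>)\<^sup>2)" 0 t x 0] a b rapidly_decaying_gaussian[OF assms] by simp

lemma gaussian_solution_smooth:
  "0 < \<epsilon> \<Longrightarrow> smooth_on ({0<..} \<times> UNIV) (\<lambda>(t, x::'a::euclidean_space). gaussian_solution \<epsilon> t x)"
  using wave_integral_smooth[of a b "\<lambda>\<xi>. exp (- \<epsilon> * (norm \<xi>)\<^sup>2)" 0 0] a b rapidly_decaying_gaussian[of \<epsilon>]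
  by (simp add: gaussian_solution_def case_prod_beta)

lemma symbol_laplace_mixture: "0 \<le> t \<Longrightarrow> laplace_mixture (\<lambda>z. E (z powr (b / 2) * t powr a))"
  using laplace_mixture_powr[OF laplace_mixture_dilate[OF mittag_leffler_laplace_mixture[of a 0], of "t powr a"], of "b / 2"] a b
  by (simp add: mult.commute)

lemma gaussian_solution_mixture:
  "gaussian_solution \<epsilon> t x = mixture_transform \<epsilon> (\<lambda>z. E (z powr (b / 2) * t powr a)) x"
proof -
  have "(norm \<xi>)\<^sup>2 powr (b / 2) = norm \<xi> powr b" for \<xi> :: 'a
    by (simp add: powr_powr flip: powr_numeral)
  then show ?thesis unfolding gaussian_solution_eq mixture_transform_def by (simp add: mult_ac)
qed

lemma gaussian_solution_bounds:
  fixes x :: "'a::euclidean_space"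
  assumes "0 < \<epsilon>" "0 \<le> t"
  shows "exp (- (norm x)\<^sup>2 / (4 * \<epsilon>)) * gaussian_solution \<epsilon> t (0::'a) \<le> gaussian_solution \<epsilon> t x"
    and "x \<noteq> 0 \<Longrightarrow> gaussian_solution \<epsilon> t x \<le> (sqrt (4 * pi) / norm x) ^ DIM('a) * (1 + fact DIM('a))"
  using mixture_transform_bounds[OF assms(1) symbol_laplace_mixture[OF assms(2)], of x] b
  by (simp_all add: gaussian_solution_mixture mittag_leffler_0)

text \<open>
  At the origin the integrand is positive, so it may be restricted to a ball, on which the Gaussian weight is at least its boundary value.
\<close>

lemma gaussian_solution_origin_ge:
  assumes \<epsilon>: "0 < \<epsilon>" and t: "0 \<le> t" and R: "0 \<le> R"
  shows "exp (- \<epsilon> * R\<^sup>2) * (LINT \<xi>:ball (0::'a::euclidean_space) R|lborel. E (norm \<xi> powr b * t powr a)) \<le> gaussian_solution \<epsilon> t (0::'a)"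
    and "set_integrable lborel (ball (0::'a) R) (\<lambda>\<xi>. E (norm \<xi> powr b * t powr a))"
proof -
  have "integrable lborel (indicator (ball (0::'a) R) :: 'a \<Rightarrow> real)"
    by (intro integrable_real_indicator emeasure_lborel_ball_finite) auto
  then show int: "set_integrable lborel (ball (0::'a) R) (\<lambda>\<xi>. E (norm \<xi> powr b * t powr a))"
    unfolding set_integrable_def
    by (rule Bochner_Integration.integrable_bound) (use mittag_leffler_bounds in \<open>auto simp: abs_mult indicator_def\<close>)
  have "(LINT \<xi>|lborel. exp (- \<epsilon> * R\<^sup>2) * (indicator (ball (0::'a) R) \<xi> *\<^sub>R E (norm \<xi> powr b * t powr a)))
      \<le> (LINT \<xi>|lborel. E (norm \<xi> powr b * t powr a) * (cos (0 \<bullet> \<xi>) * exp (- \<epsilon> * (norm (\<xi>::'a))\<^sup>2)))"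
  proof (rule integral_mono)
    show "integrable lborel (\<lambda>\<xi>. exp (- \<epsilon> * R\<^sup>2) * (indicator (ball (0::'a) R) \<xi> *\<^sub>R E (norm \<xi> powr b * t powr a)))"
      using int unfolding set_integrable_def by (rule integrable_mult_right)
    show "integrable lborel (\<lambda>\<xi>::'a. E (norm \<xi> powr b * t powr a) * (cos (0 \<bullet> \<xi>) * exp (- \<epsilon> * (norm \<xi>)\<^sup>2)))"
      by (rule gaussian_solution_integrable[OF \<epsilon>])
    fix \<xi> :: 'a
    have "0 < E (norm \<xi> powr b * t powr a)" by (rule mittag_leffler_bounds) auto
    moreover have "exp (- \<epsilon> * R\<^sup>2) \<le> exp (- \<epsilon> * (norm \<xi>)\<^sup>2)" if "norm \<xi> < R"
      using that \<epsilon> by (auto intro!: mult_left_mono power_mono)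
    ultimately show "exp (- \<epsilon> * R\<^sup>2) * (indicator (ball (0::'a) R) \<xi> *\<^sub>R E (norm \<xi> powr b * t powr a))
       \<le> E (norm \<xi> powr b * t powr a) * (cos (0 \<bullet> \<xi>) * exp (- \<epsilon> * (norm \<xi>)\<^sup>2))"
      by (auto simp: indicator_def mult.commute[of "exp _"] intro!: mult_left_mono)
  qed
  then show "exp (- \<epsilon> * R\<^sup>2) * (LINT \<xi>:ball (0::'a) R|lborel. E (norm \<xi> powr b * t powr a)) \<le> gaussian_solution \<epsilon> t (0::'a)"
    unfolding gaussian_solution_eq set_lebesgue_integral_def by simp
qed

text \<open>
  The shell between the radii \<open>R\<close> and \<open>2 * R\<close> has volume at least a constant times \<open>R ^ d\<close>, and
  \<open>E\<close> is at least a constant times \<open>R powr (- b)\<close> on it.  For \<open>b \<le> d\<close> and \<open>R = 2 ^ N\<close>, each of the \<open>N\<close> shells inside the ball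
  contributes at least the same positive amount.
\<close>

lemma symbol_ball_integral_ge:
  assumes d: "b \<le> real DIM('a::euclidean_space)" and t: "0 \<le> t"
  shows "real N * (unit_ball_vol (real DIM('a)) / (1 + 4 * (Gamma (1 - a) * t powr a)))
    \<le> (LINT \<xi>:ball (0::'a) (2 ^ N)|lborel. E (norm \<xi> powr b * t powr a))"
proof (induction N)
  case 0
  have "0 \<le> (LINT \<xi>:ball (0::'a) 1|lborel. E (norm \<xi> powr b * t powr a))"
    unfolding set_lebesgue_integral_def
    by (intro integral_nonneg_AE AE_I2) (auto simp: indicator_def intro!: less_imp_le[OF mittag_leffler_bounds(1)])
  then show ?case by simp
next
  case (Suc N)
  let ?I = "\<lambda>R. LINT \<xi>:ball (0::'a) R|lborel. E (norm \<xi> powr b * t powr a)"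
  let ?d = "DIM('a)" and ?G = "Gamma (1 - a) * t powr a" and ?V = "unit_ball_vol (real DIM('a))"
  define R :: real where "R = 2 ^ N"
  have R: "1 \<le> R" by (simp add: R_def)
  have G: "0 \<le> ?G" using a by (intro mult_nonneg_nonneg less_imp_le[OF Gamma_real_pos]) auto
  define q where "q = 1 / (R powr b * (1 + 4 * ?G))"
  have q: "0 \<le> q" using G R by (simp add: q_def)
  have low: "q \<le> E (norm \<xi> powr b * t powr a)" if "norm \<xi> < 2 * R" for \<xi> :: 'a
  proof -
    have "norm \<xi> powr b \<le> (2 * R) powr b" using that b by (intro powr_mono2) auto
    also have "\<dots> = 2 powr b * R powr b" using R by (simp add: powr_mult)
    also have "\<dots> \<le> 4 * R powr b"
      using powr_mono[of b 2 2] b by (intro mult_right_mono) auto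
    finally have "?G * norm \<xi> powr b \<le> ?G * (4 * R powr b)" using G by (intro mult_left_mono) auto
    moreover have "1 \<le> R powr b" using R b by (intro ge_one_powr_ge_zero) auto
    ultimately have "1 + Gamma (1 - a) * (norm \<xi> powr b * t powr a) \<le> R powr b * (1 + 4 * ?G)"
      by (simp add: algebra_simps)
    moreover have "0 < 1 + Gamma (1 - a) * (norm \<xi> powr b * t powr a)"
      using a by (intro add_pos_nonneg mult_nonneg_nonneg less_imp_le[OF Gamma_real_pos]) auto
    moreover have "0 < R powr b * (1 + 4 * ?G)" using G R by (intro mult_pos_pos) auto
    ultimately have "q \<le> 1 / (1 + Gamma (1 - a) * (norm \<xi> powr b * t powr a))"
      unfolding q_def by (intro divide_left_mono) auto
    also have "\<dots> \<le> E (norm \<xi> powr b * t powr a)" by (rule mittag_leffler_bounds) auto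
    finally show ?thesis .
  qed
  have ball_int: "integrable lborel (indicator (ball (0::'a) r) :: 'a \<Rightarrow> real)" for r
    by (intro integrable_real_indicator emeasure_lborel_ball_finite) auto
  have "(LINT \<xi>|lborel. q * (indicator (ball (0::'a) (2 * R)) \<xi> - indicator (ball (0::'a) R) \<xi>))
      \<le> (LINT \<xi>|lborel. indicator (ball (0::'a) (2 * R)) \<xi> *\<^sub>R E (norm \<xi> powr b * t powr a)
           - indicator (ball (0::'a) R) \<xi> *\<^sub>R E (norm \<xi> powr b * t powr a))"
    using gaussian_solution_origin_ge(2)[OF zero_less_one t, of "2 * R"] gaussian_solution_origin_ge(2)[OF zero_less_one t, of R] R ball_int
    unfolding set_integrable_def
    by (intro integral_mono Bochner_Integration.integrable_diff integrable_mult_right ball_int) (auto simp: indicator_def low)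
  also have "\<dots> = ?I (2 * R) - ?I R"
    using gaussian_solution_origin_ge(2)[OF zero_less_one t, of "2 * R"] gaussian_solution_origin_ge(2)[OF zero_less_one t, of R] R
    unfolding set_integrable_def set_lebesgue_integral_def by (intro Bochner_Integration.integral_diff) auto
  also have "(LINT \<xi>|lborel. q * (indicator (ball (0::'a) (2 * R)) \<xi> - indicator (ball (0::'a) R) \<xi>))
      = q * (?V * (2 * R) ^ ?d - ?V * R ^ ?d)"
    using ball_int R by (simp add: content_ball)
  finally have step: "q * (?V * (2 * R) ^ ?d - ?V * R ^ ?d) \<le> ?I (2 * R) - ?I R" .
  have "?V / (1 + 4 * ?G) \<le> q * (?V * (2 * R) ^ ?d - ?V * R ^ ?d)"
  proof -
    have "(2::real) ^ 1 \<le> 2 ^ ?d" by (intro power_increasing) (auto simp: Suc_leI)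
    then have "2 * R ^ ?d \<le> 2 ^ ?d * R ^ ?d" using R by (intro mult_right_mono) auto
    then have "R ^ ?d \<le> (2 * R) ^ ?d - R ^ ?d" by (simp add: power_mult_distrib)
    moreover have "R powr b \<le> R ^ ?d" using R d powr_mono[OF d R] by (simp add: powr_realpow)
    ultimately have "R powr b \<le> (2 * R) ^ ?d - R ^ ?d" by linarith
    then have "q * ?V * R powr b \<le> q * ?V * ((2 * R) ^ ?d - R ^ ?d)"
      using q by (intro mult_left_mono) auto
    moreover have "q * ?V * R powr b = ?V / (1 + 4 * ?G)" using R by (simp add: q_def)
    ultimately show ?thesis by (simp add: algebra_simps)
  qed
  moreover have "real N * (?V / (1 + 4 * ?G)) \<le> ?I R"
    using Suc.IH by (simp only: R_def)
  moreover have "real (Suc N) * (?V / (1 + 4 * ?G)) = real N * (?V / (1 + 4 * ?G)) + ?V / (1 + 4 * ?G)"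
    by (simp only: of_nat_Suc distrib_right mult_1 add.commute)
  ultimately have "real (Suc N) * (?V / (1 + 4 * ?G)) \<le> ?I (2 * R)"
    using step by linarith
  then show ?case by (simp only: R_def power_Suc)
qed

text \<open>
  At the origin the integral has a positive integrand; elsewhere the solution is at least a positive
  multiple of its value at the origin, being a mixture of Gaussians.
\<close>

lemma gaussian_solution_pos:
  fixes x :: "'a::euclidean_space"
  assumes "b \<le> real DIM('a)" "0 < \<epsilon>" "0 \<le> t"
  shows "0 < gaussian_solution \<epsilon> t x"
proof -
  have "0 \<le> Gamma (1 - a) * t powr a" using a by (intro mult_nonneg_nonneg less_imp_le[OF Gamma_real_pos]) auto
  then have "0 < unit_ball_vol (real DIM('a)) / (1 + 4 * (Gamma (1 - a) * t powr a))"
    by (intro divide_pos_pos) auto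
  also have "\<dots> \<le> (LINT \<xi>:ball (0::'a) 2|lborel. E (norm \<xi> powr b * t powr a))"
    using symbol_ball_integral_ge[OF assms(1,3), of 1] by simp
  finally have "0 < exp (- \<epsilon> * 2\<^sup>2) * (LINT \<xi>:ball (0::'a) 2|lborel. E (norm \<xi> powr b * t powr a))"
    by simp
  also have "\<dots> \<le> gaussian_solution \<epsilon> t (0::'a)"
    by (rule gaussian_solution_origin_ge) (use assms in auto)
  finally have "0 < exp (- (norm x)\<^sup>2 / (4 * \<epsilon>)) * gaussian_solution \<epsilon> t (0::'a)" by simp
  also have "\<dots> \<le> gaussian_solution \<epsilon> t x" by (rule gaussian_solution_bounds) fact+
  finally show ?thesis .
qed

lemma gaussian_solution_origin_blowup:
  assumes "b \<le> real DIM('a::euclidean_space)" "0 \<le> t"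
  shows "filterlim (\<lambda>n. gaussian_solution (1 / real (Suc n)) t (0::'a)) at_top sequentially"
  unfolding filterlim_at_top
proof
  fix Z :: real
  define c where "c = unit_ball_vol (real DIM('a)) / (1 + 4 * (Gamma (1 - a) * t powr a))"
  have "0 \<le> Gamma (1 - a) * t powr a" using a by (intro mult_nonneg_nonneg less_imp_le[OF Gamma_real_pos]) auto
  then have c: "0 < c" unfolding c_def by (intro divide_pos_pos) auto
  obtain N :: nat where N: "2 * \<bar>Z\<bar> / c \<le> real N" using real_arch_simple by blast
  have "(\<lambda>n. exp (- (1 / real (Suc n)) * (2 ^ N)\<^sup>2)) \<longlonglongrightarrow> exp (- 0 * (2 ^ N)\<^sup>2)"
    by (intro tendsto_intros LIMSEQ_Suc[OF lim_1_over_n])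
  then have "\<forall>\<^sub>F n in sequentially. 1 / 2 < exp (- (1 / real (Suc n)) * (2 ^ N)\<^sup>2)"
    by (rule order_tendstoD) simp
  then show "\<forall>\<^sub>F n in sequentially. Z \<le> gaussian_solution (1 / real (Suc n)) t (0::'a)"
  proof eventually_elim
    case (elim n)
    have "Z \<le> 1 / 2 * (real N * c)" using N c by (simp add: field_simps)
    also have "\<dots> \<le> exp (- (1 / real (Suc n)) * (2 ^ N)\<^sup>2) * (LINT \<xi>:ball (0::'a) (2 ^ N)|lborel. E (norm \<xi> powr b * t powr a))"
      using elim symbol_ball_integral_ge[OF assms, of N, folded c_def] c
      by (intro mult_mono mult_nonneg_nonneg) auto
    also have "\<dots> \<le> gaussian_solution (1 / real (Suc n)) t (0::'a)"
      by (rule gaussian_solution_origin_ge) (use assms in auto)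
    finally show ?case .
  qed
qed

lemma gaussian_solution_ratio:
  fixes x :: "'a::euclidean_space"
  assumes d: "b \<le> real DIM('a)" and t: "0 \<le> t" "0 \<le> t'" and x: "x \<noteq> 0"
  shows "filterlim (\<lambda>n. gaussian_solution (1 / real (Suc n)) t (0::'a) / gaussian_solution (1 / real (Suc n)) t' x) at_top sequentially"
proof -
  define K where "K = (sqrt (4 * pi) / norm x) ^ DIM('a) * (1 + fact DIM('a))"
  have K: "0 < K" unfolding K_def using x by (intro mult_pos_pos zero_less_power) (auto intro: add_pos_nonneg)
  have "filterlim (\<lambda>n. 1 / K * gaussian_solution (1 / real (Suc n)) t (0::'a)) at_top sequentially"
    using K by (intro filterlim_tendsto_pos_mult_at_top[OF tendsto_const] gaussian_solution_origin_blowup d t) auto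
  then show ?thesis
  proof (rule filterlim_at_top_mono, intro always_eventually allI)
    fix n
    have e: "0 < 1 / real (Suc n)" by simp
    have "gaussian_solution (1 / real (Suc n)) t' x \<le> K"
      unfolding K_def using gaussian_solution_bounds(2)[OF e t(2) x] .
    then have "gaussian_solution (1 / real (Suc n)) t (0::'a) / K \<le> gaussian_solution (1 / real (Suc n)) t (0::'a) / gaussian_solution (1 / real (Suc n)) t' x"
      using gaussian_solution_pos[OF d e t(1), of 0] gaussian_solution_pos[OF d e t(2), of x] K
      by (intro divide_left_mono mult_pos_pos) (auto intro: less_imp_le)
    then show "1 / K * gaussian_solution (1 / real (Suc n)) t (0::'a) \<le> gaussian_solution (1 / real (Suc n)) t (0::'a) / gaussian_solution (1 / real (Suc n)) t' x"
      by simp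
  qed
qed

lemma gaussian_solution_continuous:
  assumes \<epsilon>: "0 < \<epsilon>"
  shows "continuous_on ({0..} \<times> UNIV) (\<lambda>(t, x::'a::euclidean_space). gaussian_solution \<epsilon> t x)"
  unfolding continuous_on_sequentially
proof (intro ballI allI impI)
  fix p :: "real \<times> 'a" and X :: "nat \<Rightarrow> real \<times> 'a"
  assume p: "p \<in> {0..} \<times> UNIV" and X: "(\<forall>n. X n \<in> {0..} \<times> UNIV) \<and> X \<longlonglongrightarrow> p"
  then have X0: "0 \<le> fst (X n)" for n by (simp add: mem_Times_iff)
  have lim: "(\<lambda>n. fst (X n)) \<longlonglongrightarrow> fst p" "(\<lambda>n. snd (X n)) \<longlonglongrightarrow> snd p"
    using X by (auto intro: tendsto_fst tendsto_snd)
  have "(\<lambda>n. gaussian_solution \<epsilon> (fst (X n)) (snd (X n))) \<longlonglongrightarrow> gaussian_solution \<epsilon> (fst p) (snd p)"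
    unfolding gaussian_solution_eq
  proof (rule integral_dominated_convergence[where w = "\<lambda>\<xi>. exp (- \<epsilon> * (norm \<xi>)\<^sup>2)"])
    show "integrable lborel (\<lambda>\<xi>::'a. exp (- \<epsilon> * (norm \<xi>)\<^sup>2))" by (rule gaussian_fourier(1)[OF \<epsilon>])
    show "AE \<xi> in lborel. norm (E (norm \<xi> powr b * fst (X n) powr a) * (cos (snd (X n) \<bullet> \<xi>) * exp (- \<epsilon> * (norm \<xi>)\<^sup>2)))
        \<le> exp (- \<epsilon> * (norm \<xi>)\<^sup>2)" for n
    proof (rule AE_I2)
      fix \<xi> :: 'a
      have "\<bar>E (norm \<xi> powr b * fst (X n) powr a)\<bar> * (\<bar>cos (snd (X n) \<bullet> \<xi>)\<bar> * exp (- \<epsilon> * (norm \<xi>)\<^sup>2)) \<le> 1 * (1 * exp (- \<epsilon> * (norm \<xi>)\<^sup>2))"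
        by (intro mult_mono mult_nonneg_nonneg abs_cos_le_one order_refl mittag_leffler_bounds) auto
      then show "norm (E (norm \<xi> powr b * fst (X n) powr a) * (cos (snd (X n) \<bullet> \<xi>) * exp (- \<epsilon> * (norm \<xi>)\<^sup>2)))
        \<le> exp (- \<epsilon> * (norm \<xi>)\<^sup>2)" by (simp add: abs_mult)
    qed
    show "AE \<xi> in lborel. (\<lambda>n. E (norm \<xi> powr b * fst (X n) powr a) * (cos (snd (X n) \<bullet> \<xi>) * exp (- \<epsilon> * (norm \<xi>)\<^sup>2)))
       \<longlonglongrightarrow> E (norm \<xi> powr b * fst p powr a) * (cos (snd p \<bullet> \<xi>) * exp (- \<epsilon> * (norm \<xi>)\<^sup>2))"
    proof (rule AE_I2)
      fix \<xi> :: 'a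
      have "isCont E (norm \<xi> powr b * fst p powr a)"
        using has_real_derivative_mittag_leffler[of a 0] a by (intro DERIV_isCont) auto
      moreover have "(\<lambda>n. norm \<xi> powr b * fst (X n) powr a) \<longlonglongrightarrow> norm \<xi> powr b * fst p powr a"
        using a X0 by (intro tendsto_mult tendsto_const tendsto_powr'[OF lim(1)]) auto
      ultimately have "(\<lambda>n. E (norm \<xi> powr b * fst (X n) powr a)) \<longlonglongrightarrow> E (norm \<xi> powr b * fst p powr a)"
        by (rule isCont_tendsto_compose)
      then show "(\<lambda>n. E (norm \<xi> powr b * fst (X n) powr a) * (cos (snd (X n) \<bullet> \<xi>) * exp (- \<epsilon> * (norm \<xi>)\<^sup>2)))
       \<longlonglongrightarrow> E (norm \<xi> powr b * fst p powr a) * (cos (snd p \<bullet> \<xi>) * exp (- \<epsilon> * (norm \<xi>)\<^sup>2))"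
        by (intro tendsto_intros lim)
    qed
  qed measurable
  then show "((\<lambda>(t, x). gaussian_solution \<epsilon> t x) \<circ> X) \<longlonglongrightarrow> (case p of (t, x) \<Rightarrow> gaussian_solution \<epsilon> t x)"
    by (simp add: o_def case_prod_beta)
qed

lemma gaussian_solution_even: "gaussian_solution \<epsilon> t (- x) = gaussian_solution \<epsilon> t x"
  unfolding gaussian_solution_eq by simp

text \<open>
  The Fourier transform of \<open>gaussian_solution \<epsilon> t\<close> up to a constant factor.
\<close>

definition symbol :: "real \<Rightarrow> real \<Rightarrow> 'a::euclidean_space \<Rightarrow> real" where
  "symbol \<epsilon> t \<xi> = E (norm \<xi> powr b * t powr a) * exp (- \<epsilon> * (norm \<xi>)\<^sup>2)"

lemma symbol_bound: "\<bar>symbol \<epsilon> t \<xi>\<bar> \<le> exp (- \<epsilon> * (norm \<xi>)\<^sup>2)"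
  using mittag_leffler_bounds(3)[of "norm \<xi> powr b * t powr a"] by (simp add: symbol_def abs_mult)

lemma symbol_measurable [measurable]: "symbol \<epsilon> t \<in> borel_measurable borel"
  unfolding symbol_def by measurable

lemma symbol_integrable:
  assumes \<epsilon>: "0 < \<epsilon>"
  shows "integrable lborel (symbol \<epsilon> t :: 'a::euclidean_space \<Rightarrow> real)"
    and "integrable lborel (\<lambda>\<xi>::'a. norm \<xi> powr b * symbol \<epsilon> t \<xi>)"
proof -
  show "integrable lborel (symbol \<epsilon> t :: 'a \<Rightarrow> real)"
    by (rule Bochner_Integration.integrable_bound[OF gaussian_fourier(1)[OF \<epsilon>]]) (use symbol_bound in auto)
  have "rapidly_decaying (\<lambda>\<xi>::'a. norm \<xi> powr b * exp (- \<epsilon> * (norm \<xi>)\<^sup>2))"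
    by (rule rapidly_decaying_mult[OF rapidly_decaying_gaussian[OF \<epsilon>], of _ 1 2])
       (use b in \<open>auto intro: norm_powr_le\<close>)
  from rapidly_decaying_integrable[OF this]
  show "integrable lborel (\<lambda>\<xi>::'a. norm \<xi> powr b * symbol \<epsilon> t \<xi>)"
    by (rule Bochner_Integration.integrable_bound)
       (auto simp: abs_mult intro!: AE_I2 mult_left_mono symbol_bound[simplified])
qed

lemma gaussian_solution_fourier:
  fixes y :: "'a::euclidean_space"
  assumes d: "b \<le> real DIM('a)" and \<epsilon>: "0 < \<epsilon>" and t: "0 \<le> t"
  shows "integrable lborel (gaussian_solution \<epsilon> t :: 'a \<Rightarrow> real)"
    and "(LINT x|lborel. cos (x \<bullet> y) * gaussian_solution \<epsilon> t x) = (2 * pi) ^ DIM('a) * symbol \<epsilon> t y"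
proof -
  have gs: "gaussian_solution \<epsilon> t = (\<lambda>x::'a. LINT \<xi>|lborel. cos (x \<bullet> \<xi>) * symbol \<epsilon> t \<xi>)"
    unfolding gaussian_solution_eq[abs_def] symbol_def by (simp add: mult_ac)
  have "continuous_on UNIV (symbol \<epsilon> t :: 'a \<Rightarrow> real)"
    unfolding symbol_def using a b by (intro continuous_intros continuous_on_powr') auto
  moreover have "\<bar>symbol \<epsilon> t \<xi>\<bar> \<le> 1" for \<xi> :: 'a
    using symbol_bound[of \<epsilon> t \<xi>] \<epsilon> by (auto elim: order_trans)
  moreover have "symbol \<epsilon> t (- \<xi>) = symbol \<epsilon> t \<xi>" for \<xi> :: 'a by (simp add: symbol_def)
  moreover have "0 \<le> (LINT \<xi>|lborel. cos (x \<bullet> \<xi>) * symbol \<epsilon> t \<xi>)" for x :: 'a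
    using gaussian_solution_pos[OF d \<epsilon> t, of x] unfolding gs by simp
  ultimately show "integrable lborel (gaussian_solution \<epsilon> t :: 'a \<Rightarrow> real)"
    "(LINT x|lborel. cos (x \<bullet> y) * gaussian_solution \<epsilon> t x) = (2 * pi) ^ DIM('a) * symbol \<epsilon> t y"
    unfolding gs using fourier_inversion_nonneg[of "symbol \<epsilon> t :: 'a \<Rightarrow> real" 1] symbol_integrable(1)[OF \<epsilon>] by blast+
qed

lemma gaussian_solution_frac_laplacian:
  fixes x :: "'a::euclidean_space"
  assumes d: "b \<le> real DIM('a)" and \<epsilon>: "0 < \<epsilon>" and t: "0 \<le> t"
  shows "frac_laplacian_dom b (\<lambda>x::'a. of_real (gaussian_solution \<epsilon> t x))"
    and "frac_laplacian b (\<lambda>x. of_real (gaussian_solution \<epsilon> t x)) x = of_real (LINT \<xi>|lborel. cos (x \<bullet> \<xi>) * (norm \<xi> powr b * symbol \<epsilon> t \<xi>))"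
proof -
  define c where "c = (2 * pi) powr (- real DIM('a) / 2)"
  have c: "c * (c * (2 * pi) ^ DIM('a)) = 1"
  proof -
    have "(2 * pi) ^ DIM('a) = (2 * pi) powr real DIM('a)" by (simp add: powr_realpow)
    then show ?thesis unfolding c_def by (simp flip: powr_add)
  qed
  define h where "h \<xi> = c * (2 * pi) ^ DIM('a) * (norm \<xi> powr b * symbol \<epsilon> t \<xi>)" for \<xi> :: 'a
  have F: "of_real (norm \<xi> powr b) * fourier (\<lambda>x::'a. of_real (gaussian_solution \<epsilon> t x)) \<xi> = of_real (h \<xi>)" for \<xi>
    unfolding fourier_even(1)[OF gaussian_solution_fourier(1)[OF assms] gaussian_solution_even]
      gaussian_solution_fourier(2)[OF assms] by (simp add: h_def c_def mult_ac)
  have h: "integrable lborel h" unfolding h_def[abs_def]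
    by (intro integrable_mult_right symbol_integrable(2) \<epsilon>)
  have h_even: "h (- \<xi>) = h \<xi>" for \<xi> by (simp add: h_def symbol_def)
  show "frac_laplacian_dom b (\<lambda>x::'a. of_real (gaussian_solution \<epsilon> t x))"
    unfolding frac_laplacian_dom_def F using h gaussian_solution_fourier(1)[OF assms] by (auto intro: integrable_of_real)
  have "frac_laplacian b (\<lambda>x. of_real (gaussian_solution \<epsilon> t x)) x = of_real (c * (LINT \<xi>|lborel. cos (\<xi> \<bullet> x) * h \<xi>))"
    unfolding frac_laplacian_def F fourier_even(2)[OF h h_even] c_def ..
  also have "(LINT \<xi>|lborel. cos (\<xi> \<bullet> x) * h \<xi>) = c * (2 * pi) ^ DIM('a) * (LINT \<xi>|lborel. cos (x \<bullet> \<xi>) * (norm \<xi> powr b * symbol \<epsilon> t \<xi>))"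
    unfolding h_def mult.left_commute[of _ "c * (2 * pi) ^ DIM('a)"] integral_mult_right_zero by (simp add: inner_commute)
  also have "c * \<dots> = (LINT \<xi>|lborel. cos (x \<bullet> \<xi>) * (norm \<xi> powr b * symbol \<epsilon> t \<xi>))"
    using c by (simp only: mult.assoc[symmetric] mult_1)
  finally show "frac_laplacian b (\<lambda>x. of_real (gaussian_solution \<epsilon> t x)) x = of_real (LINT \<xi>|lborel. cos (x \<bullet> \<xi>) * (norm \<xi> powr b * symbol \<epsilon> t \<xi>))" .
qed

lemma gaussian_solution_increment:
  assumes \<epsilon>: "0 < \<epsilon>"
  shows "gaussian_solution \<epsilon> t x - gaussian_solution \<epsilon> 0 x = (LINT \<xi>|lborel. (E (norm \<xi> powr b * t powr a) - 1) * (cos (x \<bullet> \<xi>) * exp (- \<epsilon> * (norm \<xi>)\<^sup>2)))"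
proof -
  have "gaussian_solution \<epsilon> t x - gaussian_solution \<epsilon> 0 x = (LINT \<xi>|lborel. E (norm \<xi> powr b * t powr a) * (cos (x \<bullet> \<xi>) * exp (- \<epsilon> * (norm \<xi>)\<^sup>2))
      - E (norm \<xi> powr b * 0 powr a) * (cos (x \<bullet> \<xi>) * exp (- \<epsilon> * (norm \<xi>)\<^sup>2)))"
    unfolding gaussian_solution_eq by (intro Bochner_Integration.integral_diff[symmetric] gaussian_solution_integrable[OF \<epsilon>])
  also have "\<dots> = (LINT \<xi>|lborel. (E (norm \<xi> powr b * t powr a) - 1) * (cos (x \<bullet> \<xi>) * exp (- \<epsilon> * (norm \<xi>)\<^sup>2)))"
    by (simp add: mittag_leffler_0 left_diff_distrib)
  finally show ?thesis .
qed

lemma gaussian_solution_measurable [measurable]: "(\<lambda>t. gaussian_solution \<epsilon> t x) \<in> borel_measurable borel"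
  unfolding gaussian_solution_eq by measurable

text \<open>
  Fubini moves the fractional time integral inside the Fourier integral, where the relaxation identity applies for each frequency.
\<close>

lemma gaussian_solution_rl_kernel_integral:
  fixes x :: "'a::euclidean_space"
  assumes \<epsilon>: "0 < \<epsilon>" and t: "0 < t"
  shows "rl_kernel_integral a (\<lambda>\<tau>. gaussian_solution \<epsilon> \<tau> x - gaussian_solution \<epsilon> 0 x) t
    = (LINT \<xi>|lborel. - (norm \<xi> powr b * (LBINT \<tau>:{0<..<t}. E (norm \<xi> powr b * \<tau> powr a))) * (cos (x \<bullet> \<xi>) * exp (- \<epsilon> * (norm \<xi>)\<^sup>2)))"
proof -
  let ?g = "\<lambda>\<xi>::'a. cos (x \<bullet> \<xi>) * exp (- \<epsilon> * (norm \<xi>)\<^sup>2)"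
  let ?p = "\<lambda>\<tau>. indicator {0<..<t} \<tau> *\<^sub>R (t - \<tau>) powr (- a)"
  define f where "f \<tau> \<xi> = ?p \<tau> * ((E (norm \<xi> powr b * \<tau> powr a) - 1) * ?g \<xi>)" for \<tau> and \<xi> :: 'a
  have g: "0 < Gamma (1 - a)" using a by (intro Gamma_real_pos) auto
  have fub: "(LINT \<tau>|lborel. (LINT \<xi>|lborel. f \<tau> \<xi>)) = (LINT \<xi>|lborel. (LINT \<tau>|lborel. f \<tau> \<xi>))"
  proof (rule integrable_pair_bound(2)[where p = ?p and r = "\<lambda>\<xi>. 2 * exp (- \<epsilon> * (norm \<xi>)\<^sup>2)"])
    show "integrable lborel ?p"
      using abel_integral_relaxation(2)[OF t order_refl] unfolding set_integrable_def .
    show "integrable lborel (\<lambda>\<xi>::'a. 2 * exp (- \<epsilon> * (norm \<xi>)\<^sup>2))"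
      by (intro integrable_mult_right gaussian_fourier(1) \<epsilon>)
    show "case_prod f \<in> borel_measurable (lborel \<Otimes>\<^sub>M lborel)"
      unfolding f_def by measurable
    fix \<tau> and \<xi> :: 'a
    have "\<bar>E (norm \<xi> powr b * \<tau> powr a) - 1\<bar> \<le> 2"
      using mittag_leffler_bounds(3)[of "norm \<xi> powr b * \<tau> powr a"] by auto
    then have "\<bar>?p \<tau>\<bar> * (\<bar>E (norm \<xi> powr b * \<tau> powr a) - 1\<bar> * (\<bar>cos (x \<bullet> \<xi>)\<bar> * exp (- \<epsilon> * (norm \<xi>)\<^sup>2)))
       \<le> ?p \<tau> * (2 * (1 * exp (- \<epsilon> * (norm \<xi>)\<^sup>2)))"
      by (intro mult_mono mult_nonneg_nonneg abs_cos_le_one order_refl) auto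
    then show "\<bar>f \<tau> \<xi>\<bar> \<le> ?p \<tau> * (2 * exp (- \<epsilon> * (norm \<xi>)\<^sup>2))"
      by (simp add: f_def abs_mult)
  qed (auto intro: lborel.sigma_finite_measure_axioms)
  have "(LBINT \<tau>:{0..t}. (t - \<tau>) powr (- a) * (gaussian_solution \<epsilon> \<tau> x - gaussian_solution \<epsilon> 0 x)) = (LBINT \<tau>:{0<..<t}. (t - \<tau>) powr (- a) * (gaussian_solution \<epsilon> \<tau> x - gaussian_solution \<epsilon> 0 x))"
    by (rule set_integral_Icc_eq_Ioo) measurable
  also have "\<dots> = (LINT \<tau>|lborel. (LINT \<xi>|lborel. f \<tau> \<xi>))"
    unfolding set_lebesgue_integral_def gaussian_solution_increment[OF \<epsilon>] f_def by (simp add: mult.assoc)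
  also have "\<dots> = (LINT \<xi>|lborel. - Gamma (1 - a) * (norm \<xi> powr b * (LBINT \<tau>:{0<..<t}. E (norm \<xi> powr b * \<tau> powr a))) * ?g \<xi>)"
    unfolding fub
  proof (rule Bochner_Integration.integral_cong[OF refl])
    fix \<xi> :: 'a
    have "(LINT \<tau>|lborel. f \<tau> \<xi>) = (LBINT \<tau>:{0<..<t}. (t - \<tau>) powr (- a) * (E (norm \<xi> powr b * \<tau> powr a) - 1)) * ?g \<xi>"
      unfolding f_def set_lebesgue_integral_def by (simp flip: mult.assoc)
    then show "(LINT \<tau>|lborel. f \<tau> \<xi>) = - Gamma (1 - a) * (norm \<xi> powr b * (LBINT \<tau>:{0<..<t}. E (norm \<xi> powr b * \<tau> powr a))) * ?g \<xi>"
      using abel_integral_relaxation(1)[OF t, of "norm \<xi> powr b"] by simp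
  qed
  also have "\<dots> = Gamma (1 - a) * (LINT \<xi>|lborel. - (norm \<xi> powr b * (LBINT \<tau>:{0<..<t}. E (norm \<xi> powr b * \<tau> powr a))) * ?g \<xi>)"
    by (subst integral_mult_right_zero[symmetric]) (simp add: mult.assoc)
  finally show ?thesis unfolding rl_kernel_integral_def using g by simp
qed

text \<open>
  The time integral of \<open>E (l * \<tau> powr a)\<close> from the previous lemma is differentiated under the Fourier integral.
\<close>

lemma gaussian_solution_rl_derivative:
  fixes x :: "'a::euclidean_space"
  assumes \<epsilon>: "0 < \<epsilon>" and t: "0 < t"
  shows "has_rl_derivative a (\<lambda>\<tau>. gaussian_solution \<epsilon> \<tau> x - gaussian_solution \<epsilon> 0 x)
    (- (LINT \<xi>|lborel. cos (x \<bullet> \<xi>) * (norm \<xi> powr b * symbol \<epsilon> t \<xi>))) t"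
  unfolding has_rl_derivative_def
proof (intro conjI allI impI)
  fix s :: real assume s: "0 < s"
  define C where "C = (LINT \<xi>::'a|lborel. 2 * exp (- \<epsilon> * (norm \<xi>)\<^sup>2))"
  have bound: "\<bar>gaussian_solution \<epsilon> \<tau> x - gaussian_solution \<epsilon> 0 x\<bar> \<le> C" for \<tau>
  proof -
    let ?h = "\<lambda>\<xi>. (E (norm \<xi> powr b * \<tau> powr a) - 1) * (cos (x \<bullet> \<xi>) * exp (- \<epsilon> * (norm \<xi>)\<^sup>2))"
    have h: "norm (?h \<xi>) \<le> 2 * exp (- \<epsilon> * (norm \<xi>)\<^sup>2)" for \<xi>
    proof -
      have "\<bar>E (norm \<xi> powr b * \<tau> powr a) - 1\<bar> \<le> 2"
        using mittag_leffler_bounds(3)[of "norm \<xi> powr b * \<tau> powr a"] by auto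
      then have "\<bar>E (norm \<xi> powr b * \<tau> powr a) - 1\<bar> * (\<bar>cos (x \<bullet> \<xi>)\<bar> * exp (- \<epsilon> * (norm \<xi>)\<^sup>2)) \<le> 2 * (1 * exp (- \<epsilon> * (norm \<xi>)\<^sup>2))"
        by (intro mult_mono mult_nonneg_nonneg abs_cos_le_one order_refl) auto
      then show ?thesis by (simp add: abs_mult)
    qed
    have gint: "integrable lborel (\<lambda>\<xi>::'a. 2 * exp (- \<epsilon> * (norm \<xi>)\<^sup>2))"
      by (intro integrable_mult_right gaussian_fourier(1) \<epsilon>)
    have "integrable lborel ?h"
      by (rule Bochner_Integration.integrable_bound[OF gint]) (use h in \<open>auto intro!: AE_I2 elim: order_trans[OF _ abs_ge_self]\<close>)
    have "norm (LINT \<xi>|lborel. ?h \<xi>) \<le> (LINT \<xi>|lborel. norm (?h \<xi>))" by (rule integral_norm_bound)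
    also have "\<dots> \<le> C" unfolding C_def
      by (intro integral_mono integrable_norm \<open>integrable lborel ?h\<close> gint h)
    finally show ?thesis unfolding gaussian_solution_increment[OF \<epsilon>] by simp
  qed
  have "set_integrable lborel {0<..<s} (\<lambda>\<tau>. (s - \<tau>) powr (- a) * (gaussian_solution \<epsilon> \<tau> x - gaussian_solution \<epsilon> 0 x))"
    unfolding set_integrable_def
  proof (rule Bochner_Integration.integrable_bound)
    show "integrable lborel (\<lambda>\<tau>. C * (indicator {0<..<s} \<tau> *\<^sub>R (s - \<tau>) powr (- a)))"
      using abel_integral_relaxation(2)[OF s order_refl] unfolding set_integrable_def by (rule integrable_mult_right)
    show "AE \<tau> in lborel. norm (indicator {0<..<s} \<tau> *\<^sub>R ((s - \<tau>) powr (- a) * (gaussian_solution \<epsilon> \<tau> x - gaussian_solution \<epsilon> 0 x)))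
       \<le> norm (C * (indicator {0<..<s} \<tau> *\<^sub>R (s - \<tau>) powr (- a)))"
      using bound by (intro AE_I2) (auto simp: abs_mult indicator_def mult.commute[of C] intro!: mult_left_mono order_trans[OF bound abs_ge_self])
  qed measurable
  then show "set_integrable lborel {0..s} (\<lambda>\<tau>. (s - \<tau>) powr (- a) * (gaussian_solution \<epsilon> \<tau> x - gaussian_solution \<epsilon> 0 x))"
    by (subst set_integral_Icc_eq_Ioo(1)) measurable
next
  let ?g = "\<lambda>\<xi>::'a. cos (x \<bullet> \<xi>) * exp (- \<epsilon> * (norm \<xi>)\<^sup>2)"
  let ?A = "\<lambda>s \<xi>::'a. LBINT \<tau>:{0<..<s}. E (norm \<xi> powr b * \<tau> powr a)"
  have wb: "integrable lborel (\<lambda>\<xi>::'a. norm \<xi> powr b * exp (- \<epsilon> * (norm \<xi>)\<^sup>2))"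
    by (rule rapidly_decaying_integrable, rule rapidly_decaying_mult[OF rapidly_decaying_gaussian[OF \<epsilon>], of _ 1 2])
       (use b in \<open>auto intro: norm_powr_le\<close>)
  have [measurable]: "?A s \<in> borel_measurable borel" for s
    unfolding set_lebesgue_integral_def by measurable
  have "((\<lambda>s. LINT \<xi>|lborel. - (norm \<xi> powr b * ?A s \<xi>) * ?g \<xi>) has_derivative
     (\<lambda>v. LINT \<xi>|lborel. v * (- (norm \<xi> powr b * E (norm \<xi> powr b * t powr a)) * ?g \<xi>))) (at t)"
  proof (rule has_derivative_integral[where e = t and B = "\<lambda>\<xi>. norm \<xi> powr b * exp (- \<epsilon> * (norm \<xi>)\<^sup>2)"])
    fix s assume s: "s \<in> ball t t"
    then have s: "0 < s" by (auto simp: dist_real_def)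
    show "integrable lborel (\<lambda>\<xi>. - (norm \<xi> powr b * ?A s \<xi>) * ?g \<xi>)"
    proof (rule Bochner_Integration.integrable_bound[OF integrable_mult_right[OF wb, of s]])
      show "AE \<xi> in lborel. norm (- (norm \<xi> powr b * ?A s \<xi>) * ?g \<xi>) \<le> norm (s * (norm \<xi> powr b * exp (- \<epsilon> * (norm \<xi>)\<^sup>2)))"
      proof (rule AE_I2)
        fix \<xi> :: 'a
        have "norm \<xi> powr b * \<bar>?A s \<xi>\<bar> * (\<bar>cos (x \<bullet> \<xi>)\<bar> * exp (- \<epsilon> * (norm \<xi>)\<^sup>2)) \<le> norm \<xi> powr b * s * (1 * exp (- \<epsilon> * (norm \<xi>)\<^sup>2))"
          using relaxation_antiderivative(2)[OF s, of "norm \<xi> powr b"] s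
          by (intro mult_mono mult_nonneg_nonneg abs_cos_le_one order_refl) auto
        then show "norm (- (norm \<xi> powr b * ?A s \<xi>) * ?g \<xi>) \<le> norm (s * (norm \<xi> powr b * exp (- \<epsilon> * (norm \<xi>)\<^sup>2)))"
          using s by (simp add: abs_mult mult_ac)
      qed
    qed measurable
    fix \<xi> :: 'a
    have "((\<lambda>s. - (norm \<xi> powr b * ?A s \<xi>) * ?g \<xi>) has_real_derivative - (norm \<xi> powr b * E (norm \<xi> powr b * s powr a)) * ?g \<xi>) (at s)"
      by (intro DERIV_cmult_right DERIV_minus DERIV_cmult relaxation_antiderivative(1)[OF s]) auto
    then show "((\<lambda>s. - (norm \<xi> powr b * ?A s \<xi>) * ?g \<xi>) has_derivative (\<lambda>v. v * (- (norm \<xi> powr b * E (norm \<xi> powr b * s powr a)) * ?g \<xi>))) (at s)"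
      unfolding has_field_derivative_def mult_commute_abs .
    fix v
    have "\<bar>v\<bar> * (norm \<xi> powr b * \<bar>E (norm \<xi> powr b * s powr a)\<bar> * (\<bar>cos (x \<bullet> \<xi>)\<bar> * exp (- \<epsilon> * (norm \<xi>)\<^sup>2)))
        \<le> \<bar>v\<bar> * (norm \<xi> powr b * 1 * (1 * exp (- \<epsilon> * (norm \<xi>)\<^sup>2)))"
      by (intro mult_mono mult_nonneg_nonneg abs_cos_le_one order_refl mittag_leffler_bounds) auto
    then show "\<bar>v * (- (norm \<xi> powr b * E (norm \<xi> powr b * s powr a)) * ?g \<xi>)\<bar> \<le> norm \<xi> powr b * exp (- \<epsilon> * (norm \<xi>)\<^sup>2) * norm v"
      by (simp add: abs_mult mult_ac)
  next
    show "(\<lambda>\<xi>. v * (- (norm \<xi> powr b * E (norm \<xi> powr b * t powr a)) * ?g \<xi>)) \<in> borel_measurable lborel" for v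
      by measurable
  qed (use t wb in auto)
  also have "(\<lambda>v. LINT \<xi>|lborel. v * (- (norm \<xi> powr b * E (norm \<xi> powr b * t powr a)) * ?g \<xi>))
      = (*) (- (LINT \<xi>|lborel. cos (x \<bullet> \<xi>) * (norm \<xi> powr b * symbol \<epsilon> t \<xi>)))"
  proof
    fix v
    have "- (norm \<xi> powr b * E (norm \<xi> powr b * t powr a)) * ?g \<xi> = - (cos (x \<bullet> \<xi>) * (norm \<xi> powr b * symbol \<epsilon> t \<xi>))" for \<xi>
      by (simp add: symbol_def mult_ac)
    then show "(LINT \<xi>|lborel. v * (- (norm \<xi> powr b * E (norm \<xi> powr b * t powr a)) * ?g \<xi>))
      = - (LINT \<xi>|lborel. cos (x \<bullet> \<xi>) * (norm \<xi> powr b * symbol \<epsilon> t \<xi>)) * v"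
      by (simp only: integral_mult_right_zero Bochner_Integration.integral_minus) simp
  qed
  finally have D: "((\<lambda>s. LINT \<xi>|lborel. - (norm \<xi> powr b * ?A s \<xi>) * ?g \<xi>) has_real_derivative
      - (LINT \<xi>|lborel. cos (x \<bullet> \<xi>) * (norm \<xi> powr b * symbol \<epsilon> t \<xi>))) (at t)"
    by (simp only: has_field_derivative_def)
  show "(rl_kernel_integral a (\<lambda>\<tau>. gaussian_solution \<epsilon> \<tau> x - gaussian_solution \<epsilon> 0 x) has_real_derivative
      - (LINT \<xi>|lborel. cos (x \<bullet> \<xi>) * (norm \<xi> powr b * symbol \<epsilon> t \<xi>))) (at t)"
    by (rule has_field_derivative_transform_within_open[OF D, of "{0<..}"])
       (use t in \<open>auto simp: gaussian_solution_rl_kernel_integral[OF \<epsilon>]\<close>)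
qed

lemma gaussian_solution_classical:
  assumes d: "b \<le> real DIM('a::euclidean_space)" and \<epsilon>: "0 < \<epsilon>"
  shows "classical_solution a b (gaussian_solution \<epsilon> :: real \<Rightarrow> 'a \<Rightarrow> real)"
  unfolding classical_solution_def
proof (intro conjI allI impI gaussian_solution_continuous \<epsilon>)
  fix t :: real assume t: "0 < t"
  show "frac_laplacian_dom b (\<lambda>x::'a. of_real (gaussian_solution \<epsilon> t x))"
    by (rule gaussian_solution_frac_laplacian[OF d \<epsilon> less_imp_le[OF t]])
  fix x :: 'a
  show "\<exists>D. has_rl_derivative a (\<lambda>\<tau>. gaussian_solution \<epsilon> \<tau> x - gaussian_solution \<epsilon> 0 x) D t \<and> of_real D + frac_laplacian b (\<lambda>y. of_real (gaussian_solution \<epsilon> t y)) x = 0"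
    using gaussian_solution_rl_derivative[OF \<epsilon> t, of x]
    unfolding gaussian_solution_frac_laplacian(2)[OF d \<epsilon> less_imp_le[OF t]] by (intro exI conjI) auto
qed

end

section \<open>Failure of the Harnack inequality\<close>

theorem theorem2p2:
  fixes \<alpha> \<beta> :: real
  assumes "0 < \<alpha>" and "\<alpha> < 1" and "0 < \<beta>" and "\<beta> \<le> 2"
    and "real DIM('a::euclidean_space) \<ge> \<beta>"
  shows "(\<exists>u :: nat \<Rightarrow> real \<Rightarrow> 'a \<Rightarrow> real.
      (\<forall>n. classical_solution \<alpha> \<beta> (u n) \<and>
           smooth_on ({0<..} \<times> UNIV) (\<lambda>(t, x). u n t x) \<and>
           (\<forall>t>0. \<forall>x. u n t x > 0)) \<and>
      (\<forall>t\<^sub>1>0. \<forall>t\<^sub>2>0. \<forall>x\<^sub>0. x\<^sub>0 \<noteq> 0 \<longrightarrow>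
         filterlim (\<lambda>n. u n t\<^sub>1 0 / u n t\<^sub>2 x\<^sub>0) at_top sequentially)) \<and>
    (\<forall>a\<^sub>1 a\<^sub>2 \<delta>\<^sub>1 a\<^sub>3 a\<^sub>4 \<delta>\<^sub>2. 0 \<le> a\<^sub>1 \<and> a\<^sub>1 < a\<^sub>2 \<and> a\<^sub>2 \<le> a\<^sub>3 \<and> a\<^sub>3 < a\<^sub>4 \<and> 0 < \<delta>\<^sub>1 \<and> 0 < \<delta>\<^sub>2 \<longrightarrow>
      \<not> local_harnack TYPE('a) \<alpha> \<beta> a\<^sub>1 a\<^sub>2 \<delta>\<^sub>1 a\<^sub>3 a\<^sub>4 \<delta>\<^sub>2)"
proof -
  note ab = assms(1-4) and d = assms(5)
  define u :: "nat \<Rightarrow> real \<Rightarrow> 'a \<Rightarrow> real" where "u n = gaussian_solution \<alpha> \<beta> (1 / real (Suc n))" for n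
  have e: "0 < 1 / real (Suc n)" for n by simp
  have sol: "classical_solution \<alpha> \<beta> (u n)" for n
    unfolding u_def by (rule gaussian_solution_classical[OF ab d e])
  have smooth: "smooth_on ({0<..} \<times> UNIV) (\<lambda>(t, x). u n t x)" for n
    unfolding u_def by (rule gaussian_solution_smooth[OF ab e])
  have pos: "0 < u n t x" if "0 \<le> t" for n t x
    unfolding u_def by (rule gaussian_solution_pos[OF ab d e that])
  have ratio: "filterlim (\<lambda>n. u n t\<^sub>1 0 / u n t\<^sub>2 x\<^sub>0) at_top sequentially" if "0 < t\<^sub>1" "0 < t\<^sub>2" "x\<^sub>0 \<noteq> 0" for t\<^sub>1 t\<^sub>2 x\<^sub>0
    unfolding u_def by (rule gaussian_solution_ratio[OF ab d]) (use that in auto)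
  have "\<not> local_harnack TYPE('a) \<alpha> \<beta> a\<^sub>1 a\<^sub>2 \<delta>\<^sub>1 a\<^sub>3 a\<^sub>4 \<delta>\<^sub>2"
    if shape: "0 \<le> a\<^sub>1" "a\<^sub>1 < a\<^sub>2" "a\<^sub>2 \<le> a\<^sub>3" "a\<^sub>3 < a\<^sub>4" "0 < \<delta>\<^sub>1" "0 < \<delta>\<^sub>2" for a\<^sub>1 a\<^sub>2 \<delta>\<^sub>1 a\<^sub>3 a\<^sub>4 \<delta>\<^sub>2
  proof
    assume "local_harnack TYPE('a) \<alpha> \<beta> a\<^sub>1 a\<^sub>2 \<delta>\<^sub>1 a\<^sub>3 a\<^sub>4 \<delta>\<^sub>2"
    then obtain C where C: "0 < C" and harnack: "\<forall>t\<^sub>0\<ge>0. \<forall>x\<^sub>0::'a. \<forall>r>0. \<forall>u.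
        classical_solution \<alpha> \<beta> u \<and> (\<forall>t\<ge>0. \<forall>x. u t x \<ge> 0) \<longrightarrow>
        (SUP (t, x) \<in> cylinder \<alpha> \<beta> a\<^sub>1 a\<^sub>2 \<delta>\<^sub>1 t\<^sub>0 x\<^sub>0 r. ereal (u t x))
          \<le> ereal C * (INF (t, x) \<in> cylinder \<alpha> \<beta> a\<^sub>3 a\<^sub>4 \<delta>\<^sub>2 t\<^sub>0 x\<^sub>0 r. ereal (u t x))"
      unfolding local_harnack_def by (elim exE conjE) (rule that)
    have harnack_at_0: "(SUP (t, x) \<in> cylinder \<alpha> \<beta> a\<^sub>1 a\<^sub>2 \<delta>\<^sub>1 0 (0::'a) 1. ereal (u n t x))
          \<le> ereal C * (INF (t, x) \<in> cylinder \<alpha> \<beta> a\<^sub>3 a\<^sub>4 \<delta>\<^sub>2 0 (0::'a) 1. ereal (u n t x))" for n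
      using harnack[rule_format, of 0 1 "u n" 0] sol[of n] pos[of _ n] by (simp add: less_imp_le)
    \<comment> \<open>The scale \<open>r = 1\<close> is used; any point of the later cylinder off the axis \<open>x = 0\<close> would do for \<open>(t\<^sub>2, x\<^sub>0)\<close>.\<close>
    define t\<^sub>1 t\<^sub>2 where "t\<^sub>1 = (a\<^sub>1 + a\<^sub>2) / 2" and "t\<^sub>2 = (a\<^sub>3 + a\<^sub>4) / 2"
    define x\<^sub>0 :: 'a where "x\<^sub>0 = (\<delta>\<^sub>2 / 2) *\<^sub>R (SOME i. i \<in> Basis)"
    have t: "0 < t\<^sub>1" "0 < t\<^sub>2" "x\<^sub>0 \<noteq> 0"
      using shape by (auto simp: t\<^sub>1_def t\<^sub>2_def x\<^sub>0_def SOME_Basis nonzero_Basis)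
    have in1: "(t\<^sub>1, 0) \<in> cylinder \<alpha> \<beta> a\<^sub>1 a\<^sub>2 \<delta>\<^sub>1 0 (0::'a) 1"
      using shape by (simp add: cylinder_def t\<^sub>1_def)
    have in2: "(t\<^sub>2, x\<^sub>0) \<in> cylinder \<alpha> \<beta> a\<^sub>3 a\<^sub>4 \<delta>\<^sub>2 0 (0::'a) 1"
      using shape by (simp add: cylinder_def t\<^sub>2_def x\<^sub>0_def SOME_Basis)
    have "u n t\<^sub>1 0 / u n t\<^sub>2 x\<^sub>0 \<le> C" for n
    proof -
      have "ereal (u n t\<^sub>1 0) \<le> (SUP (t, x) \<in> cylinder \<alpha> \<beta> a\<^sub>1 a\<^sub>2 \<delta>\<^sub>1 0 (0::'a) 1. ereal (u n t x))"
        by (rule SUP_upper2[OF in1]) simp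
      also have "\<dots> \<le> ereal C * (INF (t, x) \<in> cylinder \<alpha> \<beta> a\<^sub>3 a\<^sub>4 \<delta>\<^sub>2 0 (0::'a) 1. ereal (u n t x))"
        by (rule harnack_at_0)
      also have "\<dots> \<le> ereal C * ereal (u n t\<^sub>2 x\<^sub>0)"
        using C by (intro ereal_mult_left_mono INF_lower2[OF in2]) auto
      finally have "u n t\<^sub>1 0 \<le> C * u n t\<^sub>2 x\<^sub>0" by simp
      moreover have "0 < u n t\<^sub>2 x\<^sub>0" using t by (intro pos) auto
      ultimately show ?thesis by (simp add: pos_divide_le_eq)
    qed
    moreover have "\<forall>\<^sub>F n in sequentially. C < u n t\<^sub>1 0 / u n t\<^sub>2 x\<^sub>0"
      using ratio[OF t] by (simp add: filterlim_at_top_dense)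
    then obtain n where "C < u n t\<^sub>1 0 / u n t\<^sub>2 x\<^sub>0"
      by (auto simp: eventually_sequentially)
    ultimately show False by (simp add: not_less[symmetric])
  qed
  with sol smooth pos ratio show ?thesis by (intro conjI exI[of _ u]) auto
qed

end
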